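(* Let $p\in(0,1/2)$, let $X$ be a real-valued random variable which is not almost surely constant and which satisfies $\mathbb{E}(X^2)<\infty$, and let $\hat S$ be a step reinforced random walk with reinforcement parameter $p$ and typical step distributed as $X$. Then, as $n\to\infty$, the sequence of processes $$\frac{\hat S(\lfloor tn\rfloor)-tn\,\mathbb{E}(X)}{\sqrt{n\,\mathrm{Var}(X)}},\qquad t\geq 0,$$ converges in distribution in the sense of Skorokhod towards a noise reinforced Brownian motion $\hat B=(\hat B(t))_{t\ge 0}$ with reinforcement parameter $p$.
   Context: Step reinforced random walk. Let $X_1,X_2,\ldots$ be i.i.d. copies of a real random variable $X$. Let $(\varepsilon_i)_{i\ge 2}$ be i.i.d. Bernoulli variables with parameter $p$ (i.e. $\mathbb{P}(\varepsilon_i=1)=p$) and let $(U_i)_{i\geq 2}$ be independent random variables with $U_i$ uniform on $\{1,\ldots,i-1\}$; the sequences $(X_i)$, $(\varepsilon_i)$, $(U_i)$ are independent. Set $\hat X_1=X_1$ and, for $i\ge 2$, $\hat X_i=X_i$ if $\varepsilon_i=0$ and $\hat X_i=\hat X_{U_i}$ if $\varepsilon_i=1$. The step reinforced random walk with reinforcement parameter $p$ and typical step distributed as $X$ is $\hat S(n)=\hat X_1+\cdots+\hat X_n$, $n\ge 1$, with $\hat S(0)=0$. Noise reinforced Brownian motion. For $p\in(0,1/2)$, a noise reinforced Brownian motion with reinforcement parameter $p$ is a continuous centered Gaussian process $\hat B=(\hat B(t))_{t\geq 0}$ with covariance $\mathbb{E}(\hat B(t)\hat B(s))=\dfrac{t^p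 s^{1-p}}{1-2p}$ for $0\le s\le t$ (equal to $0$ when $s=0$). Convergence in distribution in the sense of Skorokhod means weak convergence of laws on the space of càdlàg functions $[0,\infty)\to\mathbb{R}$ endowed with the Skorokhod ($J_1$) topology. *)

theory Defs
  imports "HOL-Probability.Probability"
begin

section \<open>Step reinforced random walks\<close>

text \<open>
  The reinforced sequence for fixed values \<open>x\<close>, \<open>e\<close>, \<open>u\<close> of the sequences \<open>(X\<^sub>i)\<close>,
  \<open>(\<epsilon>\<^sub>i)\<close> (with \<open>True\<close> for 1) and \<open>(U\<^sub>i)\<close>. The test \<open>u i \<in> {1..<i}\<close> makes the recursion
  terminate; below it fails at most on a null event, since \<open>U\<^sub>i\<close> is uniform on \<open>{1..<i}\<close>.
\<close>

function reinforced :: "(nat \<Rightarrow> real) \<Rightarrow> (nat \<Rightarrow> bool) \<Rightarrow> (nat \<Rightarrow> nat) \<Rightarrow> nat \<Rightarrow> real" where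
  "reinforced x e u i =
     (if 2 \<le> i \<and> e i \<and> u i \<in> {1..<i} then reinforced x e u (u i) else x i)"
  by auto
termination
  by (relation "Wellfounded.measure (\<lambda>(x, e, u, i). i)") auto

declare reinforced.simps [simp del]

definition generated_events ::
    "'a measure \<Rightarrow> 'i set \<Rightarrow> 'b measure \<Rightarrow> ('i \<Rightarrow> 'a \<Rightarrow> 'b) \<Rightarrow> 'a set set" where
  "generated_events M I N Y =
     sigma_sets (space M) (\<Union>i\<in>I. {Y i -` A \<inter> space M | A. A \<in> sets N})"

definition reinforcement_data ::
    "real \<Rightarrow> real measure \<Rightarrow> 'a measure \<Rightarrow> (nat \<Rightarrow> 'a \<Rightarrow> real) \<Rightarrow> (nat \<Rightarrow> 'a \<Rightarrow> bool) \<Rightarrow>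
     (nat \<Rightarrow> 'a \<Rightarrow> nat) \<Rightarrow> bool" where
  "reinforcement_data p \<mu> M X \<epsilon> U \<longleftrightarrow>
     prob_space M \<and>
     prob_space.indep_vars M (\<lambda>_. borel) X {1..} \<and>
     (\<forall>i\<ge>1. distr M borel (X i) = \<mu>) \<and>
     prob_space.indep_vars M (\<lambda>_. count_space UNIV) \<epsilon> {2..} \<and>
     (\<forall>i\<ge>2. distr M (count_space UNIV) (\<epsilon> i) = measure_pmf (bernoulli_pmf p)) \<and>
     prob_space.indep_vars M (\<lambda>_. count_space UNIV) U {2..} \<and>
     (\<forall>i\<ge>2. distr M (count_space UNIV) (U i) = measure_pmf (pmf_of_set {1..<i})) \<and>
     prob_space.indep_sets M
       (\<lambda>k. [generated_events M {1..} borel X,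
             generated_events M {2..} (count_space UNIV) \<epsilon>,
             generated_events M {2..} (count_space UNIV) U] ! k) {..<3::nat}"

definition step_reinforced_random_walk ::
    "real \<Rightarrow> real measure \<Rightarrow> 'a measure \<Rightarrow> (nat \<Rightarrow> 'a \<Rightarrow> real) \<Rightarrow> bool" where
  "step_reinforced_random_walk p \<mu> M S \<longleftrightarrow>
     (\<exists>X \<epsilon> U. reinforcement_data p \<mu> M X \<epsilon> U \<and>
        (\<forall>n. \<forall>\<omega>\<in>space M.
           S n \<omega> = (\<Sum>i=1..n. reinforced (\<lambda>j. X j \<omega>) (\<lambda>j. \<epsilon> j \<omega>) (\<lambda>j. U j \<omega>) i)))"


section \<open>Noise reinforced Brownian motion\<close>

text \<open>Degenerate (almost surely constant) variables count as Gaussian.\<close>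

definition gaussian_variable :: "'a measure \<Rightarrow> ('a \<Rightarrow> real) \<Rightarrow> bool" where
  "gaussian_variable M Y \<longleftrightarrow>
     Y \<in> borel_measurable M \<and>
     ((\<exists>m \<sigma>. 0 < \<sigma> \<and> distributed M lborel Y (\<lambda>x. ennreal (normal_density m \<sigma> x))) \<or>
      (\<exists>c. AE \<omega> in M. Y \<omega> = c))"

definition gaussian_process :: "'a measure \<Rightarrow> 't set \<Rightarrow> ('t \<Rightarrow> 'a \<Rightarrow> real) \<Rightarrow> bool" where
  "gaussian_process M I Y \<longleftrightarrow>
     (\<forall>F a. finite F \<and> F \<subseteq> I \<longrightarrow> gaussian_variable M (\<lambda>\<omega>. \<Sum>t\<in>F. a t * Y t \<omega>))"

text \<open>As \<open>0 powr (1 - p) = 0\<close>, the covariance formula gives 0 for \<open>s = 0\<close>.\<close>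

definition noise_reinforced_brownian_motion ::
    "real \<Rightarrow> 'a measure \<Rightarrow> (real \<Rightarrow> 'a \<Rightarrow> real) \<Rightarrow> bool" where
  "noise_reinforced_brownian_motion p M B \<longleftrightarrow>
     prob_space M \<and>
     (\<forall>\<omega>\<in>space M. continuous_on {0..} (\<lambda>t. B t \<omega>)) \<and>
     gaussian_process M {0..} B \<and>
     (\<forall>t\<ge>0. prob_space.expectation M (B t) = 0) \<and>
     (\<forall>s t. 0 \<le> s \<and> s \<le> t \<longrightarrow>
        prob_space.expectation M (\<lambda>\<omega>. B t \<omega> * B s \<omega>) = t powr p * s powr (1 - p) / (1 - 2 * p))"


section \<open>The Skorokhod space\<close>

text \<open>Paths are functions on \<open>{0..}\<close>, hence \<open>undefined\<close> at negative times.\<close>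

definition cadlag_paths :: "(real \<Rightarrow> real) set" where
  "cadlag_paths =
     {x \<in> extensional {0..}.
        (\<forall>t\<ge>0. (x \<longlongrightarrow> x t) (at_right t)) \<and> (\<forall>t>0. \<exists>l. (x \<longlongrightarrow> l) (at_left t))}"

text \<open>An increasing bijection of \<open>{0..}\<close> is automatically a homeomorphism fixing 0.\<close>

definition time_changes :: "(real \<Rightarrow> real) set" where
  "time_changes = {l. strict_mono_on {0..} l \<and> l ` {0..} = {0..}}"

definition skorokhod_convergent :: "(nat \<Rightarrow> real \<Rightarrow> real) \<Rightarrow> (real \<Rightarrow> real) \<Rightarrow> bool" where
  "skorokhod_convergent xs x \<longleftrightarrow>
     (\<exists>l. (\<forall>n. l n \<in> time_changes) \<and>
          uniform_limit {0..} l (\<lambda>t. t) sequentially \<and>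
          (\<forall>T. uniform_limit {0..T} (\<lambda>n t. xs n (l n t)) x sequentially))"

text \<open>
  The J1 topology is metrizable and its convergent sequences are those above (Jacod and Shiryaev,
  Limit Theorems for Stochastic Processes, Theorem VI.1.14). Since metrizable topologies are
  sequential, its open sets are exactly the sequentially open ones.
\<close>

definition skorokhod_topology :: "(real \<Rightarrow> real) topology" where
  "skorokhod_topology = topology (\<lambda>V. V \<subseteq> cadlag_paths \<and>
     (\<forall>xs. \<forall>x\<in>V. (\<forall>n. xs n \<in> cadlag_paths) \<and> skorokhod_convergent xs x \<longrightarrow>
        (\<forall>\<^sub>F n in sequentially. xs n \<in> V)))"

lemma openin_skorokhod_topology:
  "openin skorokhod_topology V \<longleftrightarrow> V \<subseteq> cadlag_paths \<and>
     (\<forall>xs. \<forall>x\<in>V. (\<forall>n. xs n \<in> cadlag_paths) \<and> skorokhod_convergent xs x \<longrightarrow>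
        (\<forall>\<^sub>F n in sequentially. xs n \<in> V))"
proof -
  let ?P = "\<lambda>V. V \<subseteq> cadlag_paths \<and>
     (\<forall>xs. \<forall>x\<in>V. (\<forall>n. xs n \<in> cadlag_paths) \<and> skorokhod_convergent xs x \<longrightarrow>
        (\<forall>\<^sub>F n in sequentially. xs n \<in> V))"
  have "?P (V \<inter> W)" if "?P V" "?P W" for V W
    using that by (auto simp: eventually_conj_iff)
  moreover have "?P (\<Union>\<K>)" if *: "\<forall>V\<in>\<K>. ?P V" for \<K>
  proof (intro conjI allI ballI impI)
    show "\<Union>\<K> \<subseteq> cadlag_paths"
      using * by blast
  next
    fix xs x
    assume "x \<in> \<Union>\<K>" and xs: "(\<forall>n. xs n \<in> cadlag_paths) \<and> skorokhod_convergent xs x"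
    then obtain V where "V \<in> \<K>" "x \<in> V"
      by blast
    then have "\<forall>\<^sub>F n in sequentially. xs n \<in> V"
      using * xs by blast
    then show "\<forall>\<^sub>F n in sequentially. xs n \<in> \<Union>\<K>"
      by (rule eventually_mono) (use \<open>V \<in> \<K>\<close> in blast)
  qed
  ultimately have "istopology ?P"
    unfolding istopology_def by blast
  then show ?thesis
    unfolding skorokhod_topology_def by (simp add: topology_inverse')
qed

lemma topspace_skorokhod_topology: "topspace skorokhod_topology = cadlag_paths"
  unfolding topspace_def openin_skorokhod_topology by auto


section \<open>Convergence in distribution\<close>

definition borel_of_topology :: "'x topology \<Rightarrow> 'x measure" where
  "borel_of_topology T = sigma (topspace T) {V. openin T V}"

definition weakly_convergent :: "'x topology \<Rightarrow> (nat \<Rightarrow> 'x measure) \<Rightarrow> 'x measure \<Rightarrow> bool" where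
  "weakly_convergent T \<mu> \<nu> \<longleftrightarrow>
     (\<forall>f. continuous_map T euclideanreal f \<and> bounded (f ` topspace T) \<longrightarrow>
        (\<lambda>n. \<integral>x. f x \<partial>\<mu> n) \<longlonglongrightarrow> (\<integral>x. f x \<partial>\<nu>))"

definition converges_in_distribution ::
    "'x topology \<Rightarrow> 'a measure \<Rightarrow> (nat \<Rightarrow> 'a \<Rightarrow> 'x) \<Rightarrow> 'b measure \<Rightarrow> ('b \<Rightarrow> 'x) \<Rightarrow> bool" where
  "converges_in_distribution T M Y N Z \<longleftrightarrow>
     (\<forall>n. Y n \<in> measurable M (borel_of_topology T)) \<and>
     Z \<in> measurable N (borel_of_topology T) \<and>
     weakly_convergent T (\<lambda>n. distr M (borel_of_topology T) (Y n))
       (distr N (borel_of_topology T) Z)"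

end

theory Submission imports Defs begin

text \<open>
  Every step of the walk repeats one original step \<open>X j\<close>, so \<open>W n = (\<Sum>j. cluster n j * X j)\<close>, where
  \<open>cluster n j\<close> counts the copies of \<open>X j\<close> made up to time \<open>n\<close> and is independent of the \<open>X j\<close>.
  Conditionally on the cluster sizes the walk is a weighted sum of i.i.d. variables: its finite
  dimensional limits are governed by \<open>\<Sum>j. cluster m j * cluster n j\<close>, which concentrates around
  its mean with the covariance of the limit, while \<open>p < 1 / 2\<close> makes
  \<open>\<Sum>j. (cluster n j)^3\<close> negligible at scale \<open>n powr (3 / 2)\<close>. For tightness,
  \<open>W n / growth p n\<close> is a martingale; Doob's maximal inequality bounds its oscillation over a block of
  length \<open>n / k\<close> by a truncated second moment of the increment, which converges to that of a Gaussian
  variable with variance \<open>O(1 / k)\<close> and hence is \<open>O(1 / k^2)\<close>, so that the union bound over the blocks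
  tends to \<open>0\<close> with \<open>k\<close>. As the limit is continuous, only locally uniform closeness of
  paths is needed, and functions that are continuous for the Skorokhod topology are approximated from below by
  functions that are Lipschitz for a metric of locally uniform convergence.
\<close>


section \<open>Random recursive trees and their cluster sizes\<close>

text \<open>Only second moments of the steps are available, so increments of the walk admit no
  fourth moment bound. Fourth moments are therefore taken of the limit: for fixed \<open>k\<close>,
  the second moment of a block increment and the expectation of its bounded continuous truncation
  \<open>min (x^2) \<eta>\<close> both converge as \<open>n\<close> grows, hence so does their
  difference, which for the Gaussian limit is at most its fourth moment over \<open>\<eta>\<close>.
  For the same reason the characteristic function of a step is compared with the Gaussian one up to
  \<open>\<delta> * t^2 + K * |t|^3\<close>, and the cubic part is summed over cluster sizes, never
  over moments of \<open>X\<close>. The recursions for cubes and for squared deviations have rates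
  \<open>3 * p\<close> and \<open>4 * p\<close>; the requirements \<open>3 * p < 3 / 2\<close> and
  \<open>4 * p < 2\<close> are where \<open>p < 1 / 2\<close> enters, besides
  \<open>2 * p < 1\<close> for the means. A functional of a whole path reads all grid times
  \<open>l / k\<close>, so the grid values form one random point of
  \<open>nat \<Rightarrow> real\<close>; weak convergence there is reduced by the Stone-Weierstrass
  theorem to cosines of finite linear combinations.\<close>

definition growth :: "real \<Rightarrow> nat \<Rightarrow> real" where
  "growth p n = (\<Prod>i\<in>{1..<n}. 1 + p / real i)"

lemma growth_0 [simp]: "growth p 0 = 1"
  by (simp add: growth_def)

text \<open>Since \<open>p / real 0 = 0\<close>, the recursion also holds at \<open>n = 0\<close>,
  where both products are empty.\<close>

lemma growth_Suc: "growth p (Suc n) = growth p n * (1 + p / real n)"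
  by (cases "n = 0") (simp_all add: growth_def)

lemma growth_pos: "0 \<le> p \<Longrightarrow> 0 < growth p n"
  unfolding growth_def by (intro prod_pos ballI add_pos_nonneg) auto

lemma growth_mono: "0 \<le> p \<Longrightarrow> m \<le> n \<Longrightarrow> growth p m \<le> growth p n"
proof (rule lift_Suc_mono_le[of "growth p"])
  fix n assume "0 \<le> p"
  then show "growth p n \<le> growth p (Suc n)"
    using growth_pos[of p n] by (simp add: growth_Suc distrib_left)
qed

text \<open>Each factor is \<open>(p + i) / i\<close>, so the product is a rising factorial over a
  factorial, which gives access to the asymptotics of the Gamma function.\<close>

lemma growth_pochhammer: "growth p (Suc n) = pochhammer (p + 1) n / fact n"
proof (induction n)
  case (Suc n)
  have "growth p (Suc (Suc n)) = pochhammer (p + 1) n / fact n * (1 + p / real (Suc n))"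
    by (simp add: growth_Suc[of p "Suc n"] Suc)
  also have "1 + p / real (Suc n) = (p + 1 + real n) / real (Suc n)"
    by (simp add: field_simps)
  finally show ?case by (simp add: pochhammer_Suc field_simps)
qed (simp add: growth_def)

text \<open>Euler's limit formula for \<open>Gamma p\<close>, inverted: the reciprocal of
  \<open>Gamma_series p n\<close> is \<open>p * growth p (Suc n) / n powr p\<close>. The shift from
  \<open>Suc n\<close> to \<open>n\<close> costs a ratio of powers that tends to
  \<open>1\<close>.\<close>

lemma growth_asymp:
  assumes "0 < p"
  shows "(\<lambda>n. growth p n / real n powr p) \<longlonglongrightarrow> inverse (Gamma (p + 1))"
proof -
  have "Gamma p \<noteq> 0"
    using Gamma_real_pos[OF assms] by linarith
  from tendsto_inverse[OF Gamma_series_LIMSEQ this]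
  have "(\<lambda>n. inverse (Gamma_series p n)) \<longlonglongrightarrow> inverse (Gamma p)" .
  then have "(\<lambda>n. inverse p * inverse (Gamma_series p n)) \<longlonglongrightarrow> inverse p * inverse (Gamma p)"
    by (rule tendsto_mult_left)
  moreover have "\<forall>\<^sub>F n in sequentially.
      inverse p * inverse (Gamma_series p n) = growth p (Suc n) / real n powr p"
    using eventually_gt_at_top[of 0]
  proof eventually_elim
    case (elim n)
    have "pochhammer p (n + 1) = p * pochhammer (p + 1) n"
      by (simp add: pochhammer_rec)
    then show ?case using elim assms
      by (simp add: Gamma_series_def growth_pochhammer powr_def field_simps)
  qed
  ultimately have 1: "(\<lambda>n. growth p (Suc n) / real n powr p) \<longlonglongrightarrow> inverse p * inverse (Gamma p)"
    by (rule Lim_transform_eventually)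
  have "(\<lambda>n. real n powr p / real (Suc n) powr p) \<longlonglongrightarrow> 1"
    by real_asymp
  from tendsto_mult[OF 1 this]
  have "(\<lambda>n. growth p (Suc n) / real n powr p * (real n powr p / real (Suc n) powr p))
     \<longlonglongrightarrow> inverse p * inverse (Gamma p)" by simp
  moreover have "\<forall>\<^sub>F n in sequentially.
      growth p (Suc n) / real n powr p * (real n powr p / real (Suc n) powr p)
       = growth p (Suc n) / real (Suc n) powr p"
    using eventually_gt_at_top[of 0] by eventually_elim simp
  ultimately have "(\<lambda>n. growth p (Suc n) / real (Suc n) powr p) \<longlonglongrightarrow> inverse p * inverse (Gamma p)"
    by (rule Lim_transform_eventually)
  then have "(\<lambda>n. growth p n / real n powr p) \<longlonglongrightarrow> inverse p * inverse (Gamma p)"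
    by (subst (asm) filterlim_sequentially_Suc)
  moreover have "Gamma (p + 1) = p * Gamma p"
    using assms by (intro Gamma_plus1) auto
  ultimately show ?thesis by simp
qed

section \<open>Expectation over random recursive trees\<close>

text \<open>Expectation of \<open>F r\<close>, where step \<open>i \<le> n\<close> is a copy of the original step \<open>r i\<close>, and
  \<open>r i = 0\<close> for all other \<open>i\<close>. Since \<open>p / 0 = 0\<close>, the first step is always an original one.\<close>

primrec tree_exp :: "real \<Rightarrow> nat \<Rightarrow> ((nat \<Rightarrow> nat) \<Rightarrow> real) \<Rightarrow> real" where
  "tree_exp p 0 F = F (\<lambda>_. 0)"
| "tree_exp p (Suc n) F = tree_exp p n (\<lambda>r.
     (1 - real n * (p / real n)) * F (r(Suc n := Suc n)) +
     p / real n * (\<Sum>u=1..n. F (r(Suc n := r u))))"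

text \<open>A superset of the attainable maps, as \<open>r (r i) = r i\<close> is not imposed; only
  the bounds enter the arguments below. The value \<open>0\<close> outside \<open>{1..n}\<close>
  makes the set finite and a tree determined by its values on \<open>{1..n}\<close>.\<close>

definition trees :: "nat \<Rightarrow> (nat \<Rightarrow> nat) set" where
  "trees n = {r. \<forall>i. if i \<in> {1..n} then r i \<in> {1..i} else r i = 0}"

lemma trees_0: "trees 0 = {\<lambda>_. 0}"
  by (auto simp: trees_def)

lemma trees_le: "r \<in> trees n \<Longrightarrow> r i \<le> i"
  by (cases "i \<in> {1..n}") (auto simp: trees_def split: if_splits dest!: spec[of _ i])

lemma trees_pos: "r \<in> trees n \<Longrightarrow> i \<in> {1..n} \<Longrightarrow> r i \<in> {1..n}"
  unfolding trees_def by (drule CollectD, drule spec[of _ i]) auto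

lemma trees_upd: "r \<in> trees n \<Longrightarrow> k \<in> {1..Suc n} \<Longrightarrow> r(Suc n := k) \<in> trees (Suc n)"
  unfolding trees_def
proof (intro CollectI allI)
  fix i assume r: "r \<in> {r. \<forall>i. if i \<in> {1..n} then r i \<in> {1..i} else r i = 0}" and k: "k \<in> {1..Suc n}"
  from r have "if i \<in> {1..n} then r i \<in> {1..i} else r i = 0" by blast
  with k show "if i \<in> {1..Suc n} then (r(Suc n := k)) i \<in> {1..i} else (r(Suc n := k)) i = 0"
    by (auto split: if_splits simp: le_Suc_eq)
qed

lemma trees_upd_root: "r \<in> trees n \<Longrightarrow> r(Suc n := Suc n) \<in> trees (Suc n)"
  by (rule trees_upd) auto

lemma trees_upd_copy: "r \<in> trees n \<Longrightarrow> u \<in> {1..n} \<Longrightarrow> r(Suc n := r u) \<in> trees (Suc n)"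
  using trees_pos[of r n u] by (intro trees_upd) auto

lemma tree_exp_cong: "(\<And>r. r \<in> trees n \<Longrightarrow> F r = G r) \<Longrightarrow> tree_exp p n F = tree_exp p n G"
proof (induction n arbitrary: F G)
  case (Suc n)
  show ?case unfolding tree_exp.simps
    by (intro Suc.IH arg_cong2[where f="(+)"] arg_cong2[where f="(*)"] refl sum.cong Suc.prems
        trees_upd_root trees_upd_copy)
qed (simp add: trees_0)

lemma tree_exp_mono:
  assumes "0 \<le> p" "p \<le> 1"
  shows "(\<And>r. r \<in> trees n \<Longrightarrow> F r \<le> G r) \<Longrightarrow> tree_exp p n F \<le> tree_exp p n G"
proof (induction n arbitrary: F G)
  case (Suc n)
  have "0 \<le> 1 - real n * (p / real n)" using assms by (cases "n = 0") auto
  then show ?case unfolding tree_exp.simps using assms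
    by (intro Suc.IH add_mono mult_left_mono sum_mono Suc.prems
        trees_upd_root trees_upd_copy) auto
qed (simp add: trees_0)

lemma tree_exp_add: "tree_exp p n (\<lambda>r. F r + G r) = tree_exp p n F + tree_exp p n G"
proof (induction n arbitrary: F G)
  case (Suc n)
  show ?case unfolding tree_exp.simps Suc.IH[symmetric]
    by (rule tree_exp_cong) (simp add: algebra_simps sum.distrib)
qed simp

lemma tree_exp_mult_left: "tree_exp p n (\<lambda>r. c * F r) = c * tree_exp p n F"
proof (induction n arbitrary: F)
  case (Suc n)
  show ?case unfolding tree_exp.simps Suc.IH[symmetric]
    by (rule tree_exp_cong) (simp add: algebra_simps sum_distrib_left)
qed simp

lemma tree_exp_const [simp]: "tree_exp p n (\<lambda>_. c) = c"
  by (induction n) (simp_all, simp add: algebra_simps)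

lemma tree_exp_diff: "tree_exp p n (\<lambda>r. F r - G r) = tree_exp p n F - tree_exp p n G"
  using tree_exp_add[of p n F "\<lambda>r. (-1) * G r"] unfolding tree_exp_mult_left by simp

lemma tree_exp_sum: "tree_exp p n (\<lambda>r. \<Sum>i\<in>I. F i r) = (\<Sum>i\<in>I. tree_exp p n (F i))"
  by (induction I rule: infinite_finite_induct) (simp_all add: tree_exp_add)

lemma tree_exp_nonneg:
  "0 \<le> p \<Longrightarrow> p \<le> 1 \<Longrightarrow> (\<And>r. r \<in> trees n \<Longrightarrow> 0 \<le> F r) \<Longrightarrow> 0 \<le> tree_exp p n F"
  using tree_exp_mono[of p n "\<lambda>_. 0" F] by simp

lemma tree_exp_abs:
  assumes "0 \<le> p" "p \<le> 1"
  shows "\<bar>tree_exp p n F\<bar> \<le> tree_exp p n (\<lambda>r. \<bar>F r\<bar>)"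
proof (rule abs_leI)
  show "tree_exp p n F \<le> tree_exp p n (\<lambda>r. \<bar>F r\<bar>)"
    by (rule tree_exp_mono[OF assms]) auto
  have "- tree_exp p n F = tree_exp p n (\<lambda>r. - F r)"
    using tree_exp_mult_left[of p n "-1" F] by simp
  also have "\<dots> \<le> tree_exp p n (\<lambda>r. \<bar>F r\<bar>)"
    by (rule tree_exp_mono[OF assms]) auto
  finally show "- tree_exp p n F \<le> tree_exp p n (\<lambda>r. \<bar>F r\<bar>)" .
qed

text \<open>The weights of one step, \<open>1 - n * (p / n)\<close> once and \<open>p / n\<close>
  for each of \<open>n\<close> copies, sum to one, so steps that \<open>F\<close> does not read
  integrate out. This makes the laws of the trees consistent in \<open>n\<close>.\<close>

lemma tree_exp_extend:
  assumes "m \<le> n" and "\<And>r i k. m < i \<Longrightarrow> F (r(i := k)) = F r"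
  shows "tree_exp p n F = tree_exp p m F"
  using assms(1)
proof (induction rule: dec_induct)
  case (step n)
  have "tree_exp p (Suc n) F = tree_exp p n (\<lambda>r. F r)"
    unfolding tree_exp.simps
    by (rule tree_exp_cong) (use assms(2) step in \<open>simp add: algebra_simps\<close>)
  then show ?case using step by simp
qed simp

section \<open>Cluster sizes and their change when a step is added\<close>

definition cluster :: "(nat \<Rightarrow> nat) \<Rightarrow> nat \<Rightarrow> nat \<Rightarrow> real" where
  "cluster r n j = (\<Sum>i=1..n. of_bool (r i = j))"

lemma cluster_nonneg: "0 \<le> cluster r n j"
  unfolding cluster_def by (intro sum_nonneg) auto

lemma cluster_upd [simp]: "m < i \<Longrightarrow> cluster (r(i := k)) m j = cluster r m j"
  unfolding cluster_def by (intro sum.cong) auto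

lemma cluster_Suc_upd: "cluster (r(Suc n := k)) (Suc n) j = cluster r n j + of_bool (k = j)"
  using cluster_upd[of n "Suc n" r k j] by (simp add: cluster_def)

lemma cluster_mono: "m \<le> n \<Longrightarrow> cluster r m j \<le> cluster r n j"
  unfolding cluster_def by (intro sum_mono2) auto

lemma cluster_zero: "r \<in> trees n \<Longrightarrow> m < j \<Longrightarrow> cluster r m j = 0"
  unfolding cluster_def
proof (intro sum.neutral ballI)
  fix i assume "r \<in> trees n" "m < j" "i \<in> {1..m}"
  with trees_le[of r n i] show "of_bool (r i = j) = (0::real)" by auto
qed

text \<open>The steps are grouped by the original step that they repeat. For
  \<open>f j = X j \<omega>\<close> this expresses the walk by cluster sizes; for a function of the
  cluster it turns a uniform choice of a step into a size-biased choice of a cluster.\<close>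

lemma sum_fibres:
  assumes "r \<in> trees n" "m \<le> n" "m \<le> L"
  shows "(\<Sum>u=1..m. f (r u)) = (\<Sum>j=1..L. cluster r m j * f j)"
proof -
  have "(\<Sum>u=1..m. f (r u)) = (\<Sum>u=1..m. \<Sum>j=1..L. of_bool (r u = j) * f j)"
  proof (intro sum.cong refl)
    fix u assume u: "u \<in> {1..m}"
    then have "r u \<in> {1..L}" using trees_pos[OF assms(1), of u] trees_le[OF assms(1), of u] assms by auto
    then show "f (r u) = (\<Sum>j=1..L. of_bool (r u = j) * f j)"
      by (subst sum.remove[of _ "r u"]) (auto intro!: sum.neutral)
  qed
  also have "\<dots> = (\<Sum>j=1..L. cluster r m j * f j)"
    unfolding cluster_def sum_distrib_right by (rule sum.swap)
  finally show ?thesis .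
qed

text \<open>Only the summand of \<open>k\<close> changes. The index \<open>Suc n\<close> is new and
  its cluster was empty, which is why \<open>g j 0 = 0\<close> is asked for;
  \<open>k = Suc n\<close> creates a cluster of size one.\<close>

lemma cluster_sum_step:
  fixes g :: "nat \<Rightarrow> real \<Rightarrow> real"
  assumes r: "r \<in> trees n" and k: "k \<in> {1..Suc n}" and g: "\<And>j. g j 0 = 0"
  shows "(\<Sum>j=1..Suc n. g j (cluster (r(Suc n := k)) (Suc n) j)) =
    (\<Sum>j=1..n. g j (cluster r n j)) + (g k (cluster r n k + 1) - g k (cluster r n k))"
proof -
  have "(\<Sum>j=1..Suc n. g j (cluster (r(Suc n := k)) (Suc n) j)) =
     (\<Sum>j=1..Suc n. g j (cluster r n j) + (if j = k then g k (cluster r n k + 1) - g k (cluster r n k) else 0))"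
    by (intro sum.cong refl) (auto simp: cluster_Suc_upd)
  also have "\<dots> = (\<Sum>j=1..Suc n. g j (cluster r n j)) + (g k (cluster r n k + 1) - g k (cluster r n k))"
    using k by (subst sum.distrib) (simp add: sum.delta del: sum.cl_ivl_Suc)
  also have "(\<Sum>j=1..Suc n. g j (cluster r n j)) = (\<Sum>j=1..n. g j (cluster r n j))"
    using cluster_zero[OF r, of n "Suc n"] g by simp
  finally show ?thesis .
qed

text \<open>Copying a uniformly chosen step is preferential attachment: cluster \<open>j\<close>
  grows with probability proportional to its size. The second argument of \<open>G\<close> is the
  size before growth, which is \<open>0\<close> for a new original step.\<close>

lemma tree_exp_cluster_step:
  assumes F: "\<And>r k. r \<in> trees n \<Longrightarrow> k \<in> {1..Suc n} \<Longrightarrow> F (r(Suc n := k)) = G r (cluster r n k) k"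
  shows "tree_exp p (Suc n) F = tree_exp p n (\<lambda>r. (1 - real n * (p / real n)) * G r 0 (Suc n)
     + p / real n * (\<Sum>j=1..n. cluster r n j * G r (cluster r n j) j))"
  unfolding tree_exp.simps
proof (rule tree_exp_cong)
  fix r assume r: "r \<in> trees n"
  have "(\<Sum>u=1..n. F (r(Suc n := r u))) = (\<Sum>u=1..n. G r (cluster r n (r u)) (r u))"
    using trees_pos[OF r] by (intro sum.cong refl F r) force
  also have "\<dots> = (\<Sum>j=1..n. cluster r n j * G r (cluster r n j) j)"
    by (rule sum_fibres[OF r]) auto
  moreover have "F (r(Suc n := Suc n)) = G r 0 (Suc n)"
    using F[OF r, of "Suc n"] cluster_zero[OF r, of n "Suc n"] by simp
  ultimately show "(1 - real n * (p / real n)) * F (r(Suc n := Suc n)) +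
      p / real n * (\<Sum>u=1..n. F (r(Suc n := r u))) =
      (1 - real n * (p / real n)) * G r 0 (Suc n) +
      p / real n * (\<Sum>j=1..n. cluster r n j * G r (cluster r n j) j)" by simp
qed

definition cube_sum :: "(nat \<Rightarrow> nat) \<Rightarrow> nat \<Rightarrow> real" where
  "cube_sum r n = (\<Sum>j=1..n. cluster r n j ^ 3)"

text \<open>For \<open>a \<le> b\<close>, this is the covariance of the walk at times
  \<open>a\<close> and \<open>b\<close> given the tree, for uncorrelated original steps of mean zero
  and variance one. Clusters beyond \<open>b\<close> are still empty at time
  \<open>b\<close>.\<close>

definition pairs :: "(nat \<Rightarrow> nat) \<Rightarrow> nat \<Rightarrow> nat \<Rightarrow> real" where
  "pairs r a b = (\<Sum>j=1..b. cluster r a j * cluster r b j)"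

lemma cube_sum_nonneg: "0 \<le> cube_sum r n"
  unfolding cube_sum_def by (intro sum_nonneg) (simp add: cluster_nonneg)

lemma cube_sum_upd: "r \<in> trees n \<Longrightarrow> k \<in> {1..Suc n} \<Longrightarrow>
   cube_sum (r(Suc n := k)) (Suc n) = cube_sum r n + 3 * (cluster r n k)\<^sup>2 + 3 * cluster r n k + 1"
  unfolding cube_sum_def
  using cluster_sum_step[of r n k "\<lambda>_ x. x ^ 3"]
  by (simp add: power3_eq_cube power2_eq_square algebra_simps)

lemma pairs_diag_upd: "r \<in> trees n \<Longrightarrow> k \<in> {1..Suc n} \<Longrightarrow>
   pairs (r(Suc n := k)) (Suc n) (Suc n) = pairs r n n + 2 * cluster r n k + 1"
  unfolding pairs_def
  using cluster_sum_step[of r n k "\<lambda>_ x. x * x"]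
  by (simp add: algebra_simps)

lemma pairs_upd: "r \<in> trees n \<Longrightarrow> k \<in> {1..Suc n} \<Longrightarrow> a \<le> n \<Longrightarrow>
   pairs (r(Suc n := k)) a (Suc n) = pairs r a n + cluster r a k"
  unfolding pairs_def
  using cluster_sum_step[of r n k "\<lambda>j x. cluster r a j * x"]
  by (simp add: algebra_simps)

lemma sum_cluster: "r \<in> trees n \<Longrightarrow> (\<Sum>j=1..n. cluster r n j) = real n"
  using sum_fibres[of r n n n "\<lambda>_. 1"] by simp

section \<open>One-step recursions for moments of the cluster sizes\<close>

lemma tree_exp_pairs_diag_Suc:
  "tree_exp p (Suc n) (\<lambda>r. pairs r (Suc n) (Suc n)) =
    (1 + 2 * p / real n) * tree_exp p n (\<lambda>r. pairs r n n) + 1"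
proof -
  have "tree_exp p (Suc n) (\<lambda>r. pairs r (Suc n) (Suc n)) = tree_exp p n (\<lambda>r.
      (1 - real n * (p / real n)) * (pairs r n n + 2 * 0 + 1)
     + p / real n * (\<Sum>j=1..n. cluster r n j * (pairs r n n + 2 * cluster r n j + 1)))"
    by (rule tree_exp_cluster_step) (rule pairs_diag_upd)
  also have "\<dots> = tree_exp p n (\<lambda>r. (1 + 2 * p / real n) * pairs r n n + 1)"
  proof (rule tree_exp_cong)
    fix r assume r: "r \<in> trees n"
    have "(\<Sum>j=1..n. cluster r n j * (pairs r n n + 2 * cluster r n j + 1)) =
        (\<Sum>j=1..n. (pairs r n n + 1) * cluster r n j + 2 * (cluster r n j * cluster r n j))"
      by (intro sum.cong refl) (simp add: algebra_simps)
    also have "\<dots> = (pairs r n n + 1) * (\<Sum>j=1..n. cluster r n j) + 2 * pairs r n n"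
      by (simp only: sum.distrib sum_distrib_left[symmetric] pairs_def[of r n n, symmetric])
    finally have "(\<Sum>j=1..n. cluster r n j * (pairs r n n + 2 * cluster r n j + 1)) =
        (pairs r n n + 1) * (\<Sum>j=1..n. cluster r n j) + 2 * pairs r n n" .
    then show "(1 - real n * (p / real n)) * (pairs r n n + 2 * 0 + 1)
     + p / real n * (\<Sum>j=1..n. cluster r n j * (pairs r n n + 2 * cluster r n j + 1))
     = (1 + 2 * p / real n) * pairs r n n + 1"
      unfolding sum_cluster[OF r] by (simp add: algebra_simps)
  qed
  also have "\<dots> = (1 + 2 * p / real n) * tree_exp p n (\<lambda>r. pairs r n n) + 1"
    by (simp only: tree_exp_add tree_exp_mult_left tree_exp_const)
  finally show ?thesis .
qed

text \<open>A cluster of size \<open>x\<close> gains \<open>3 * x^2 + 3 * x + 1\<close> with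
  probability \<open>p * x / n\<close>; the leading term reproduces the cubes at rate
  \<open>3 * p\<close>, the next one brings in the squares, and the constants add up to
  \<open>1\<close>.\<close>

lemma tree_exp_cube_sum_Suc:
  "tree_exp p (Suc n) (\<lambda>r. cube_sum r (Suc n)) =
    (1 + 3 * p / real n) * tree_exp p n (\<lambda>r. cube_sum r n) +
    3 * p / real n * tree_exp p n (\<lambda>r. pairs r n n) + 1"
proof -
  have "tree_exp p (Suc n) (\<lambda>r. cube_sum r (Suc n)) = tree_exp p n (\<lambda>r.
      (1 - real n * (p / real n)) * (cube_sum r n + 3 * 0\<^sup>2 + 3 * 0 + 1)
     + p / real n * (\<Sum>j=1..n. cluster r n j * (cube_sum r n + 3 * (cluster r n j)\<^sup>2 + 3 * cluster r n j + 1)))"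
    by (rule tree_exp_cluster_step) (rule cube_sum_upd)
  also have "\<dots> = tree_exp p n (\<lambda>r. (1 + 3 * p / real n) * cube_sum r n + 3 * p / real n * pairs r n n + 1)"
  proof (rule tree_exp_cong)
    fix r assume r: "r \<in> trees n"
    have "(\<Sum>j=1..n. cluster r n j * (cube_sum r n + 3 * (cluster r n j)\<^sup>2 + 3 * cluster r n j + 1)) =
        (\<Sum>j=1..n. (cube_sum r n + 1) * cluster r n j + 3 * cluster r n j ^ 3
           + 3 * (cluster r n j * cluster r n j))"
      by (intro sum.cong refl) (simp add: algebra_simps power2_eq_square power3_eq_cube)
    also have "\<dots> = (cube_sum r n + 1) * (\<Sum>j=1..n. cluster r n j) + 3 * cube_sum r n + 3 * pairs r n n"
      by (simp only: sum.distrib sum_distrib_left[symmetric] pairs_def[of r n n, symmetric]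
          cube_sum_def[of r n, symmetric])
    finally have "(\<Sum>j=1..n. cluster r n j * (cube_sum r n + 3 * (cluster r n j)\<^sup>2 + 3 * cluster r n j + 1)) =
        (cube_sum r n + 1) * (\<Sum>j=1..n. cluster r n j) + 3 * cube_sum r n + 3 * pairs r n n" .
    then show "(1 - real n * (p / real n)) * (cube_sum r n + 3 * 0\<^sup>2 + 3 * 0 + 1)
     + p / real n * (\<Sum>j=1..n. cluster r n j * (cube_sum r n + 3 * (cluster r n j)\<^sup>2 + 3 * cluster r n j + 1))
     = (1 + 3 * p / real n) * cube_sum r n + 3 * p / real n * pairs r n n + 1"
      unfolding sum_cluster[OF r] by (simp add: algebra_simps)
  qed
  also have "\<dots> = (1 + 3 * p / real n) * tree_exp p n (\<lambda>r. cube_sum r n) +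
    3 * p / real n * tree_exp p n (\<lambda>r. pairs r n n) + 1"
    by (simp only: tree_exp_add tree_exp_mult_left tree_exp_const)
  finally show ?thesis .
qed

text \<open>\<open>E (y + x)^2 \<le> (y + E x)^2 + E x^2\<close> for a variable taking the value \<open>x j\<close> with probability
  \<open>q * w j\<close> and \<open>0\<close> otherwise.\<close>

lemma weighted_square_le:
  fixes w x :: "'i \<Rightarrow> real"
  shows "(1 - q * (\<Sum>j\<in>I. w j)) * y\<^sup>2 + q * (\<Sum>j\<in>I. w j * (y + x j)\<^sup>2)
     \<le> (y + q * (\<Sum>j\<in>I. w j * x j))\<^sup>2 + q * (\<Sum>j\<in>I. w j * (x j)\<^sup>2)"
proof -
  define m where "m = q * (\<Sum>j\<in>I. w j * x j)"
  have "(\<Sum>j\<in>I. w j * (y + x j)\<^sup>2) = (\<Sum>j\<in>I. y\<^sup>2 * w j + 2 * y * (w j * x j) + w j * (x j)\<^sup>2)"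
    by (intro sum.cong refl) (simp add: power2_eq_square algebra_simps)
  also have "\<dots> = y\<^sup>2 * (\<Sum>j\<in>I. w j) + 2 * y * (\<Sum>j\<in>I. w j * x j) + (\<Sum>j\<in>I. w j * (x j)\<^sup>2)"
    by (simp only: sum.distrib sum_distrib_left)
  finally have "(1 - q * (\<Sum>j\<in>I. w j)) * y\<^sup>2 + q * (\<Sum>j\<in>I. w j * (y + x j)\<^sup>2)
     = y\<^sup>2 + 2 * y * m + q * (\<Sum>j\<in>I. w j * (x j)\<^sup>2)"
    unfolding m_def by (simp add: algebra_simps)
  also have "\<dots> \<le> (y + m)\<^sup>2 + q * (\<Sum>j\<in>I. w j * (x j)\<^sup>2)"
    by (simp add: power2_eq_square algebra_simps)
  finally show ?thesis unfolding m_def .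
qed

text \<open>As \<open>c\<close> obeys the recursion of the mean, the conditional mean of the
  deviation is multiplied by \<open>1 + 2 * p / n\<close>. The random gain \<open>2 * x\<close> adds
  at most its second moment, and size-biasing turns \<open>4 * x^2\<close> into four times a
  cube.\<close>

lemma tree_exp_pairs_diag_var_Suc:
  assumes "0 \<le> p" "p \<le> 1" and c': "c' = (1 + 2 * p / real n) * c + 1"
  shows "tree_exp p (Suc n) (\<lambda>r. (pairs r (Suc n) (Suc n) - c')\<^sup>2) \<le>
    (1 + 2 * p / real n)\<^sup>2 * tree_exp p n (\<lambda>r. (pairs r n n - c)\<^sup>2)
     + 4 * p / real n * tree_exp p n (\<lambda>r. cube_sum r n)"
proof -
  have "tree_exp p (Suc n) (\<lambda>r. (pairs r (Suc n) (Suc n) - c')\<^sup>2) = tree_exp p n (\<lambda>r.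
      (1 - real n * (p / real n)) * (pairs r n n + 2 * 0 + 1 - c')\<^sup>2
     + p / real n * (\<Sum>j=1..n. cluster r n j * (pairs r n n + 2 * cluster r n j + 1 - c')\<^sup>2))"
    by (rule tree_exp_cluster_step) (simp add: pairs_diag_upd)
  also have "\<dots> \<le> tree_exp p n (\<lambda>r. (1 + 2 * p / real n)\<^sup>2 * (pairs r n n - c)\<^sup>2 + 4 * p / real n * cube_sum r n)"
  proof (rule tree_exp_mono[OF assms(1,2)])
    fix r assume r: "r \<in> trees n"
    have "(1 - p / real n * (\<Sum>j=1..n. cluster r n j)) * (pairs r n n + (1 - c'))\<^sup>2
       + p / real n * (\<Sum>j=1..n. cluster r n j * (pairs r n n + (1 - c') + 2 * cluster r n j)\<^sup>2)
     \<le> (pairs r n n + (1 - c') + p / real n * (\<Sum>j=1..n. cluster r n j * (2 * cluster r n j)))\<^sup>2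
        + p / real n * (\<Sum>j=1..n. cluster r n j * (2 * cluster r n j)\<^sup>2)"
      by (rule weighted_square_le)
    also have "(\<Sum>j=1..n. cluster r n j * (2 * cluster r n j)) = 2 * pairs r n n"
      unfolding pairs_def sum_distrib_left by (intro sum.cong) auto
    also have "(\<Sum>j=1..n. cluster r n j * (2 * cluster r n j)\<^sup>2) = 4 * cube_sum r n"
      unfolding cube_sum_def sum_distrib_left
      by (intro sum.cong) (auto simp: power2_eq_square power3_eq_cube)
    also have "pairs r n n + (1 - c') + p / real n * (2 * pairs r n n) = (1 + 2 * p / real n) * (pairs r n n - c)"
      unfolding c' by (simp add: algebra_simps diff_divide_distrib)
    finally have *: "(1 - p / real n * real n) * (pairs r n n + (1 - c'))\<^sup>2
       + p / real n * (\<Sum>j=1..n. cluster r n j * (pairs r n n + (1 - c') + 2 * cluster r n j)\<^sup>2)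
       \<le> ((1 + 2 * p / real n) * (pairs r n n - c))\<^sup>2 + p / real n * (4 * cube_sum r n)"
      unfolding sum_cluster[OF r] .
    have "pairs r n n + 2 * x + 1 - c' = pairs r n n + (1 - c') + 2 * x" for x by simp
    moreover have "pairs r n n + 1 - c' = pairs r n n + (1 - c')" by simp
    moreover have "p / real n * (4 * cube_sum r n) = 4 * p / real n * cube_sum r n" by simp
    ultimately show "(1 - real n * (p / real n)) * (pairs r n n + 2 * 0 + 1 - c')\<^sup>2
     + p / real n * (\<Sum>j=1..n. cluster r n j * (pairs r n n + 2 * cluster r n j + 1 - c')\<^sup>2)
     \<le> (1 + 2 * p / real n)\<^sup>2 * (pairs r n n - c)\<^sup>2 + 4 * p / real n * cube_sum r n"
      using * by (simp only: mult.commute[of "real n"] power_mult_distrib[symmetric] mult_zero_right add_0_right)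
  qed
  also have "\<dots> = (1 + 2 * p / real n)\<^sup>2 * tree_exp p n (\<lambda>r. (pairs r n n - c)\<^sup>2)
     + 4 * p / real n * tree_exp p n (\<lambda>r. cube_sum r n)"
    by (simp only: tree_exp_add tree_exp_mult_left tree_exp_const)
  finally show ?thesis .
qed

text \<open>With the earlier time \<open>a\<close> frozen, the gain is \<open>cluster r a j\<close>
  and the rate drops from \<open>2 * p\<close> to \<open>p\<close>. Its second moment is bounded by
  the cubes at time \<open>n\<close>, because clusters only grow.\<close>

lemma tree_exp_pairs_var_Suc:
  assumes "0 \<le> p" "p \<le> 1" "a \<le> n" and c': "c' = (1 + p / real n) * c"
  shows "tree_exp p (Suc n) (\<lambda>r. (pairs r a (Suc n) - c')\<^sup>2) \<le>
    (1 + p / real n)\<^sup>2 * tree_exp p n (\<lambda>r. (pairs r a n - c)\<^sup>2)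
     + p / real n * tree_exp p n (\<lambda>r. cube_sum r n)"
proof -
  have "tree_exp p (Suc n) (\<lambda>r. (pairs r a (Suc n) - c')\<^sup>2) = tree_exp p n (\<lambda>r.
      (1 - real n * (p / real n)) * (pairs r a n + cluster r a (Suc n) - c')\<^sup>2
     + p / real n * (\<Sum>j=1..n. cluster r n j * (pairs r a n + cluster r a j - c')\<^sup>2))"
    by (rule tree_exp_cluster_step) (simp add: pairs_upd assms)
  also have "\<dots> \<le> tree_exp p n (\<lambda>r. (1 + p / real n)\<^sup>2 * (pairs r a n - c)\<^sup>2 + p / real n * cube_sum r n)"
  proof (rule tree_exp_mono[OF assms(1,2)])
    fix r assume r: "r \<in> trees n"
    have 0: "cluster r a (Suc n) = 0"
      using cluster_zero[OF r, of a "Suc n"] assms by simp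
    have "(1 - p / real n * (\<Sum>j=1..n. cluster r n j)) * (pairs r a n + (- c'))\<^sup>2
       + p / real n * (\<Sum>j=1..n. cluster r n j * (pairs r a n + (- c') + cluster r a j)\<^sup>2)
     \<le> (pairs r a n + (- c') + p / real n * (\<Sum>j=1..n. cluster r n j * cluster r a j))\<^sup>2
        + p / real n * (\<Sum>j=1..n. cluster r n j * (cluster r a j)\<^sup>2)"
      by (rule weighted_square_le)
    also have "(\<Sum>j=1..n. cluster r n j * cluster r a j) = pairs r a n"
      unfolding pairs_def by (intro sum.cong) auto
    also have "pairs r a n + (- c') + p / real n * (pairs r a n) = (1 + p / real n) * (pairs r a n - c)"
      unfolding c' by (simp add: algebra_simps)
    also have "((1 + p / real n) * (pairs r a n - c))\<^sup>2
        + p / real n * (\<Sum>j=1..n. cluster r n j * (cluster r a j)\<^sup>2)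
      \<le> ((1 + p / real n) * (pairs r a n - c))\<^sup>2 + p / real n * cube_sum r n"
      unfolding cube_sum_def
    proof (intro add_left_mono mult_left_mono sum_mono)
      fix j
      have "(cluster r a j)\<^sup>2 \<le> (cluster r n j)\<^sup>2"
        using cluster_mono[OF assms(3)] cluster_nonneg by (intro power_mono)
      then show "cluster r n j * (cluster r a j)\<^sup>2 \<le> cluster r n j ^ 3"
        using mult_left_mono[OF _ cluster_nonneg[of r n j]]
        by (fastforce simp: power2_eq_square power3_eq_cube)
    qed (use assms in auto)
    finally have *: "(1 - p / real n * real n) * (pairs r a n + (- c'))\<^sup>2
       + p / real n * (\<Sum>j=1..n. cluster r n j * (pairs r a n + (- c') + cluster r a j)\<^sup>2)
       \<le> ((1 + p / real n) * (pairs r a n - c))\<^sup>2 + p / real n * cube_sum r n"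
      unfolding sum_cluster[OF r] .
    have "pairs r a n + x - c' = pairs r a n + (- c') + x" for x by simp
    moreover have "pairs r a n - c' = pairs r a n + (- c')" by simp
    ultimately show "(1 - real n * (p / real n)) * (pairs r a n + cluster r a (Suc n) - c')\<^sup>2
     + p / real n * (\<Sum>j=1..n. cluster r n j * (pairs r a n + cluster r a j - c')\<^sup>2)
     \<le> (1 + p / real n)\<^sup>2 * (pairs r a n - c)\<^sup>2 + p / real n * cube_sum r n"
      using * by (simp only: 0 mult.commute[of "real n"] power_mult_distrib[symmetric] add_0_right)
  qed
  also have "\<dots> = (1 + p / real n)\<^sup>2 * tree_exp p n (\<lambda>r. (pairs r a n - c)\<^sup>2)
     + p / real n * tree_exp p n (\<lambda>r. cube_sum r n)"
    by (simp only: tree_exp_add tree_exp_mult_left tree_exp_const)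
  finally show ?thesis .
qed

section \<open>Power bounds from the recursions\<close>

lemma powr_one_plus_ge:
  fixes x \<gamma> :: real
  assumes "0 \<le> x" "1 \<le> \<gamma>"
  shows "1 + \<gamma> * x \<le> (1 + x) powr \<gamma>"
proof -
  define f where "f y = (1 + y) powr \<gamma> - \<gamma> * y" for y
  have "f 0 \<le> f x"
  proof (rule DERIV_nonneg_imp_nondecreasing[OF assms(1)])
    fix y :: real assume y: "0 \<le> y" "y \<le> x"
    have "(f has_real_derivative (\<gamma> * (1 + y) powr (\<gamma> - 1) - \<gamma>)) (at y)"
      unfolding f_def using y by (auto intro!: derivative_eq_intros)
    moreover have "1 \<le> (1 + y) powr (\<gamma> - 1)"
      using y assms by (intro ge_one_powr_ge_zero) auto
    then have "0 \<le> \<gamma> * (1 + y) powr (\<gamma> - 1) - \<gamma>" using assms by simp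
    ultimately show "\<exists>d. (f has_real_derivative d) (at y) \<and> 0 \<le> d" by blast
  qed
  then show ?thesis by (simp add: f_def)
qed

text \<open>A discrete Gronwall argument: \<open>K * n powr \<gamma>\<close> is a supersolution. By
  Bernoulli's inequality its increment is at least
  \<open>K * \<gamma> * n powr (\<gamma> - 1)\<close>, of which \<open>\<alpha>\<close> pays for the
  linear term and \<open>\<gamma> - \<alpha>\<close> for the forcing term.\<close>

lemma recursion_power_bound:
  fixes x :: "nat \<Rightarrow> real"
  assumes "0 \<le> \<alpha>" "\<alpha> < \<gamma>" "1 \<le> \<gamma>" "0 \<le> K" "C \<le> K * (\<gamma> - \<alpha>)" "1 \<le> n0"
    and start: "x n0 \<le> K * real n0 powr \<gamma>"
    and step: "\<And>n. n0 \<le> n \<Longrightarrow> x (Suc n) \<le> (1 + \<alpha> / real n) * x n + C * real n powr (\<gamma> - 1)"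
  shows "n0 \<le> n \<Longrightarrow> x n \<le> K * real n powr \<gamma>"
proof (induction n rule: dec_induct)
  case base
  show ?case by (fact start)
next
  case (step n)
  then have n: "0 < real n" using assms by simp
  have "x (Suc n) \<le> (1 + \<alpha> / real n) * x n + C * real n powr (\<gamma> - 1)"
    using step assms(8) by simp
  also have "\<dots> \<le> (1 + \<alpha> / real n) * (K * real n powr \<gamma>) + (K * (\<gamma> - \<alpha>)) * real n powr (\<gamma> - 1)"
    using step n assms by (intro add_mono mult_left_mono mult_right_mono) auto
  also have "real n powr (\<gamma> - 1) = real n powr \<gamma> / real n"
    using n by (simp add: powr_diff)
  also have "(1 + \<alpha> / real n) * (K * real n powr \<gamma>) + (K * (\<gamma> - \<alpha>)) * (real n powr \<gamma> / real n)
     = K * real n powr \<gamma> * (1 + \<gamma> * (1 / real n))"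
    using n by (simp add: field_simps)
  also have "\<dots> \<le> K * real n powr \<gamma> * (1 + 1 / real n) powr \<gamma>"
    using assms by (intro mult_left_mono powr_one_plus_ge) auto
  also have "\<dots> = K * (real n * (1 + 1 / real n)) powr \<gamma>"
    using n by (simp add: powr_mult)
  also have "real n * (1 + 1 / real n) = real (Suc n)"
    using n by (simp add: field_simps)
  finally show ?case .
qed

definition mean_pairs :: "real \<Rightarrow> nat \<Rightarrow> real" where
  "mean_pairs p n = tree_exp p n (\<lambda>r. pairs r n n)"

lemma mean_pairs_Suc: "mean_pairs p (Suc n) = (1 + 2 * p / real n) * mean_pairs p n + 1"
  unfolding mean_pairs_def by (rule tree_exp_pairs_diag_Suc)

text \<open>\<open>n / (1 - 2 * p)\<close> is a particular solution of the recursion and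
  \<open>growth (2 * p)\<close> a homogeneous one; the value \<open>1\<close> at time one fixes the
  coefficient. At time \<open>0\<close> the formula would fail, hence \<open>Suc n\<close>.\<close>

lemma mean_pairs_eq:
  assumes "p < 1 / 2"
  shows "mean_pairs p (Suc n) = real (Suc n) / (1 - 2 * p) - 2 * p / (1 - 2 * p) * growth (2 * p) (Suc n)"
proof (induction n)
  case 0
  have "mean_pairs p (Suc 0) = 1"
    unfolding mean_pairs_def by (subst tree_exp_pairs_diag_Suc) (simp add: pairs_def)
  then show ?case using assms by (simp add: growth_Suc field_simps)
next
  case (Suc n)
  let ?m = "real (Suc n)"
  have "mean_pairs p (Suc (Suc n)) = (1 + 2 * p / ?m) * mean_pairs p (Suc n) + 1"
    by (rule mean_pairs_Suc)
  also have "\<dots> = (1 + 2 * p / ?m) * (?m / (1 - 2 * p)) + 1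
     - 2 * p / (1 - 2 * p) * (growth (2 * p) (Suc n) * (1 + 2 * p / ?m))"
    unfolding Suc by (simp only: right_diff_distrib) (simp add: mult_ac)
  also have "(1 + 2 * p / ?m) * (?m / (1 - 2 * p)) + 1 = real (Suc (Suc n)) / (1 - 2 * p)"
    using assms by (simp add: divide_simps)
  also have "growth (2 * p) (Suc n) * (1 + 2 * p / ?m) = growth (2 * p) (Suc (Suc n))"
    by (simp add: growth_Suc)
  finally show ?case .
qed

lemma mean_pairs_le:
  assumes "0 < p" "p < 1 / 2"
  shows "mean_pairs p n \<le> real n / (1 - 2 * p)"
proof (cases n)
  case 0
  then show ?thesis by (simp add: mean_pairs_def pairs_def)
next
  case (Suc m)
  then show ?thesis using assms growth_pos[of "2 * p" n]
    by (simp add: mean_pairs_eq[OF assms(2)])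
qed

text \<open>The homogeneous part is of order \<open>n powr (2 * p)\<close>, negligible against
  \<open>n\<close> since \<open>2 * p < 1\<close>.\<close>

lemma mean_pairs_asymp:
  assumes "0 < p" "p < 1 / 2"
  shows "(\<lambda>n. mean_pairs p n / real n) \<longlonglongrightarrow> 1 / (1 - 2 * p)"
proof -
  have "(\<lambda>n. real n powr (2 * p - 1)) \<longlonglongrightarrow> 0"
    using assms by (intro tendsto_neg_powr filterlim_real_sequentially) auto
  from tendsto_mult[OF growth_asymp[of "2 * p"] this]
  have "(\<lambda>n. growth (2 * p) n / real n powr (2 * p) * real n powr (2 * p - 1)) \<longlonglongrightarrow> 0"
    using assms by simp
  then have "(\<lambda>n. 1 / (1 - 2 * p) - 2 * p / (1 - 2 * p) *
      (growth (2 * p) n / real n powr (2 * p) * real n powr (2 * p - 1))) \<longlonglongrightarrow>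
      1 / (1 - 2 * p) - 2 * p / (1 - 2 * p) * 0"
    by (intro tendsto_diff tendsto_const tendsto_mult_left)
  moreover have "\<forall>\<^sub>F n in sequentially. 1 / (1 - 2 * p) - 2 * p / (1 - 2 * p) *
      (growth (2 * p) n / real n powr (2 * p) * real n powr (2 * p - 1)) = mean_pairs p n / real n"
    using eventually_gt_at_top[of 0]
  proof eventually_elim
    case (elim n)
    then obtain m where m: "n = Suc m" by (cases n) auto
    have "growth (2 * p) n / real n powr (2 * p) * real n powr (2 * p - 1) = growth (2 * p) n / real n"
      using elim by (simp add: powr_diff)
    then show ?case using elim assms
      unfolding m mean_pairs_eq[OF assms(2)] by (simp add: diff_divide_distrib mult_ac)
  qed
  ultimately show ?thesis by (simp add: Lim_transform_eventually)
qed

text \<open>The forcing term is bounded because the mean number of pairs is at most linear, so every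
  exponent above \<open>max (3 * p) 1\<close> works. As \<open>p < 1 / 2\<close>, the midpoint
  between this and \<open>3 / 2\<close> is available.\<close>

lemma cube_sum_bound:
  assumes "0 < p" "p < 1 / 2"
  obtains K \<gamma> where "0 \<le> K" "1 \<le> \<gamma>" "\<gamma> < 3 / 2"
    "\<And>n. tree_exp p n (\<lambda>r. cube_sum r n) \<le> K * real n powr \<gamma>"
proof -
  define \<gamma> where "\<gamma> = max (3 * p) 1 / 2 + 3 / 4"
  have \<gamma>: "3 * p < \<gamma>" "1 < \<gamma>" "\<gamma> < 3 / 2" using assms by (auto simp: \<gamma>_def)
  define C where "C = 3 * p / (1 - 2 * p) + 1"
  have C: "1 \<le> C" using assms by (simp add: C_def)
  define K where "K = max 1 (C / (\<gamma> - 3 * p))"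
  have "tree_exp p n (\<lambda>r. cube_sum r n) \<le> K * real n powr \<gamma>" if "1 \<le> n" for n
  proof (rule recursion_power_bound[where \<alpha> = "3 * p" and C = C and ?n0.0 = 1])
    have "C / (\<gamma> - 3 * p) \<le> K" by (simp add: K_def)
    then show "C \<le> K * (\<gamma> - 3 * p)" using \<gamma> by (simp add: field_simps)
    have "tree_exp p (Suc 0) (\<lambda>r. cube_sum r (Suc 0)) = 1"
      by (subst tree_exp_cube_sum_Suc) (simp add: cube_sum_def)
    then show "tree_exp p 1 (\<lambda>r. cube_sum r 1) \<le> K * real 1 powr \<gamma>"
      by (simp add: K_def)
    fix n :: nat assume n: "1 \<le> n"
    have "3 * p / real n * mean_pairs p n \<le> 3 * p / real n * (real n / (1 - 2 * p))"
      using assms by (intro mult_left_mono mean_pairs_le) auto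
    also have "\<dots> + 1 = C" using n by (simp add: C_def)
    also have "C \<le> C * real n powr (\<gamma> - 1)"
      using C n \<gamma> by (simp add: ge_one_powr_ge_zero)
    finally show "tree_exp p (Suc n) (\<lambda>r. cube_sum r (Suc n)) \<le>
       (1 + 3 * p / real n) * tree_exp p n (\<lambda>r. cube_sum r n) + C * real n powr (\<gamma> - 1)"
      unfolding tree_exp_cube_sum_Suc mean_pairs_def by simp
  qed (use that assms \<gamma> C in \<open>auto simp: K_def\<close>)
  moreover have "tree_exp p 0 (\<lambda>r. cube_sum r 0) \<le> K * real 0 powr \<gamma>"
    by (simp add: cube_sum_def)
  ultimately have "tree_exp p n (\<lambda>r. cube_sum r n) \<le> K * real n powr \<gamma>" for n
    by (cases "1 \<le> n") (auto simp: not_le)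
  then show ?thesis using \<gamma> by (intro that[of K \<gamma>]) (auto simp: K_def)
qed

text \<open>For fixed \<open>a\<close>, the mean of \<open>pairs r a b\<close> grows with
  \<open>growth p b\<close>, which explains the centring. The bound is uniform in \<open>a\<close>,
  so that both times may later grow with \<open>n\<close>.\<close>

lemma pairs_var_bound:
  assumes "0 < p" "p < 1 / 2"
  obtains K \<gamma> n0 where "0 \<le> K" "1 \<le> \<gamma>" "\<gamma> < 2"
    "\<And>a b. n0 \<le> a \<Longrightarrow> a \<le> b \<Longrightarrow>
       tree_exp p b (\<lambda>r. (pairs r a b - mean_pairs p a / growth p a * growth p b)\<^sup>2) \<le> K * real b powr \<gamma>"
proof -
  obtain K3 \<gamma>3 where K3: "0 \<le> K3" "1 \<le> \<gamma>3" "\<gamma>3 < 3 / 2"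
    "\<And>n. tree_exp p n (\<lambda>r. cube_sum r n) \<le> K3 * real n powr \<gamma>3"
    using cube_sum_bound[OF assms] by blast
  \<comment> \<open>The points at one third and two thirds of the gap between \<open>4 * p\<close>
    and \<open>2\<close>. The rate \<open>\<alpha>\<close> absorbs the term
    \<open>4 * p^2 / n^2\<close> of \<open>(1 + 2 * p / n)^2\<close> once \<open>n\<close> exceeds
    the \<open>n0\<close> chosen below, and \<open>\<gamma>\<close> leaves room above
    \<open>\<alpha>\<close>; the maximum with \<open>3 / 2\<close> makes it dominate the exponent of
    the cubes.\<close>
  define \<alpha> where "\<alpha> = 4 * p + (2 - 4 * p) / 3"
  define \<gamma> where "\<gamma> = max (4 * p + 2 * (2 - 4 * p) / 3) (3 / 2)"
  have \<gamma>: "0 \<le> \<alpha>" "4 * p < \<alpha>" "\<alpha> < \<gamma>" "3 / 2 \<le> \<gamma>" "\<gamma> < 2"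
  proof -
    have "4 * p + 2 * (2 - 4 * p) / 3 < 2" using assms by (simp add: field_simps)
    moreover have "x / 3 < 2 * x / 3" if "0 < x" for x :: real using that by simp
    then have "4 * p + (2 - 4 * p) / 3 < 4 * p + 2 * (2 - 4 * p) / 3"
      using assms by (intro add_strict_left_mono) auto
    ultimately show "0 \<le> \<alpha>" "4 * p < \<alpha>" "\<alpha> < \<gamma>" "3 / 2 \<le> \<gamma>" "\<gamma> < 2"
      unfolding \<gamma>_def \<alpha>_def less_max_iff_disj using assms by auto
  qed
  obtain n0 :: nat where n0: "1 \<le> n0" "4 * p\<^sup>2 / (\<alpha> - 4 * p) \<le> real n0"
    using real_arch_simple[of "max 1 (4 * p\<^sup>2 / (\<alpha> - 4 * p))"] by auto
  define v where "v n = tree_exp p n (\<lambda>r. (pairs r n n - mean_pairs p n)\<^sup>2)" for n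
  define C where "C = 4 * p * K3"
  define K where "K = max (max 0 (v n0 / real n0 powr \<gamma>)) (C / (\<gamma> - \<alpha>))"
  have C0: "0 \<le> C" using K3 assms by (simp add: C_def)
  have K: "0 \<le> K" "C \<le> K * (\<gamma> - \<alpha>)" "v n0 \<le> K * real n0 powr \<gamma>"
  proof -
    have "C / (\<gamma> - \<alpha>) \<le> K" "v n0 / real n0 powr \<gamma> \<le> K" by (auto simp: K_def)
    then show "C \<le> K * (\<gamma> - \<alpha>)" "v n0 \<le> K * real n0 powr \<gamma>"
      using \<gamma> n0 by (auto simp: field_simps)
  qed (simp add: K_def)
  have step: "(1 + 2 * p / real n)\<^sup>2 * y + 4 * p / real n * tree_exp p n (\<lambda>r. cube_sum r n)
      \<le> (1 + \<alpha> / real n) * y + C * real n powr (\<gamma> - 1)" if "n0 \<le> n" "0 \<le> y" for n y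
  proof (rule add_mono)
    have n: "1 \<le> real n" using that n0 by simp
    have "4 * p\<^sup>2 / (\<alpha> - 4 * p) \<le> real n"
      using n0(2) that(1) by (meson of_nat_le_iff order_trans)
    then have "4 * p\<^sup>2 \<le> real n * (\<alpha> - 4 * p)"
      using \<gamma> by (simp only: pos_divide_le_eq diff_gt_0_iff_gt)
    then have "4 * p\<^sup>2 / real n \<le> \<alpha> - 4 * p"
      using n by (simp add: pos_divide_le_eq mult.commute)
    then have "(4 * p + 4 * p\<^sup>2 / real n) / real n \<le> \<alpha> / real n"
      using n by (intro divide_right_mono) auto
    moreover have "(1 + 2 * p / real n)\<^sup>2 = 1 + (4 * p + 4 * p\<^sup>2 / real n) / real n"
      using n by (simp add: power2_eq_square field_simps)
    ultimately have "(1 + 2 * p / real n)\<^sup>2 \<le> 1 + \<alpha> / real n" by linarith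
    then show "(1 + 2 * p / real n)\<^sup>2 * y \<le> (1 + \<alpha> / real n) * y"
      using that by (intro mult_right_mono)
    have "4 * p / real n * tree_exp p n (\<lambda>r. cube_sum r n) \<le> 4 * p / real n * (K3 * real n powr \<gamma>)"
      using K3(4)[of n] K3(1) \<gamma> K3(3) n assms
      by (intro mult_left_mono order_trans[OF K3(4)] powr_mono) auto
    also have "\<dots> = C * real n powr (\<gamma> - 1)"
      using n by (simp add: C_def powr_diff)
    finally show "4 * p / real n * tree_exp p n (\<lambda>r. cube_sum r n) \<le> C * real n powr (\<gamma> - 1)" .
  qed
  have v0: "0 \<le> tree_exp p n (\<lambda>r. (F r)\<^sup>2)" for n F
    using assms by (intro tree_exp_nonneg) auto
  have diag: "v n \<le> K * real n powr \<gamma>" if "n0 \<le> n" for n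
  proof (rule recursion_power_bound[where x = v and \<alpha> = \<alpha> and \<gamma> = \<gamma> and K = K and C = C and ?n0.0 = n0])
    fix n assume n: "n0 \<le> n"
    have "v (Suc n) \<le> (1 + 2 * p / real n)\<^sup>2 * v n + 4 * p / real n * tree_exp p n (\<lambda>r. cube_sum r n)"
      unfolding v_def
      by (rule tree_exp_pairs_diag_var_Suc[OF _ _ mean_pairs_Suc]) (use assms in auto)
    also have "\<dots> \<le> (1 + \<alpha> / real n) * v n + C * real n powr (\<gamma> - 1)"
      using n by (rule step) (simp add: v_def v0)
    finally show "v (Suc n) \<le> (1 + \<alpha> / real n) * v n + C * real n powr (\<gamma> - 1)" .
  qed (use \<gamma> K n0 that in auto)
  have "tree_exp p b (\<lambda>r. (pairs r a b - mean_pairs p a / growth p a * growth p b)\<^sup>2) \<le> K * real b powr \<gamma>"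
    if "n0 \<le> a" "a \<le> b" for a b
  proof -
    define w where "w b = tree_exp p b (\<lambda>r. (pairs r a b - mean_pairs p a / growth p a * growth p b)\<^sup>2)" for b
    \<comment> \<open>The recursion off the diagonal is dominated by the one on it and is started at
      time \<open>a\<close> from the diagonal bound, so the same \<open>K\<close> and \<gamma> serve
      for all \<open>a\<close>.\<close>
    have "w b \<le> K * real b powr \<gamma>"
    proof (rule recursion_power_bound[where x = w and \<alpha> = \<alpha> and \<gamma> = \<gamma> and K = K and C = C and ?n0.0 = a])
      show "w a \<le> K * real a powr \<gamma>"
        using diag[OF that(1)] growth_pos[of p a] assms by (simp add: w_def v_def)
    next
      fix n assume n: "a \<le> n"
      have "w (Suc n) \<le> (1 + p / real n)\<^sup>2 * w n + p / real n * tree_exp p n (\<lambda>r. cube_sum r n)"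
        unfolding w_def
        by (rule tree_exp_pairs_var_Suc) (use assms n in \<open>simp_all add: growth_Suc mult_ac\<close>)
      also have "\<dots> \<le> (1 + 2 * p / real n)\<^sup>2 * w n + 4 * p / real n * tree_exp p n (\<lambda>r. cube_sum r n)"
        using assms by (intro add_mono mult_right_mono power_mono divide_right_mono tree_exp_nonneg)
          (auto simp: w_def v0 cube_sum_nonneg)
      also have "\<dots> \<le> (1 + \<alpha> / real n) * w n + C * real n powr (\<gamma> - 1)"
        using n that by (intro step) (simp_all add: w_def v0)
      finally show "w (Suc n) \<le> (1 + \<alpha> / real n) * w n + C * real n powr (\<gamma> - 1)" .
    qed (use \<gamma> K n0 that in auto)
    then show ?thesis by (simp add: w_def)
  qed
  then show ?thesis using \<gamma> K by (intro that[of K \<gamma> n0]) auto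
qed

text \<open>Cauchy-Schwarz for \<open>tree_exp\<close>, from nonnegativity of the variance of the
  absolute value of \<open>F\<close>.\<close>

lemma tree_exp_abs_le_sqrt:
  assumes "0 \<le> p" "p \<le> 1"
  shows "tree_exp p n (\<lambda>r. \<bar>F r\<bar>) \<le> sqrt (tree_exp p n (\<lambda>r. (F r)\<^sup>2))"
proof -
  define m where "m = tree_exp p n (\<lambda>r. \<bar>F r\<bar>)"
  have "0 \<le> tree_exp p n (\<lambda>r. (\<bar>F r\<bar> - m)\<^sup>2)"
    using assms by (intro tree_exp_nonneg) auto
  also have "(\<lambda>r. (\<bar>F r\<bar> - m)\<^sup>2) = (\<lambda>r. ((F r)\<^sup>2 - (2 * m) * \<bar>F r\<bar>) + m\<^sup>2)"
    by (auto simp: power2_eq_square algebra_simps)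
  also have "tree_exp p n \<dots> = tree_exp p n (\<lambda>r. (F r)\<^sup>2) - 2 * m * m + m\<^sup>2"
    by (simp only: tree_exp_add tree_exp_diff tree_exp_mult_left m_def[symmetric] tree_exp_const)
  finally have "m\<^sup>2 \<le> tree_exp p n (\<lambda>r. (F r)\<^sup>2)"
    by (simp add: power2_eq_square)
  then show ?thesis unfolding m_def by (rule real_le_rsqrt)
qed

section \<open>Limits along the times \<open>nat \<lfloor>t * real n\<rfloor>\<close>\<close>

lemma nat_floor_div_tendsto:
  assumes "0 \<le> t"
  shows "(\<lambda>n. real (nat \<lfloor>t * real n\<rfloor>) / real n) \<longlonglongrightarrow> t"
proof (rule tendsto_sandwich)
  show "\<forall>\<^sub>F n in sequentially. t - 1 / real n \<le> real (nat \<lfloor>t * real n\<rfloor>) / real n"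
    using eventually_gt_at_top[of 0]
  proof eventually_elim
    case (elim n)
    have "t * real n - 1 \<le> real (nat \<lfloor>t * real n\<rfloor>)" by linarith
    then have "(t * real n - 1) / real n \<le> real (nat \<lfloor>t * real n\<rfloor>) / real n"
      by (intro divide_right_mono) auto
    then show ?case using elim by (simp add: diff_divide_distrib)
  qed
  show "\<forall>\<^sub>F n in sequentially. real (nat \<lfloor>t * real n\<rfloor>) / real n \<le> t"
    using eventually_gt_at_top[of 0]
  proof eventually_elim
    case (elim n)
    have "real (nat \<lfloor>t * real n\<rfloor>) \<le> t * real n" using assms by simp
    then show ?case using elim by (simp add: field_simps)
  qed
  show "(\<lambda>n. t - 1 / real n) \<longlonglongrightarrow> t" by real_asymp
qed simp

lemma nat_floor_mult_at_top:
  assumes "0 < t"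
  shows "filterlim (\<lambda>n. nat \<lfloor>t * real n\<rfloor>) at_top sequentially"
proof -
  have "filterlim (\<lambda>n. t * real n) at_top sequentially"
    using assms by (intro filterlim_tendsto_pos_mult_at_top[OF tendsto_const] filterlim_real_sequentially)
  from filterlim_compose[OF filterlim_nat_sequentially filterlim_compose[OF filterlim_floor_sequentially this]]
  show ?thesis .
qed

lemma growth_floor_tendsto:
  assumes "0 < p" "0 < t"
  shows "(\<lambda>n. growth p (nat \<lfloor>t * real n\<rfloor>) / real n powr p) \<longlonglongrightarrow> t powr p * inverse (Gamma (p + 1))"
proof -
  let ?b = "\<lambda>n. nat \<lfloor>t * real n\<rfloor>"
  have "(\<lambda>n. growth p (?b n) / real (?b n) powr p) \<longlonglongrightarrow> inverse (Gamma (p + 1))"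
    by (rule filterlim_compose[OF growth_asymp nat_floor_mult_at_top]) (use assms in auto)
  moreover have "(\<lambda>n. (real (?b n) / real n) powr p) \<longlonglongrightarrow> t powr p"
    using assms by (intro tendsto_powr nat_floor_div_tendsto) auto
  ultimately have "(\<lambda>n. (real (?b n) / real n) powr p * (growth p (?b n) / real (?b n) powr p))
      \<longlonglongrightarrow> t powr p * inverse (Gamma (p + 1))"
    by (rule tendsto_mult[rotated])
  moreover have "\<forall>\<^sub>F n in sequentially. 0 < ?b n"
    using eventually_compose_filterlim[OF eventually_gt_at_top[of 0] nat_floor_mult_at_top[OF assms(2)]] .
  then have "\<forall>\<^sub>F n in sequentially. (real (?b n) / real n) powr p * (growth p (?b n) / real (?b n) powr p)
      = growth p (?b n) / real n powr p"
    using eventually_gt_at_top[of 0]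
  proof eventually_elim
    case (elim n)
    have "(x / y) powr p * (g / x powr p) = g / y powr p" if "0 < x" "0 < y" for x y g :: real
      using that by (simp add: powr_divide)
    from this[of "real (?b n)" "real n"] elim show ?case by (simp only: of_nat_0_less_iff)
  qed
  ultimately show ?thesis by (rule Lim_transform_eventually)
qed

lemma growth_ratio_tendsto:
  assumes "0 < p" "0 < s" "0 < t"
  shows "(\<lambda>n. growth p (nat \<lfloor>t * real n\<rfloor>) / growth p (nat \<lfloor>s * real n\<rfloor>)) \<longlonglongrightarrow> (t / s) powr p"
proof -
  have G: "0 < inverse (Gamma (p + 1))" using assms by (simp add: Gamma_real_pos)
  then have "0 < s powr p * inverse (Gamma (p + 1))" using assms by simp
  then have "s powr p * inverse (Gamma (p + 1)) \<noteq> 0" by (rule less_imp_neq[symmetric])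
  then have "(\<lambda>n. (growth p (nat \<lfloor>t * real n\<rfloor>) / real n powr p) / (growth p (nat \<lfloor>s * real n\<rfloor>) / real n powr p))
     \<longlonglongrightarrow> (t powr p * inverse (Gamma (p + 1))) / (s powr p * inverse (Gamma (p + 1)))"
    using assms by (intro tendsto_divide growth_floor_tendsto)
  also have "(t powr p * inverse (Gamma (p + 1))) / (s powr p * inverse (Gamma (p + 1))) = (t / s) powr p"
    using assms less_imp_neq[OF G] by (simp add: powr_divide)
  finally show ?thesis
    by (rule Lim_transform_eventually)
      (use eventually_gt_at_top[of 0] in \<open>auto elim!: eventually_mono\<close>)
qed

lemma powr_floor_tendsto_0:
  assumes "0 \<le> t" "1 \<le> \<gamma>" "\<gamma> < \<beta>" "0 \<le> K"
  shows "(\<lambda>n. K * real (nat \<lfloor>t * real n\<rfloor>) powr \<gamma> / real n powr \<beta>) \<longlonglongrightarrow> 0"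
proof (rule tendsto_sandwich[OF _ _ tendsto_const])
  have "(\<lambda>n. real n powr (\<gamma> - \<beta>)) \<longlonglongrightarrow> 0"
    using assms by (intro tendsto_neg_powr filterlim_real_sequentially) auto
  then show "(\<lambda>n. K * t powr \<gamma> * real n powr (\<gamma> - \<beta>)) \<longlonglongrightarrow> 0"
    by (rule tendsto_mult_right_zero)
  show "\<forall>\<^sub>F n in sequentially. K * real (nat \<lfloor>t * real n\<rfloor>) powr \<gamma> / real n powr \<beta> \<le> K * t powr \<gamma> * real n powr (\<gamma> - \<beta>)"
    using eventually_gt_at_top[of 0]
  proof eventually_elim
    case (elim n)
    have "real (nat \<lfloor>t * real n\<rfloor>) \<le> t * real n" using assms by simp
    then have "K * real (nat \<lfloor>t * real n\<rfloor>) powr \<gamma> / real n powr \<beta> \<le> K * (t * real n) powr \<gamma> / real n powr \<beta>"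
      using assms by (intro divide_right_mono mult_left_mono powr_mono2) auto
    also have "\<dots> = K * t powr \<gamma> * real n powr (\<gamma> - \<beta>)"
      using assms elim by (simp add: powr_mult powr_diff)
    finally show ?case .
  qed
qed (use assms in auto)

lemma cube_sum_floor_tendsto:
  assumes "0 < p" "p < 1 / 2" "0 \<le> t"
  shows "(\<lambda>n. tree_exp p (nat \<lfloor>t * real n\<rfloor>) (\<lambda>r. cube_sum r (nat \<lfloor>t * real n\<rfloor>)) / real n powr (3 / 2)) \<longlonglongrightarrow> 0"
proof -
  obtain K \<gamma> where K: "0 \<le> K" "1 \<le> \<gamma>" "\<gamma> < 3 / 2"
    "\<And>n. tree_exp p n (\<lambda>r. cube_sum r n) \<le> K * real n powr \<gamma>"
    using cube_sum_bound[OF assms(1,2)] by blast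
  show ?thesis
  proof (rule tendsto_sandwich[OF _ _ tendsto_const powr_floor_tendsto_0[OF assms(3) K(2,3,1)]])
    show "\<forall>\<^sub>F n in sequentially. 0 \<le> tree_exp p (nat \<lfloor>t * real n\<rfloor>) (\<lambda>r. cube_sum r (nat \<lfloor>t * real n\<rfloor>)) / real n powr (3 / 2)"
      using assms by (intro always_eventually allI divide_nonneg_nonneg tree_exp_nonneg cube_sum_nonneg) auto
    show "\<forall>\<^sub>F n in sequentially. tree_exp p (nat \<lfloor>t * real n\<rfloor>) (\<lambda>r. cube_sum r (nat \<lfloor>t * real n\<rfloor>)) / real n powr (3 / 2)
        \<le> K * real (nat \<lfloor>t * real n\<rfloor>) powr \<gamma> / real n powr (3 / 2)"
      using K by (intro always_eventually allI divide_right_mono) auto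
  qed
qed

text \<open>The limiting covariance arises as \<open>s / (1 - 2 p)\<close>, the density of the diagonal pairs, times
  the growth \<open>(t / s) powr p\<close> after time \<open>s\<close>.\<close>

lemma pairs_floor_tendsto:
  assumes "0 < p" "p < 1 / 2" "0 \<le> s" "s \<le> t"
  shows "(\<lambda>n. tree_exp p (nat \<lfloor>t * real n\<rfloor>) (\<lambda>r.
     \<bar>pairs r (nat \<lfloor>s * real n\<rfloor>) (nat \<lfloor>t * real n\<rfloor>) / real n - t powr p * s powr (1 - p) / (1 - 2 * p)\<bar>)) \<longlonglongrightarrow> 0"
proof (cases "s = 0")
  case True
  \<comment> \<open>For \<open>s = 0\<close> the time \<open>a\<close> never passes the threshold
    \<open>n0\<close> of the variance bound; here the sum vanishes identically.\<close>
  have "pairs r 0 b = 0" for r b by (simp add: pairs_def cluster_def)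
  then show ?thesis using True assms by simp
next
  case False
  then have s: "0 < s" "0 < t" using assms by auto
  define a where "a n = nat \<lfloor>s * real n\<rfloor>" for n
  define b where "b n = nat \<lfloor>t * real n\<rfloor>" for n
  define c where "c n = mean_pairs p (a n) / growth p (a n) * growth p (b n)" for n
  define L where "L = t powr p * s powr (1 - p) / (1 - 2 * p)"
  have ab: "a n \<le> b n" for n
    unfolding a_def b_def using assms by (intro nat_mono floor_mono mult_right_mono) auto
  obtain K \<gamma> n0 where K: "0 \<le> K" "1 \<le> \<gamma>" "\<gamma> < 2" and var:
    "\<And>a b. n0 \<le> a \<Longrightarrow> a \<le> b \<Longrightarrow>
       tree_exp p b (\<lambda>r. (pairs r a b - mean_pairs p a / growth p a * growth p b)\<^sup>2) \<le> K * real b powr \<gamma>"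
    using pairs_var_bound[OF assms(1,2)] by metis
  have atop: "filterlim a at_top sequentially"
    unfolding a_def by (rule nat_floor_mult_at_top[OF s(1)])
  have "(\<lambda>n. mean_pairs p (a n) / real (a n) * (real (a n) / real n) * (growth p (b n) / growth p (a n)))
     \<longlonglongrightarrow> 1 / (1 - 2 * p) * s * (t / s) powr p"
    unfolding a_def b_def
    by (intro tendsto_mult filterlim_compose[OF mean_pairs_asymp nat_floor_mult_at_top]
        nat_floor_div_tendsto growth_ratio_tendsto) (use assms s in auto)
  also have "1 / (1 - 2 * p) * s * (t / s) powr p = L"
    using s by (simp add: L_def powr_divide powr_diff mult_ac)
  finally have cn: "(\<lambda>n. c n / real n) \<longlonglongrightarrow> L"
  proof (rule Lim_transform_eventually)
    have "\<forall>\<^sub>F n in sequentially. 0 < a n"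
      using eventually_compose_filterlim[OF eventually_gt_at_top[of 0] atop] .
    then show "\<forall>\<^sub>F n in sequentially. mean_pairs p (a n) / real (a n) * (real (a n) / real n) *
        (growth p (b n) / growth p (a n)) = c n / real n"
      by eventually_elim (simp add: c_def)
  qed
  show ?thesis unfolding a_def[symmetric] b_def[symmetric] L_def[symmetric]
  proof (rule tendsto_sandwich[OF _ _ tendsto_const])
    \<comment> \<open>The fluctuation has standard deviation of order
      \<open>n powr (\<gamma> / 2)\<close> with \<open>\<gamma> < 2\<close>, so it vanishes after
      division by \<open>n\<close>; the remaining error is that of the centring.\<close>
    have "(\<lambda>n. sqrt (K * real (nat \<lfloor>t * real n\<rfloor>) powr \<gamma> / real n powr 2) + \<bar>c n / real n - L\<bar>) \<longlonglongrightarrow> sqrt 0 + \<bar>L - L\<bar>"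
      using K assms by (intro tendsto_intros powr_floor_tendsto_0 cn) auto
    then show "(\<lambda>n. sqrt (K * real (b n) powr \<gamma> / real n powr 2) + \<bar>c n / real n - L\<bar>) \<longlonglongrightarrow> 0"
      by (simp add: b_def)
    have "\<forall>\<^sub>F n in sequentially. n0 \<le> a n"
      using eventually_compose_filterlim[OF eventually_ge_at_top[of n0] atop] .
    then show "\<forall>\<^sub>F n in sequentially. tree_exp p (b n) (\<lambda>r. \<bar>pairs r (a n) (b n) / real n - L\<bar>)
        \<le> sqrt (K * real (b n) powr \<gamma> / real n powr 2) + \<bar>c n / real n - L\<bar>"
      using eventually_gt_at_top[of 0]
    proof eventually_elim
      case (elim n)
      have "tree_exp p (b n) (\<lambda>r. \<bar>pairs r (a n) (b n) / real n - L\<bar>) \<le>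
          tree_exp p (b n) (\<lambda>r. 1 / real n * \<bar>pairs r (a n) (b n) - c n\<bar> + \<bar>c n / real n - L\<bar>)"
      proof (rule tree_exp_mono)
        fix r
        have "pairs r (a n) (b n) / real n - L = 1 / real n * (pairs r (a n) (b n) - c n) + (c n / real n - L)"
          by (simp add: diff_divide_distrib)
        then show "\<bar>pairs r (a n) (b n) / real n - L\<bar> \<le> 1 / real n * \<bar>pairs r (a n) (b n) - c n\<bar> + \<bar>c n / real n - L\<bar>"
          using abs_triangle_ineq[of "1 / real n * (pairs r (a n) (b n) - c n)" "c n / real n - L"]
          unfolding abs_mult by simp
      qed (use assms in auto)
      also have "\<dots> = 1 / real n * tree_exp p (b n) (\<lambda>r. \<bar>pairs r (a n) (b n) - c n\<bar>) + \<bar>c n / real n - L\<bar>"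
        by (simp only: tree_exp_add tree_exp_mult_left tree_exp_const)
      also have "\<dots> \<le> 1 / real n * sqrt (K * real (b n) powr \<gamma>) + \<bar>c n / real n - L\<bar>"
        using assms elim ab[of n] var[of "a n" "b n"]
        by (intro add_right_mono mult_left_mono order_trans[OF tree_exp_abs_le_sqrt] real_sqrt_le_mono)
          (auto simp: c_def)
      also have "1 / real n * sqrt (K * real (b n) powr \<gamma>) = sqrt (K * real (b n) powr \<gamma> / real n powr 2)"
        by (simp add: real_sqrt_divide)
      finally show ?case .
    qed
  qed (use assms in \<open>auto intro!: always_eventually tree_exp_nonneg\<close>)
qed


section \<open>Weak convergence on real sequences\<close>

text \<open>An algebra of test functions whose expectations are determined by characteristic
  functions of finite linear combinations. The phase \<open>b\<close> brings in the sines, and the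
  empty sum the constants.\<close>

inductive trig_function :: "((nat \<Rightarrow> real) \<Rightarrow> real) \<Rightarrow> bool" where
  cos: "finite F \<Longrightarrow> trig_function (\<lambda>x. cos (b + (\<Sum>l\<in>F. c l * x l)))"
| add: "trig_function f \<Longrightarrow> trig_function g \<Longrightarrow> trig_function (\<lambda>x. f x + g x)"
| scale: "trig_function f \<Longrightarrow> trig_function (\<lambda>x. a * f x)"

lemma trig_function_const: "trig_function (\<lambda>x. a)"
  using trig_function.scale[OF trig_function.cos[of "{}" 0], of a] by simp

text \<open>The product formula leads to the sum and the difference of the two arguments; extending
  both coefficient families by \<open>0\<close> makes these linear combinations over the
  union.\<close>

lemma trig_function_cos_mult_cos:
  assumes "finite F" "finite G"
  shows "trig_function (\<lambda>x. cos (b + (\<Sum>l\<in>F. c l * x l)) * cos (b' + (\<Sum>l\<in>G. c' l * x l)))"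
proof -
  define d where "d s l = (if l \<in> F then c l else 0) + s * (if l \<in> G then c' l else 0)" for s :: real and l
  have *: "(\<Sum>l\<in>F. c l * x l) + s * (\<Sum>l\<in>G. c' l * x l) = (\<Sum>l\<in>F \<union> G. d s l * x l)" for s and x :: "nat \<Rightarrow> real"
  proof -
    have "(\<Sum>l\<in>F. c l * x l) = (\<Sum>l\<in>F \<union> G. (if l \<in> F then c l else 0) * x l)"
      using assms by (intro sum.mono_neutral_cong_left) auto
    moreover have "(\<Sum>l\<in>G. c' l * x l) = (\<Sum>l\<in>F \<union> G. (if l \<in> G then c' l else 0) * x l)"
      using assms by (intro sum.mono_neutral_cong_left) auto
    ultimately show ?thesis
      unfolding d_def by (simp only: distrib_right sum.distrib sum_distrib_left mult.assoc)
  qed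
  have "cos (b + (\<Sum>l\<in>F. c l * x l)) * cos (b' + (\<Sum>l\<in>G. c' l * x l)) =
      1 / 2 * (cos ((b - b') + (\<Sum>l\<in>F \<union> G. d (-1) l * x l)) + cos ((b + b') + (\<Sum>l\<in>F \<union> G. d 1 l * x l)))"
    for x :: "nat \<Rightarrow> real"
    unfolding *[symmetric] cos_times_cos by (simp add: algebra_simps)
  moreover have "trig_function (\<lambda>x. 1 / 2 * (cos ((b - b') + (\<Sum>l\<in>F \<union> G. d (-1) l * x l)) +
      cos ((b + b') + (\<Sum>l\<in>F \<union> G. d 1 l * x l))))"
    using assms by (intro trig_function.intros) auto
  ultimately show ?thesis by (simp only:)
qed

lemma trig_function_mult:
  assumes "trig_function f" "trig_function g"
  shows "trig_function (\<lambda>x. f x * g x)"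
  using assms(1)
proof induction
  case (cos F b c)
  note F = this
  from assms(2) show ?case
  proof induction
    case (cos G b' c')
    then show ?case by (intro trig_function_cos_mult_cos F)
  next
    case (add f g)
    show ?case unfolding distrib_left using add.IH by (rule trig_function.add)
  next
    case (scale f a)
    show ?case unfolding mult.left_commute[of _ a] using scale.IH by (rule trig_function.scale)
  qed
next
  case (add f g)
  then show ?case unfolding distrib_right by (intro trig_function.add)
next
  case (scale f a)
  then show ?case unfolding mult.assoc by (intro trig_function.scale)
qed

text \<open>Applied below to a polynomial close to a clamp, in order to bound an approximation
  globally without leaving the algebra.\<close>

lemma trig_function_polynomial:
  assumes "real_polynomial_function q" "trig_function h"
  shows "trig_function (\<lambda>x. q (h x))"
  using assms(1)
proof induction
  case (linear f)
  then obtain c where "f = (\<lambda>x. x * c)" by (auto simp: real_bounded_linear)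
  then show ?case using trig_function.scale[OF assms(2), of c] by (simp add: mult.commute)
qed (auto intro: trig_function_const trig_function.add trig_function_mult)

lemma trig_function_continuous: "trig_function f \<Longrightarrow> continuous_on S f"
proof (induction rule: trig_function.induct)
  case (cos F b c)
  have "continuous_on S (\<lambda>x. x l)" for l :: nat
    by (rule continuous_on_subset[OF continuous_on_product_coordinates]) auto
  then show ?case by (intro continuous_intros)
qed (intro continuous_intros; assumption)+

lemma trig_function_bounded: "trig_function f \<Longrightarrow> \<exists>C. \<forall>x. \<bar>f x\<bar> \<le> C"
proof (induction rule: trig_function.induct)
  case (cos F b c)
  show ?case by (intro exI[of _ 1]) auto
next
  case (add f g)
  then obtain C D where "\<And>x. \<bar>f x\<bar> \<le> C" "\<And>x. \<bar>g x\<bar> \<le> D" by blast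
  then show ?case by (intro exI[of _ "C + D"] allI order_trans[OF abs_triangle_ineq] add_mono)
next
  case (scale f a)
  then obtain C where "\<And>x. \<bar>f x\<bar> \<le> C" by blast
  then show ?case by (intro exI[of _ "\<bar>a\<bar> * C"]) (auto simp: abs_mult intro: mult_left_mono)
qed

lemma trig_function_separates:
  fixes x y :: "nat \<Rightarrow> real"
  assumes "x \<noteq> y"
  obtains f where "trig_function f" "f x \<noteq> f y"
proof -
  obtain l where l: "x l \<noteq> y l" using assms by auto
  \<comment> \<open>Scaling by \<open>1 / s\<close> brings both coordinates into
    \<open>[-1, 1]\<close>, inside the interval where the sine is injective.\<close>
  define s where "s = \<bar>x l\<bar> + \<bar>y l\<bar> + 1"
  have s: "0 < s" "\<bar>x l\<bar> \<le> s" "\<bar>y l\<bar> \<le> s" by (auto simp: s_def)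
  define d where "d = 1 / s"
  have d: "0 < d" "\<bar>d * x l\<bar> \<le> 1" "\<bar>d * y l\<bar> \<le> 1"
    using s by (simp_all add: d_def abs_mult)
  have "sin (d * x l) \<noteq> sin (d * y l)"
  proof
    assume eq: "sin (d * x l) = sin (d * y l)"
    have b: "- (pi / 2) \<le> u" "u \<le> pi / 2" if "\<bar>u\<bar> \<le> 1" for u
      using that pi_ge_two by linarith+
    have "d * x l = d * y l"
      by (rule sin_inj_pi[OF b[OF d(2)] b[OF d(3)] eq])
    then show False using l d(1) by simp
  qed
  moreover have "cos (- (pi / 2) + u) = sin u" for u
    by (simp add: cos_diff)
  ultimately show ?thesis
    using trig_function.cos[of "{l}" "- (pi / 2)" "\<lambda>_. d"]
    by (intro that[of "\<lambda>x. cos (- (pi / 2) + (\<Sum>l\<in>{l}. d * x l))"]) simp_all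
qed

text \<open>A product of compact intervals, compact by Tychonoff's theorem. The widths may grow with
  \<open>l\<close>, which lets mere second moment bounds in each coordinate give it large
  probability.\<close>

definition tube :: "(nat \<Rightarrow> real) \<Rightarrow> (nat \<Rightarrow> real) set" where
  "tube b = {x. \<forall>l. \<bar>x l\<bar> \<le> b l}"

lemma compact_tube: "compact (tube b)"
proof -
  have "compactin (product_topology (\<lambda>_. euclidean) UNIV) (PiE UNIV (\<lambda>l. {- b l..b l}))"
    unfolding compactin_PiE by auto
  moreover have "PiE UNIV (\<lambda>l. {- b l..b l}) = tube b"
    by (auto simp: tube_def abs_le_iff PiE_def Pi_def) (metis minus_le_iff)+
  ultimately show ?thesis
    by (simp add: euclidean_product_topology)
qed

lemma sets_tube [measurable]: "tube b \<in> sets borel"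
  by (intro borel_compact compact_tube)

text \<open>The Stone-Weierstrass theorem controls the approximation on the tube only; off the tube
  it could be large enough to spoil expectations. Composition with a polynomial that nearly clamps
  the range of \<open>h\<close> restores a bound that depends on neither the tube nor
  \<epsilon>.\<close>

lemma trig_approximation:
  assumes g: "continuous_on UNIV g" and C: "\<And>x. \<bar>g x\<bar> \<le> C" and \<epsilon>: "0 < \<epsilon>" "\<epsilon> \<le> 1"
  obtains h where "trig_function h" "\<And>x. x \<in> tube b \<Longrightarrow> \<bar>g x - h x\<bar> \<le> 2 * \<epsilon>" "\<And>x. \<bar>h x\<bar> \<le> C + 2"
proof -
  have C0: "0 \<le> C" using C[of undefined] by linarith
  have "\<exists>h. trig_function h \<and> (\<forall>x\<in>tube b. \<bar>g x - h x\<bar> < \<epsilon>)"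
  proof (rule Stone_Weierstrass_HOL[where P = trig_function])
    show "\<exists>f. trig_function f \<and> f x \<noteq> f y" if "x \<in> tube b \<and> y \<in> tube b \<and> x \<noteq> y" for x y
      using trig_function_separates[of x y] that by blast
  qed (auto intro: compact_tube trig_function_const trig_function_continuous trig_function.add
        trig_function_mult continuous_on_subset[OF g] \<epsilon>)
  then obtain h where h: "trig_function h" "\<And>x. x \<in> tube b \<Longrightarrow> \<bar>g x - h x\<bar> < \<epsilon>" by blast
  obtain H where H: "\<And>x. \<bar>h x\<bar> \<le> H" using trig_function_bounded[OF h(1)] by blast
  \<comment> \<open>On the tube \<open>h\<close> stays within \<open>C + \<epsilon>\<close>, where
    clamping at \<open>C + 1\<close> changes nothing.\<close>
  define clamp where "clamp u = max (- (C + 1)) (min (C + 1) u)" for u :: real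
  obtain q where q: "real_polynomial_function q" "\<And>u. u \<in> {- H..H} \<Longrightarrow> \<bar>clamp u - q u\<bar> < \<epsilon>"
  proof (rule Stone_Weierstrass_real_polynomial_function[of "{- H..H}" clamp \<epsilon>])
    show "continuous_on {- H..H} clamp"
      unfolding clamp_def by (intro continuous_intros)
  qed (use \<epsilon> in auto)
  have qh: "\<bar>clamp (h x) - q (h x)\<bar> < \<epsilon>" for x
    using H[of x] by (intro q) auto
  show ?thesis
  proof (rule that)
    show "trig_function (\<lambda>x. q (h x))" by (rule trig_function_polynomial[OF q(1) h(1)])
    show "\<bar>g x - q (h x)\<bar> \<le> 2 * \<epsilon>" if "x \<in> tube b" for x
    proof -
      have "clamp (h x) = h x" using h(2)[OF that] C[of x] \<epsilon> C0 unfolding clamp_def by linarith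
      then show ?thesis using h(2)[OF that] qh[of x] by linarith
    qed
    show "\<bar>q (h x)\<bar> \<le> C + 2" for x
    proof -
      have "\<bar>clamp u\<bar> \<le> C + 1" for u using C0 unfolding clamp_def by linarith
      from this[of "h x"] show ?thesis using qh[of x] \<epsilon> by linarith
    qed
  qed
qed

text \<open>Chebyshev's inequality in each coordinate and a union bound; the weights
  \<open>(1 / 2) ^ Suc l\<close> sum to one.\<close>

lemma (in prob_space) prob_tube:
  assumes [measurable]: "Y \<in> borel_measurable M"
    and int: "\<And>l. integrable M (\<lambda>\<omega>. (Y \<omega> l)\<^sup>2)" and C: "\<And>l. expectation (\<lambda>\<omega>. (Y \<omega> l)\<^sup>2) \<le> C l"
    and b: "\<And>l. 0 < b l" "\<And>l. C l / (b l)\<^sup>2 \<le> \<epsilon> * (1 / 2) ^ Suc l"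
  shows "prob {\<omega> \<in> space M. Y \<omega> \<notin> tube b} \<le> \<epsilon>"
proof -
  have [measurable]: "(\<lambda>\<omega>. Y \<omega> l) \<in> borel_measurable M" for l
    using measurable_compose[OF assms(1) measurable_product_coordinates] by simp
  define A where "A l = {\<omega> \<in> space M. b l \<le> \<bar>Y \<omega> l\<bar>}" for l
  have A[measurable]: "A l \<in> events" for l unfolding A_def by measurable
  have pA: "prob (A l) \<le> \<epsilon> * (1 / 2) ^ Suc l" for l
  proof -
    have "prob (A l) = prob {\<omega> \<in> space M. (b l)\<^sup>2 \<le> (Y \<omega> l)\<^sup>2}"
      unfolding A_def using b(1)[of l] by (intro arg_cong[where f = prob]) (auto simp: abs_le_square_iff[symmetric])
    also have "\<dots> \<le> expectation (\<lambda>\<omega>. (Y \<omega> l)\<^sup>2) / (b l)\<^sup>2"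
      using b(1)[of l] by (intro integral_Markov_inequality_measure[where A = "{}"] int) auto
    also have "\<dots> \<le> C l / (b l)\<^sup>2" by (intro divide_right_mono C) auto
    finally show ?thesis using b(2)[of l] by linarith
  qed
  have sums: "(\<lambda>l. \<epsilon> * (1 / 2) ^ Suc l) sums \<epsilon>"
    using sums_mult[OF power_half_series, of \<epsilon>] by simp
  have summ: "summable (\<lambda>l. prob (A l))"
    by (rule summable_comparison_test_ev[OF _ sums_summable[OF sums]]) (use pA in auto)
  have "prob {\<omega> \<in> space M. Y \<omega> \<notin> tube b} \<le> prob (\<Union>l. A l)"
    by (intro finite_measure_mono) (auto simp: A_def tube_def not_le intro: less_imp_le)
  also have "\<dots> \<le> (\<Sum>l. prob (A l))"
    by (rule finite_measure_subadditive_countably) (use summ A in auto)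
  also have "\<dots> \<le> (\<Sum>l. \<epsilon> * (1 / 2) ^ Suc l)"
    by (intro suminf_le pA summ sums_summable[OF sums])
  finally show ?thesis using sums_unique[OF sums] by simp
qed

text \<open>The difference is at most \<open>2 * \<epsilon>\<close> on the tube and
  \<open>C + (C + 2)\<close> off it, an event of probability at most \<epsilon>.\<close>

lemma (in prob_space) expectation_diff_off_tube:
  assumes [measurable]: "Y \<in> borel_measurable M"
    and g: "continuous_on UNIV g" "\<And>x. \<bar>g x\<bar> \<le> C"
    and h: "continuous_on UNIV h" "\<And>x. \<bar>h x\<bar> \<le> C + 2"
    and near: "\<And>x. x \<in> tube b \<Longrightarrow> \<bar>g x - h x\<bar> \<le> 2 * \<epsilon>" and \<epsilon>: "0 \<le> \<epsilon>"
    and P: "prob {\<omega> \<in> space M. Y \<omega> \<notin> tube b} \<le> \<epsilon>"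
  shows "\<bar>expectation (\<lambda>\<omega>. g (Y \<omega>)) - expectation (\<lambda>\<omega>. h (Y \<omega>))\<bar> \<le> (2 * C + 4) * \<epsilon>"
proof -
  have [measurable]: "g \<in> borel_measurable borel" "h \<in> borel_measurable borel"
    using g h by (auto intro: borel_measurable_continuous_onI)
  have gi: "integrable M (\<lambda>\<omega>. g (Y \<omega>))" by (rule integrable_const_bound[of _ C]) (use g in auto)
  have hi: "integrable M (\<lambda>\<omega>. h (Y \<omega>))" by (rule integrable_const_bound[of _ "C + 2"]) (use h in auto)
  have C0: "0 \<le> C" using g(2)[of undefined] by linarith
  have ind: "integrable M (\<lambda>\<omega>. (2 * C + 2) * indicator {\<omega> \<in> space M. Y \<omega> \<notin> tube b} \<omega>)"
    by (intro integrable_mult_right integrable_real_indicator) (auto simp: less_top[symmetric])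
  have "\<bar>expectation (\<lambda>\<omega>. g (Y \<omega>)) - expectation (\<lambda>\<omega>. h (Y \<omega>))\<bar>
      = \<bar>expectation (\<lambda>\<omega>. g (Y \<omega>) - h (Y \<omega>))\<bar>" using gi hi by simp
  also have "\<dots> \<le> expectation (\<lambda>\<omega>. \<bar>g (Y \<omega>) - h (Y \<omega>)\<bar>)" by (rule integral_abs_bound)
  also have "\<dots> \<le> expectation (\<lambda>\<omega>. 2 * \<epsilon> + (2 * C + 2) * indicator {\<omega> \<in> space M. Y \<omega> \<notin> tube b} \<omega>)"
  proof (rule integral_mono)
    fix \<omega> assume "\<omega> \<in> space M"
    then show "\<bar>g (Y \<omega>) - h (Y \<omega>)\<bar> \<le> 2 * \<epsilon> + (2 * C + 2) * indicator {\<omega> \<in> space M. Y \<omega> \<notin> tube b} \<omega>"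
      using near[of "Y \<omega>"] g(2)[of "Y \<omega>"] h(2)[of "Y \<omega>"] \<epsilon> by (auto simp: indicator_def)
  qed (use gi hi ind in auto)
  also have "\<dots> = 2 * \<epsilon> + (2 * C + 2) * prob {\<omega> \<in> space M. Y \<omega> \<notin> tube b}"
    by (subst Bochner_Integration.integral_add[OF _ ind]) (simp_all add: prob_space)
  also have "\<dots> \<le> 2 * \<epsilon> + (2 * C + 2) * \<epsilon>"
    using P C0 by (intro add_left_mono mult_left_mono) auto
  finally show ?thesis by (simp add: algebra_simps)
qed

text \<open>Second moments bounded uniformly in \<open>n\<close> give a single tube that carries all
  the laws up to \<epsilon>. This takes the place of a compactness argument for measures:
  \<open>g\<close> is replaced by one trigonometric function for all \<open>n\<close> and for the
  limit at once.\<close>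

theorem weak_convergence_trig:
  fixes Y :: "nat \<Rightarrow> 'a \<Rightarrow> nat \<Rightarrow> real" and Z :: "'b \<Rightarrow> nat \<Rightarrow> real"
    and g :: "(nat \<Rightarrow> real) \<Rightarrow> real"
  assumes M: "prob_space M" and N: "prob_space N"
    and Y: "\<And>n. Y n \<in> borel_measurable M" and Z: "Z \<in> borel_measurable N"
    and Y2: "\<And>n l. integrable M (\<lambda>\<omega>. (Y n \<omega> l)\<^sup>2)" "\<And>n l. (\<integral>\<omega>. (Y n \<omega> l)\<^sup>2 \<partial>M) \<le> D l"
    and Z2: "\<And>l. integrable N (\<lambda>\<omega>. (Z \<omega> l)\<^sup>2)"
    and lim: "\<And>F b c. finite F \<Longrightarrow> (\<lambda>n. \<integral>\<omega>. cos (b + (\<Sum>l\<in>F. c l * Y n \<omega> l)) \<partial>M)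
        \<longlonglongrightarrow> (\<integral>\<omega>. cos (b + (\<Sum>l\<in>F. c l * Z \<omega> l)) \<partial>N)"
    and g: "continuous_on UNIV g" and C: "\<And>x. \<bar>g x\<bar> \<le> C"
  shows "(\<lambda>n. \<integral>\<omega>. g (Y n \<omega>) \<partial>M) \<longlonglongrightarrow> (\<integral>\<omega>. g (Z \<omega>) \<partial>N)"
proof -
  interpret M: prob_space M by fact
  interpret N: prob_space N by fact
  have C0: "0 \<le> C" using C[of undefined] by linarith
  have trig: "(\<lambda>n. \<integral>\<omega>. h (Y n \<omega>) \<partial>M) \<longlonglongrightarrow> (\<integral>\<omega>. h (Z \<omega>) \<partial>N)" if "trig_function h" for h
    using that
  proof induction
    case (cos F b c)
    then show ?case by (rule lim)
  next
    case (add f h)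
    have i: "integrable M (\<lambda>\<omega>. f (Y n \<omega>))" "integrable N (\<lambda>\<omega>. f (Z \<omega>))" if "trig_function f" for f n
    proof -
      obtain c where c: "\<And>x. \<bar>f x\<bar> \<le> c" using trig_function_bounded[OF \<open>trig_function f\<close>] by blast
      have [measurable]: "f \<in> borel_measurable borel"
        by (intro borel_measurable_continuous_onI trig_function_continuous that)
      note Y[measurable] Z[measurable]
      show "integrable M (\<lambda>\<omega>. f (Y n \<omega>))" by (rule M.integrable_const_bound[of _ c]) (use c in auto)
      show "integrable N (\<lambda>\<omega>. f (Z \<omega>))" by (rule N.integrable_const_bound[of _ c]) (use c in auto)
    qed
    then show ?case using add by (simp add: tendsto_add)
  next
    case (scale f a)
    then show ?case by (simp add: tendsto_mult_left)
  qed
  show ?thesis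
  proof (rule LIMSEQ_I)
    fix \<delta> :: real assume \<delta>: "0 < \<delta>"
    \<comment> \<open>Chosen such that the replacement costs at most \<open>\<delta> / 4\<close> for
      \<open>Y n\<close> and as much for \<open>Z\<close>, leaving \<open>\<delta> / 2\<close> for
      the trigonometric function.\<close>
    define \<epsilon> where "\<epsilon> = min 1 (\<delta> / (4 * (2 * C + 4)))"
    have \<epsilon>: "0 < \<epsilon>" "\<epsilon> \<le> 1" using \<delta> C0 by (auto simp: \<epsilon>_def)
    define E where "E l = max 1 (max (D l) (\<integral>\<omega>. (Z \<omega> l)\<^sup>2 \<partial>N))" for l
    \<comment> \<open>The solution of \<open>E l / (b l)^2 = \<epsilon> * (1 / 2) ^ Suc l\<close>,
      as Chebyshev's inequality demands.\<close>
    define b where "b l = sqrt (E l * 2 ^ Suc l / \<epsilon>)" for l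
    have E: "1 \<le> E l" "D l \<le> E l" "(\<integral>\<omega>. (Z \<omega> l)\<^sup>2 \<partial>N) \<le> E l" for l by (auto simp: E_def)
    have E0: "0 < E l" for l using E(1)[of l] by linarith
    have b: "0 < b l" for l using E0[of l] \<epsilon> by (simp add: b_def)
    have b2: "E l / (b l)\<^sup>2 \<le> \<epsilon> * (1 / 2) ^ Suc l" for l
    proof -
      have "(b l)\<^sup>2 = E l * 2 ^ Suc l / \<epsilon>" using E0[of l] \<epsilon> by (simp add: b_def)
      then show ?thesis using E0[of l] \<epsilon> by (simp add: power_divide)
    qed
    obtain h where h: "trig_function h" "\<And>x. x \<in> tube b \<Longrightarrow> \<bar>g x - h x\<bar> \<le> 2 * \<epsilon>" "\<And>x. \<bar>h x\<bar> \<le> C + 2"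
      using trig_approximation[OF g C \<epsilon>, of b] by blast
    have Yh: "\<bar>(\<integral>\<omega>. g (Y n \<omega>) \<partial>M) - (\<integral>\<omega>. h (Y n \<omega>) \<partial>M)\<bar> \<le> (2 * C + 4) * \<epsilon>" for n
      by (rule M.expectation_diff_off_tube[OF Y g C trig_function_continuous[OF h(1)] h(3) h(2) _
            M.prob_tube[OF Y Y2(1) order_trans[OF Y2(2) E(2)] b b2]]) (use \<epsilon> in auto)
    have Zh: "\<bar>(\<integral>\<omega>. g (Z \<omega>) \<partial>N) - (\<integral>\<omega>. h (Z \<omega>) \<partial>N)\<bar> \<le> (2 * C + 4) * \<epsilon>"
      by (rule N.expectation_diff_off_tube[OF Z g C trig_function_continuous[OF h(1)] h(3) h(2) _
            N.prob_tube[OF Z Z2 E(3) b b2]]) (use \<epsilon> in auto)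
    have small: "(2 * C + 4) * \<epsilon> \<le> \<delta> / 4"
    proof -
      define c where "c = 2 * C + 4"
      have c: "0 < c" using C0 by (simp add: c_def)
      have "c * \<epsilon> \<le> c * (\<delta> / (4 * c))"
        using c by (intro mult_left_mono) (simp_all add: \<epsilon>_def c_def)
      also have "c * (\<delta> / (4 * c)) = \<delta> / 4" using c by simp
      finally show ?thesis by (simp add: c_def)
    qed
    obtain n0 where H: "\<And>n. n0 \<le> n \<Longrightarrow> norm ((\<integral>\<omega>. h (Y n \<omega>) \<partial>M) - (\<integral>\<omega>. h (Z \<omega>) \<partial>N)) < \<delta> / 2"
      using LIMSEQ_D[OF trig[OF h(1)], of "\<delta> / 2"] \<delta> by auto
    have "norm ((\<integral>\<omega>. g (Y n \<omega>) \<partial>M) - (\<integral>\<omega>. g (Z \<omega>) \<partial>N)) < \<delta>" if "n0 \<le> n" for n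
      using H[OF that] Yh[of n] Zh small unfolding real_norm_def by linarith
    then show "\<exists>n0. \<forall>n\<ge>n0. norm ((\<integral>\<omega>. g (Y n \<omega>) \<partial>M) - (\<integral>\<omega>. g (Z \<omega>) \<partial>N)) < \<delta>" by blast
  qed
qed


section \<open>Locally uniform distance and the Skorokhod topology\<close>

text \<open>A metric for locally uniform convergence: the cap \<open>1 / (1 + t)\<close> discounts late times.\<close>

definition path_dist :: "(real \<Rightarrow> real) \<Rightarrow> (real \<Rightarrow> real) \<Rightarrow> real" where
  "path_dist x y = (SUP t\<in>{0..}. min \<bar>x t - y t\<bar> (1 / (1 + t)))"

lemma path_dist_bdd: "bdd_above ((\<lambda>t. min \<bar>x t - y t\<bar> (1 / (1 + t))) ` {0::real..})"
  by (rule bdd_aboveI[of _ 1]) (auto simp: min_le_iff_disj)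

lemma path_dist_ge: "0 \<le> t \<Longrightarrow> min \<bar>x t - y t\<bar> (1 / (1 + t)) \<le> path_dist x y"
  unfolding path_dist_def by (rule cSUP_upper[OF _ path_dist_bdd]) simp

lemma path_dist_least:
  "(\<And>t. 0 \<le> t \<Longrightarrow> min \<bar>x t - y t\<bar> (1 / (1 + t)) \<le> c) \<Longrightarrow> path_dist x y \<le> c"
  unfolding path_dist_def by (rule cSUP_least) auto

lemma path_dist_nonneg: "0 \<le> path_dist x y"
  by (rule order_trans[OF _ path_dist_ge[of 0]]) (simp_all add: min_def)

lemma path_dist_refl [simp]: "path_dist x x = 0"
  by (rule antisym[OF path_dist_least path_dist_nonneg]) auto

lemma path_dist_commute: "path_dist x y = path_dist y x"
  unfolding path_dist_def by (simp add: abs_minus_commute)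

lemma path_dist_triangle: "path_dist x z \<le> path_dist x y + path_dist y z"
proof (rule path_dist_least)
  fix t :: real assume t: "0 \<le> t"
  define c where "c = 1 / (1 + t)"
  have "0 \<le> c" using t by (simp add: c_def)
  have m: "min a c \<le> min b c + min d c" if "a \<le> b + d" "0 \<le> b" "0 \<le> d" for a b d
    using that \<open>0 \<le> c\<close> by (auto simp: min_def)
  have "min \<bar>x t - z t\<bar> c \<le> min \<bar>x t - y t\<bar> c + min \<bar>y t - z t\<bar> c"
    by (rule m) linarith+
  then show "min \<bar>x t - z t\<bar> (1 / (1 + t)) \<le> path_dist x y + path_dist y z"
    using path_dist_ge[OF t, of x y] path_dist_ge[OF t, of y z] unfolding c_def by linarith
qed

lemma path_dist_le:
  assumes "0 \<le> T" "\<And>t. 0 \<le> t \<Longrightarrow> t \<le> T \<Longrightarrow> \<bar>x t - y t\<bar> \<le> e"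
  shows "path_dist x y \<le> max e (1 / (1 + T))"
proof (rule path_dist_least)
  fix t :: real assume t: "0 \<le> t"
  show "min \<bar>x t - y t\<bar> (1 / (1 + t)) \<le> max e (1 / (1 + T))"
  proof (cases "t \<le> T")
    case True
    then show ?thesis using assms(2)[OF t] by (simp add: min_le_iff_disj le_max_iff_disj)
  next
    case False
    then have "1 / (1 + t) \<le> 1 / (1 + T)" using assms(1) t by (intro divide_left_mono) auto
    then show ?thesis by (simp add: min_le_iff_disj le_max_iff_disj)
  qed
qed

lemma path_dist_tendsto_0:
  assumes "\<And>T. 0 \<le> T \<Longrightarrow> uniform_limit {0..T} xs x sequentially"
  shows "(\<lambda>n. path_dist (xs n) x) \<longlonglongrightarrow> 0"
proof (rule LIMSEQ_I)
  fix e :: real assume e: "0 < e"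
  define T where "T = 2 / e"
  have T: "0 \<le> T" "1 / (1 + T) < e"
  proof -
    show T: "0 \<le> T" using e by (simp add: T_def)
    have "e * (1 + T) = e + 2" using e by (simp add: T_def distrib_left)
    then show "1 / (1 + T) < e" using e T by (simp add: pos_divide_less_eq)
  qed
  have "\<forall>\<^sub>F n in sequentially. \<forall>t\<in>{0..T}. dist (xs n t) (x t) < e / 2"
    using uniform_limitD[OF assms[OF T(1)], of "e / 2"] e by simp
  then obtain n0 where n0: "\<And>n t. n0 \<le> n \<Longrightarrow> 0 \<le> t \<Longrightarrow> t \<le> T \<Longrightarrow> \<bar>xs n t - x t\<bar> < e / 2"
    unfolding eventually_sequentially dist_real_def by (meson atLeastAtMost_iff)
  have "path_dist (xs n) x < e" if "n0 \<le> n" for n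
  proof -
    have "path_dist (xs n) x \<le> max (e / 2) (1 / (1 + T))"
      using n0[OF that] by (intro path_dist_le T less_imp_le)
    then show ?thesis using T e by linarith
  qed
  then show "\<exists>n0. \<forall>n\<ge>n0. norm (path_dist (xs n) x - 0) < e"
    using path_dist_nonneg by auto
qed

lemma path_dist_uniform_limit:
  assumes "(\<lambda>n. path_dist (xs n) x) \<longlonglongrightarrow> 0"
  shows "uniform_limit {0..T} xs x sequentially"
  unfolding uniform_limit_iff
proof (intro allI impI)
  fix e :: real assume e: "0 < e"
  \<comment> \<open>On \<open>{0..T}\<close> the cap is at least \<open>1 / (1 + T)\<close>; a
    distance below this value can only come from the difference of the paths. For negative
    \<open>T\<close> the interval is empty.\<close>
  define d where "d = min e (1 / (1 + max 0 T))"
  have "0 < d" using e by (auto simp: d_def)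
  then have "\<forall>\<^sub>F n in sequentially. path_dist (xs n) x < d"
    using assms by (rule order_tendstoD(2)[rotated])
  then show "\<forall>\<^sub>F n in sequentially. \<forall>t\<in>{0..T}. dist (xs n t) (x t) < e"
  proof (eventually_elim, intro ballI)
    fix n t assume elim: "path_dist (xs n) x < d" and "t \<in> {0..T}"
    then have t: "0 \<le> t" "t \<le> max 0 T" by auto
    then have "d \<le> 1 / (1 + t)"
      unfolding d_def by (intro min.coboundedI2 divide_left_mono) auto
    moreover have "d \<le> e" by (simp add: d_def)
    ultimately show "dist (xs n t) (x t) < e"
      using path_dist_ge[OF t(1), of "xs n" x] elim unfolding dist_real_def by linarith
  qed
qed

text \<open>The identity serves as every time change: the J1 topology is coarser than locally
  uniform convergence.\<close>

lemma skorokhod_convergent_path_dist: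
  assumes "(\<lambda>n. path_dist (xs n) x) \<longlonglongrightarrow> 0"
  shows "skorokhod_convergent xs x"
  unfolding skorokhod_convergent_def
proof (intro exI[of _ "\<lambda>_ t. t"] conjI allI)
  show "(\<lambda>t. t) \<in> time_changes" by (simp add: time_changes_def strict_mono_on_def)
  show "uniform_limit {0..} (\<lambda>_ t. t) (\<lambda>t. t :: real) sequentially"
    by (simp add: uniform_limit_iff)
  show "uniform_limit {0..T} (\<lambda>n t. xs n t) x sequentially" for T
    using path_dist_uniform_limit[OF assms] .
qed

lemma openin_skorokhod_path_dist:
  assumes "openin skorokhod_topology V" "x \<in> V" "\<And>n. xs n \<in> cadlag_paths"
    "(\<lambda>n. path_dist (xs n) x) \<longlonglongrightarrow> 0"
  shows "\<forall>\<^sub>F n in sequentially. xs n \<in> V"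
  using assms skorokhod_convergent_path_dist[of xs x] unfolding openin_skorokhod_topology by blast

lemma continuous_map_skorokhod_path_dist:
  assumes f: "continuous_map skorokhod_topology euclideanreal f"
    and "x \<in> cadlag_paths" "\<And>n. xs n \<in> cadlag_paths" "(\<lambda>n. path_dist (xs n) x) \<longlonglongrightarrow> 0"
  shows "(\<lambda>n. f (xs n)) \<longlonglongrightarrow> f x"
proof (rule topological_tendstoI)
  fix U :: "real set" assume U: "open U" "f x \<in> U"
  define V where "V = {x \<in> cadlag_paths. f x \<in> U}"
  have "openin skorokhod_topology V"
    using f U unfolding continuous_map_def V_def topspace_skorokhod_topology by auto
  then have "\<forall>\<^sub>F n in sequentially. xs n \<in> V"
    by (rule openin_skorokhod_path_dist) (use assms U in \<open>auto simp: V_def\<close>)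
  then show "\<forall>\<^sub>F n in sequentially. f (xs n) \<in> U"
    by eventually_elim (simp add: V_def)
qed

section \<open>Functionals that are Lipschitz for the locally uniform distance\<close>

definition path_lipschitz :: "real \<Rightarrow> ((real \<Rightarrow> real) \<Rightarrow> real) \<Rightarrow> bool" where
  "path_lipschitz L g \<longleftrightarrow> (\<forall>x y. \<bar>g x - g y\<bar> \<le> L * path_dist x y)"

text \<open>Infimal convolution with a multiple of the distance approximates a continuous function from
  below by Lipschitz functions.\<close>

definition inf_convolution ::
    "(real \<Rightarrow> real) set \<Rightarrow> ((real \<Rightarrow> real) \<Rightarrow> real) \<Rightarrow> real \<Rightarrow> (real \<Rightarrow> real) \<Rightarrow> real" where
  "inf_convolution D f L x = (INF y\<in>D. f y + L * path_dist x y)"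

lemma inf_convolution_bdd:
  assumes "\<And>y. y \<in> D \<Longrightarrow> - C \<le> f y" "0 \<le> L"
  shows "bdd_below ((\<lambda>y. f y + L * path_dist x y) ` D)"
proof (rule bdd_belowI2)
  fix y assume "y \<in> D"
  then show "- C \<le> f y + L * path_dist x y"
    using assms(1)[of y] mult_nonneg_nonneg[OF assms(2) path_dist_nonneg[of x y]] by linarith
qed

lemma inf_convolution_ge:
  assumes "\<And>y. y \<in> D \<Longrightarrow> - C \<le> f y" "0 \<le> L" "D \<noteq> {}"
  shows "- C \<le> inf_convolution D f L x"
  unfolding inf_convolution_def
proof (rule cINF_greatest)
  fix y assume "y \<in> D"
  then show "- C \<le> f y + L * path_dist x y"
    using assms(1)[of y] mult_nonneg_nonneg[OF assms(2) path_dist_nonneg[of x y]] by linarith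
qed fact

lemma inf_convolution_le:
  assumes "\<And>y. y \<in> D \<Longrightarrow> - C \<le> f y" "0 \<le> L" "y \<in> D"
  shows "inf_convolution D f L x \<le> f y + L * path_dist x y"
  unfolding inf_convolution_def by (rule cINF_lower[OF inf_convolution_bdd[of D C]]) (use assms in auto)

lemma inf_convolution_lipschitz:
  assumes "\<And>y. y \<in> D \<Longrightarrow> - C \<le> f y" "0 \<le> L" "D \<noteq> {}"
  shows "path_lipschitz L (inf_convolution D f L)"
proof -
  have "inf_convolution D f L x - L * path_dist x x' \<le> inf_convolution D f L x'" for x x'
    unfolding inf_convolution_def[of D f L x']
  proof (rule cINF_greatest)
    fix y assume y: "y \<in> D"
    have "inf_convolution D f L x \<le> f y + L * path_dist x y"
      by (rule inf_convolution_le[of D C, OF assms(1,2) y])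
    also have "\<dots> \<le> f y + L * (path_dist x x' + path_dist x' y)"
      using assms by (intro add_left_mono mult_left_mono path_dist_triangle)
    finally show "inf_convolution D f L x - L * path_dist x x' \<le> f y + L * path_dist x' y"
      by (simp add: algebra_simps)
  qed fact
  then show ?thesis unfolding path_lipschitz_def
    by (metis abs_le_iff diff_le_eq minus_diff_eq path_dist_commute add.commute)
qed

text \<open>Near-minimizers \<open>y m\<close> satisfy
  \<open>m * path_dist x (y m) \<le> 2 * C + 1\<close>, hence converge to \<open>x\<close>;
  sequential continuity along them bounds the infimum from below, and \<open>y = x\<close> bounds it
  from above.\<close>

lemma inf_convolution_tendsto:
  assumes C: "\<And>y. y \<in> D \<Longrightarrow> \<bar>f y\<bar> \<le> C" and x: "x \<in> D"
    and cont: "\<And>xs. (\<And>n. xs n \<in> D) \<Longrightarrow> (\<lambda>n. path_dist (xs n) x) \<longlonglongrightarrow> 0 \<Longrightarrow> (\<lambda>n. f (xs n)) \<longlonglongrightarrow> f x"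
  shows "(\<lambda>m. inf_convolution D f (real m) x) \<longlonglongrightarrow> f x"
proof -
  have lower: "- C \<le> f y" if "y \<in> D" for y using C[OF that] by linarith
  have "\<exists>y\<in>D. f y + real m * path_dist x y < inf_convolution D f (real m) x + 1 / real (Suc m)" for m
  proof -
    have "Inf ((\<lambda>y. f y + real m * path_dist x y) ` D) < inf_convolution D f (real m) x + 1 / real (Suc m)"
      by (simp add: inf_convolution_def)
    moreover have "bdd_below ((\<lambda>y. f y + real m * path_dist x y) ` D)"
      by (rule inf_convolution_bdd[of _ C, OF lower]) auto
    ultimately show ?thesis
      using x by (subst (asm) cInf_less_iff) auto
  qed
  then obtain y where y: "\<And>m. y m \<in> D"
    "\<And>m. f (y m) + real m * path_dist x (y m) < inf_convolution D f (real m) x + 1 / real (Suc m)"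
    by metis
  have upper: "inf_convolution D f (real m) x \<le> f x" for m
    using inf_convolution_le[of D C f "real m" x x, OF lower _ x] by simp
  have "real m * path_dist x (y m) \<le> 2 * C + 1" for m
  proof -
    have "1 / real (Suc m) \<le> 1" by simp
    then show ?thesis using y(2)[of m] upper[of m] C[OF x] C[OF y(1), of m] by linarith
  qed
  then have "path_dist (y m) x \<le> (2 * C + 1) / real m" if "0 < m" for m
    using that by (simp add: field_simps path_dist_commute)
  then have "\<forall>\<^sub>F m in sequentially. path_dist (y m) x \<le> (2 * C + 1) / real m"
    by (intro eventually_mono[OF eventually_gt_at_top[of 0]])
  then have "(\<lambda>m. path_dist (y m) x) \<longlonglongrightarrow> 0"
    by (rule tendsto_sandwich[OF _ _ tendsto_const lim_const_over_n, rotated])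
      (simp add: path_dist_nonneg)
  then have "(\<lambda>m. f (y m)) \<longlonglongrightarrow> f x" by (rule cont[OF y(1)])
  then have lim: "(\<lambda>m. f (y m) - 1 / real (Suc m)) \<longlonglongrightarrow> f x"
    using tendsto_diff[OF _ LIMSEQ_Suc[OF lim_1_over_n]] by fastforce
  show ?thesis
  proof (rule tendsto_sandwich[OF _ _ lim tendsto_const])
    have "f (y m) - 1 / real (Suc m) \<le> inf_convolution D f (real m) x" for m
      using y(2)[of m] mult_nonneg_nonneg[OF of_nat_0_le_iff[of m] path_dist_nonneg[of x "y m"]] by linarith
    then show "\<forall>\<^sub>F m in sequentially. f (y m) - 1 / real (Suc m) \<le> inf_convolution D f (real m) x"
      by simp
    show "\<forall>\<^sub>F m in sequentially. inf_convolution D f (real m) x \<le> f x"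
      using upper by simp
  qed
qed

text \<open>Infimal convolution of the zero function is the distance to a set, which is 1-Lipschitz.
  A J1-open set is also open for \<open>path_dist\<close>, so membership in it means positive
  distance to its complement.\<close>

lemma measurable_skorokhod:
  assumes D: "\<And>\<omega>. \<omega> \<in> space M \<Longrightarrow> Y \<omega> \<in> cadlag_paths"
    and meas: "\<And>g. path_lipschitz 1 g \<Longrightarrow> (\<lambda>\<omega>. g (Y \<omega>)) \<in> borel_measurable M"
  shows "Y \<in> measurable M (borel_of_topology skorokhod_topology)"
  unfolding borel_of_topology_def topspace_skorokhod_topology
proof (rule measurable_measure_of)
  show "{V. openin skorokhod_topology V} \<subseteq> Pow cadlag_paths"
    using openin_subset by (fastforce simp: topspace_skorokhod_topology)
  show "Y \<in> space M \<rightarrow> cadlag_paths" using D by auto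
  fix V assume "V \<in> {V. openin skorokhod_topology V}"
  then have V: "openin skorokhod_topology V" by simp
  then have VD: "V \<subseteq> cadlag_paths" by (simp add: openin_skorokhod_topology)
  show "Y -` V \<inter> space M \<in> sets M"
  proof (cases "cadlag_paths - V = {}")
    case True
    then have "Y -` V \<inter> space M = space M" using D by auto
    then show ?thesis by simp
  next
    case False
    define g where "g = inf_convolution (cadlag_paths - V) (\<lambda>_. 0) 1"
    have "path_lipschitz 1 g"
      unfolding g_def by (rule inf_convolution_lipschitz[of _ 0]) (use False in auto)
    then have [measurable]: "(\<lambda>\<omega>. g (Y \<omega>)) \<in> borel_measurable M" by (rule meas)
    have "x \<in> V \<longleftrightarrow> 0 < g x" if x: "x \<in> cadlag_paths" for x
    proof
      assume xV: "x \<in> V"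
      show "0 < g x"
      proof (rule ccontr)
        assume "\<not> 0 < g x"
        have "\<exists>y\<in>cadlag_paths - V. path_dist x y < 1 / real (Suc m)" for m
        proof -
          have bdd: "bdd_below ((\<lambda>y. 0 + 1 * path_dist x y) ` (cadlag_paths - V))"
            by (rule inf_convolution_bdd[of _ 0]) auto
          have "Inf ((\<lambda>y. 0 + 1 * path_dist x y) ` (cadlag_paths - V)) \<le> 0"
            using \<open>\<not> 0 < g x\<close> unfolding g_def inf_convolution_def by (simp only: not_less)
          also have "0 < 1 / real (Suc m)" by simp
          finally show ?thesis
            using cInf_less_iff[OF _ bdd] False by auto
        qed
        then obtain y where y: "\<And>m. y m \<in> cadlag_paths - V" "\<And>m. path_dist x (y m) < 1 / real (Suc m)"
          by metis
        have "(\<lambda>m. path_dist (y m) x) \<longlonglongrightarrow> 0"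
        proof (rule tendsto_sandwich[OF _ _ tendsto_const LIMSEQ_Suc[OF lim_1_over_n]])
          show "\<forall>\<^sub>F m in sequentially. 0 \<le> path_dist (y m) x" by (simp add: path_dist_nonneg)
          show "\<forall>\<^sub>F m in sequentially. path_dist (y m) x \<le> 1 / real (Suc m)"
            using less_imp_le[OF y(2)] unfolding path_dist_commute[of x] by (intro always_eventually allI)
        qed
        then have "\<forall>\<^sub>F n in sequentially. y n \<in> V"
          using y by (intro openin_skorokhod_path_dist[OF V xV]) auto
        then show False using y(1) by auto
      qed
    next
      assume g: "0 < g x"
      show "x \<in> V"
      proof (rule ccontr)
        assume "x \<notin> V"
        then have "g x \<le> 0 + 1 * path_dist x x"
          unfolding g_def using x by (intro inf_convolution_le[of _ 0]) auto
        then show False using g by simp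
      qed
    qed
    then have "Y -` V \<inter> space M = {\<omega> \<in> space M. 0 < g (Y \<omega>)}" using D by auto
    then show ?thesis by simp
  qed
qed

lemma continuous_map_borel_measurable:
  assumes "continuous_map T euclideanreal f"
  shows "f \<in> borel_measurable (borel_of_topology T)"
proof (rule borel_measurableI)
  fix S :: "real set" assume "open S"
  have sp: "space (borel_of_topology T) = topspace T"
    unfolding borel_of_topology_def by (rule space_measure_of) (auto dest: openin_subset)
  have "openin T {x \<in> topspace T. f x \<in> S}"
    using assms \<open>open S\<close> by (auto simp: continuous_map_def)
  then have "{x \<in> topspace T. f x \<in> S} \<in> sets (borel_of_topology T)"
    unfolding borel_of_topology_def by (subst sets_measure_of) (auto dest: openin_subset)
  moreover have "f -` S \<inter> space (borel_of_topology T) = {x \<in> topspace T. f x \<in> S}"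
    using sp by auto
  ultimately show "f -` S \<inter> space (borel_of_topology T) \<in> sets (borel_of_topology T)" by simp
qed

text \<open>A portmanteau argument. A Lipschitz minorant of \<open>f\<close>, chosen by means of the
  law of \<open>Z\<close> alone, bounds the lower limit of the expectations under \<open>Y n\<close>
  from below; the same applied to \<open>- f\<close> bounds the upper limit from above. No tightness
  for the J1 topology has to be shown separately.\<close>

theorem converges_in_distribution_lipschitz:
  assumes M: "prob_space M" and N: "prob_space N"
    and YD: "\<And>n \<omega>. \<omega> \<in> space M \<Longrightarrow> Y n \<omega> \<in> cadlag_paths"
    and ZD: "\<And>\<omega>. \<omega> \<in> space N \<Longrightarrow> Z \<omega> \<in> cadlag_paths"
    and Ym: "\<And>n L g. 0 \<le> L \<Longrightarrow> path_lipschitz L g \<Longrightarrow> (\<lambda>\<omega>. g (Y n \<omega>)) \<in> borel_measurable M"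
    and Zm: "\<And>L g. 0 \<le> L \<Longrightarrow> path_lipschitz L g \<Longrightarrow> (\<lambda>\<omega>. g (Z \<omega>)) \<in> borel_measurable N"
    and lim: "\<And>L C g. 0 \<le> L \<Longrightarrow> path_lipschitz L g \<Longrightarrow> (\<And>x. \<bar>g x\<bar> \<le> C) \<Longrightarrow>
      (\<lambda>n. \<integral>\<omega>. g (Y n \<omega>) \<partial>M) \<longlonglongrightarrow> (\<integral>\<omega>. g (Z \<omega>) \<partial>N)"
  shows "converges_in_distribution skorokhod_topology M Y N Z"
proof -
  interpret M: prob_space M by fact
  interpret N: prob_space N by fact
  let ?D = "borel_of_topology skorokhod_topology"
  have Y: "Y n \<in> measurable M ?D" for n by (rule measurable_skorokhod) (use YD Ym[of 1] in auto)
  have Z: "Z \<in> measurable N ?D" by (rule measurable_skorokhod) (use ZD Zm[of 1] in auto)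
  have lower: "\<forall>\<^sub>F n in sequentially. (\<integral>\<omega>. f (Z \<omega>) \<partial>N) - \<epsilon> < (\<integral>\<omega>. f (Y n \<omega>) \<partial>M)"
    if f: "continuous_map skorokhod_topology euclideanreal f" and C: "\<And>x. x \<in> cadlag_paths \<Longrightarrow> \<bar>f x\<bar> \<le> C"
      and \<epsilon>: "0 < \<epsilon>" for f C \<epsilon>
  proof -
    let ?f = "\<lambda>m. inf_convolution cadlag_paths f (real m)"
    have ne: "cadlag_paths \<noteq> {}" using N.not_empty ZD by auto
    have C0: "0 \<le> C" using C ne by (meson abs_ge_zero all_not_in_conv order_trans)
    have low: "- C \<le> f x" if "x \<in> cadlag_paths" for x using C[OF that] by linarith
    have lip: "path_lipschitz (real m) (?f m)" for m
      by (rule inf_convolution_lipschitz[of _ C, OF low]) (use ne in auto)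
    have ge: "- C \<le> ?f m x" for m x
      by (rule inf_convolution_ge[of _ C, OF low]) (use ne in auto)
    have le: "?f m x \<le> f x" if "x \<in> cadlag_paths" for m x
      using inf_convolution_le[of cadlag_paths C f "real m" x x, OF low _ that] by simp
    \<comment> \<open>Off \<open>cadlag_paths\<close> the minorant is bounded because
      \<open>path_dist\<close> never exceeds one; \<open>lim\<close> asks for a bound on all
      functions.\<close>
    have le': "?f m x \<le> C + real m" for m x
    proof -
      obtain y where y: "y \<in> cadlag_paths" using ne by auto
      have "path_dist x y \<le> 1" by (rule path_dist_least) (simp add: min_le_iff_disj)
      then have "real m * path_dist x y \<le> real m * 1" by (intro mult_left_mono) auto
      then show ?thesis
        using inf_convolution_le[of cadlag_paths C f "real m" y x, OF low _ y] C[OF y] by simp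
    qed
    have fm[measurable]: "f \<in> borel_measurable ?D" by (rule continuous_map_borel_measurable[OF f])
    note Y[measurable] Z[measurable]
    have "(\<lambda>m. \<integral>\<omega>. ?f m (Z \<omega>) \<partial>N) \<longlonglongrightarrow> (\<integral>\<omega>. f (Z \<omega>) \<partial>N)"
    proof (rule integral_dominated_convergence[where w = "\<lambda>_. C"])
      show "AE \<omega> in N. (\<lambda>m. ?f m (Z \<omega>)) \<longlonglongrightarrow> f (Z \<omega>)"
        using C ZD by (intro AE_I2 inf_convolution_tendsto continuous_map_skorokhod_path_dist[OF f]) auto
      show "AE \<omega> in N. norm (?f m (Z \<omega>)) \<le> C" for m
      proof (rule AE_I2)
        fix \<omega> assume "\<omega> \<in> space N"
        then show "norm (?f m (Z \<omega>)) \<le> C"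
          using ge[of m "Z \<omega>"] le[OF ZD, of \<omega> m] C[OF ZD, of \<omega>] by auto
      qed
    qed (use Zm[OF _ lip] in auto)
    from order_tendstoD(1)[OF this, of "(\<integral>\<omega>. f (Z \<omega>) \<partial>N) - \<epsilon> / 2"] \<epsilon>
    obtain m where m: "(\<integral>\<omega>. f (Z \<omega>) \<partial>N) - \<epsilon> / 2 < (\<integral>\<omega>. ?f m (Z \<omega>) \<partial>N)"
      by (auto simp: eventually_sequentially)
    have bd: "\<bar>?f m x\<bar> \<le> C + real m" for x
      using ge[of m x] le'[of m x] C0 by auto
    have "(\<lambda>n. \<integral>\<omega>. ?f m (Y n \<omega>) \<partial>M) \<longlonglongrightarrow> (\<integral>\<omega>. ?f m (Z \<omega>) \<partial>N)"
      by (rule lim[OF _ lip bd]) auto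
    from order_tendstoD(1)[OF this, of "(\<integral>\<omega>. ?f m (Z \<omega>) \<partial>N) - \<epsilon> / 2"] \<epsilon>
    have "\<forall>\<^sub>F n in sequentially. (\<integral>\<omega>. ?f m (Z \<omega>) \<partial>N) - \<epsilon> / 2 < (\<integral>\<omega>. ?f m (Y n \<omega>) \<partial>M)" by simp
    then show ?thesis
    proof eventually_elim
      case (elim n)
      have "(\<integral>\<omega>. ?f m (Y n \<omega>) \<partial>M) \<le> (\<integral>\<omega>. f (Y n \<omega>) \<partial>M)"
      proof (rule integral_mono)
        show "integrable M (\<lambda>\<omega>. ?f m (Y n \<omega>))"
          by (rule M.integrable_const_bound[of _ "C + real m"]) (use bd Ym[OF _ lip] in auto)
        show "integrable M (\<lambda>\<omega>. f (Y n \<omega>))"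
          by (rule M.integrable_const_bound[of _ C]) (use C YD in auto)
      qed (use le YD in auto)
      then show ?case using elim m by linarith
    qed
  qed
  have "(\<lambda>n. \<integral>x. f x \<partial>distr M ?D (Y n)) \<longlonglongrightarrow> (\<integral>x. f x \<partial>distr N ?D Z)"
    if f: "continuous_map skorokhod_topology euclideanreal f" and bd: "bounded (f ` cadlag_paths)" for f
  proof -
    obtain C where C: "\<And>x. x \<in> cadlag_paths \<Longrightarrow> \<bar>f x\<bar> \<le> C"
      using bd by (auto simp: bounded_iff)
    have f': "continuous_map skorokhod_topology euclideanreal (\<lambda>x. - f x)"
      using f by (intro continuous_intros)
    have [measurable]: "f \<in> borel_measurable ?D" by (rule continuous_map_borel_measurable[OF f])
    have "(\<lambda>n. \<integral>\<omega>. f (Y n \<omega>) \<partial>M) \<longlonglongrightarrow> (\<integral>\<omega>. f (Z \<omega>) \<partial>N)"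
    proof (rule tendstoI)
      fix \<epsilon> :: real assume \<epsilon>: "0 < \<epsilon>"
      have "\<forall>\<^sub>F n in sequentially. (\<integral>\<omega>. - f (Z \<omega>) \<partial>N) - \<epsilon> < (\<integral>\<omega>. - f (Y n \<omega>) \<partial>M)"
        by (rule lower[OF f' _ \<epsilon>, of C]) (use C in auto)
      moreover have "\<forall>\<^sub>F n in sequentially. (\<integral>\<omega>. f (Z \<omega>) \<partial>N) - \<epsilon> < (\<integral>\<omega>. f (Y n \<omega>) \<partial>M)"
        by (rule lower[OF f C \<epsilon>])
      ultimately show "\<forall>\<^sub>F n in sequentially. dist (\<integral>\<omega>. f (Y n \<omega>) \<partial>M) (\<integral>\<omega>. f (Z \<omega>) \<partial>N) < \<epsilon>"
        by eventually_elim (simp add: dist_real_def abs_less_iff)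
    qed
    then show ?thesis using Y Z by (simp add: integral_distr)
  qed
  then show ?thesis
    using Y Z unfolding converges_in_distribution_def weakly_convergent_def topspace_skorokhod_topology by blast
qed

text \<open>\<open>\<kappa>\<close> is the number of steps per unit of time. The drift
  \<open>\<beta> * t\<close> accommodates walks with nonzero mean, whose centring is linear in time
  while the walk itself jumps.\<close>

definition step_path :: "real \<Rightarrow> real \<Rightarrow> (nat \<Rightarrow> real) \<Rightarrow> real \<Rightarrow> real" where
  "step_path \<kappa> \<beta> s = (\<lambda>t\<in>{0..}. s (nat \<lfloor>t * \<kappa>\<rfloor>) + \<beta> * t)"

lemma floor_mult_at_right:
  fixes \<kappa> t :: real
  assumes "0 \<le> \<kappa>"
  shows "\<forall>\<^sub>F u in at_right t. \<lfloor>u * \<kappa>\<rfloor> = \<lfloor>t * \<kappa>\<rfloor>"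
proof (cases "\<kappa> = 0")
  case False
  then have \<kappa>: "0 < \<kappa>" using assms by simp
  have "t < (of_int \<lfloor>t * \<kappa>\<rfloor> + 1) / \<kappa>" using \<kappa> by (simp add: pos_less_divide_eq)
  then have "\<forall>\<^sub>F u in at_right t. u < (of_int \<lfloor>t * \<kappa>\<rfloor> + 1) / \<kappa>"
    by (rule order_tendstoD(2)[OF tendsto_ident_at])
  then show ?thesis using eventually_at_right_less[of t]
  proof eventually_elim
    case (elim u)
    then have "u * \<kappa> < of_int \<lfloor>t * \<kappa>\<rfloor> + 1" using \<kappa> by (simp add: pos_less_divide_eq)
    moreover have "t * \<kappa> \<le> u * \<kappa>" using elim \<kappa> by (intro mult_right_mono) auto
    ultimately show ?case by linarith
  qed
qed simp

lemma floor_mult_at_left: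
  fixes \<kappa> t :: real
  assumes "0 \<le> \<kappa>"
  shows "\<exists>i. \<forall>\<^sub>F u in at_left t. \<lfloor>u * \<kappa>\<rfloor> = i"
proof (cases "\<kappa> = 0")
  case False
  then have \<kappa>: "0 < \<kappa>" using assms by simp
  \<comment> \<open>The value of the floor just before \<open>t\<close>, also when
    \<open>t * \<kappa>\<close> is an integer.\<close>
  define i where "i = \<lceil>t * \<kappa>\<rceil> - 1"
  have "of_int i < t * \<kappa>" "t * \<kappa> \<le> of_int i + 1" unfolding i_def by linarith+
  then have "of_int i / \<kappa> < t" using \<kappa> by (simp add: pos_divide_less_eq)
  then have "\<forall>\<^sub>F u in at_left t. of_int i / \<kappa> < u"
    by (rule order_tendstoD(1)[OF tendsto_ident_at])
  moreover have "\<forall>\<^sub>F u in at_left t. u < t"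
    by (auto simp: eventually_at_filter)
  ultimately have "\<forall>\<^sub>F u in at_left t. \<lfloor>u * \<kappa>\<rfloor> = i"
  proof eventually_elim
    case (elim u)
    then have "of_int i < u * \<kappa>" using \<kappa> by (simp add: pos_divide_less_eq)
    moreover have "u * \<kappa> < t * \<kappa>" using elim \<kappa> by simp
    ultimately show ?case using \<open>t * \<kappa> \<le> of_int i + 1\<close> by linarith
  qed
  then show ?thesis by blast
qed simp

lemma step_path_cadlag:
  assumes "0 \<le> \<kappa>"
  shows "step_path \<kappa> \<beta> s \<in> cadlag_paths"
  unfolding cadlag_paths_def
proof (intro CollectI conjI allI impI)
  show "step_path \<kappa> \<beta> s \<in> extensional {0..}" by (simp add: step_path_def)
  fix t :: real
  show "(step_path \<kappa> \<beta> s \<longlongrightarrow> step_path \<kappa> \<beta> s t) (at_right t)" if "0 \<le> t"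
  proof (rule Lim_transform_eventually)
    show "((\<lambda>u. s (nat \<lfloor>t * \<kappa>\<rfloor>) + \<beta> * u) \<longlongrightarrow> step_path \<kappa> \<beta> s t) (at_right t)"
      using that unfolding step_path_def by (auto intro!: tendsto_eq_intros)
    show "\<forall>\<^sub>F u in at_right t. s (nat \<lfloor>t * \<kappa>\<rfloor>) + \<beta> * u = step_path \<kappa> \<beta> s u"
      using floor_mult_at_right[OF assms, of t] eventually_at_right_less[of t]
      by eventually_elim (use that in \<open>simp add: step_path_def\<close>)
  qed
  show "\<exists>l. (step_path \<kappa> \<beta> s \<longlongrightarrow> l) (at_left t)" if "0 < t"
  proof -
    obtain i where i: "\<forall>\<^sub>F u in at_left t. \<lfloor>u * \<kappa>\<rfloor> = i" using floor_mult_at_left[OF assms] by blast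
    have "(step_path \<kappa> \<beta> s \<longlongrightarrow> s (nat i) + \<beta> * t) (at_left t)"
    proof (rule Lim_transform_eventually)
      show "((\<lambda>u. s (nat i) + \<beta> * u) \<longlongrightarrow> s (nat i) + \<beta> * t) (at_left t)"
        by (auto intro!: tendsto_eq_intros)
      have "\<forall>\<^sub>F u in at_left t. 0 < u"
        by (rule order_tendstoD(1)[OF tendsto_ident_at that])
      with i show "\<forall>\<^sub>F u in at_left t. s (nat i) + \<beta> * u = step_path \<kappa> \<beta> s u"
        by eventually_elim (simp add: step_path_def)
    qed
    then show ?thesis by blast
  qed
qed

lemma path_lipschitz_tendsto:
  assumes "path_lipschitz L g" "(\<lambda>n. path_dist (xs n) x) \<longlonglongrightarrow> 0"
  shows "(\<lambda>n. g (xs n)) \<longlonglongrightarrow> g x"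
proof -
  have "(\<lambda>n. L * path_dist (xs n) x) \<longlonglongrightarrow> 0" using assms(2) by (rule tendsto_mult_right_zero)
  then have "(\<lambda>n. g (xs n) - g x) \<longlonglongrightarrow> 0"
    by (rule Lim_null_comparison[rotated]) (use assms(1) in \<open>simp add: path_lipschitz_def\<close>)
  then show ?thesis by (rule LIM_zero_cancel)
qed

text \<open>Up to a fixed time a step path reads finitely many values, so coordinatewise convergence
  of sequences becomes locally uniform convergence of step paths. This links Lipschitz functionals
  of paths to weak convergence on \<open>nat \<Rightarrow> real\<close>.\<close>

lemma continuous_on_step_path:
  assumes "path_lipschitz L g" "0 \<le> \<kappa>"
  shows "continuous_on UNIV (\<lambda>s. g (step_path \<kappa> \<beta> s))"
proof (rule continuous_at_imp_continuous_on, rule ballI)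
  fix s :: "nat \<Rightarrow> real"
  show "isCont (\<lambda>s. g (step_path \<kappa> \<beta> s)) s"
  proof (rule continuous_at_sequentiallyI)
    fix ss assume ss: "ss \<longlonglongrightarrow> s"
    have "(\<lambda>n. ss n i) \<longlonglongrightarrow> s i" for i
      using continuous_on_tendsto_compose[OF continuous_on_product_coordinates ss] by auto
    note c = this
    show "(\<lambda>n. g (step_path \<kappa> \<beta> (ss n))) \<longlonglongrightarrow> g (step_path \<kappa> \<beta> s)"
    proof (rule path_lipschitz_tendsto[OF assms(1)], rule path_dist_tendsto_0)
      fix T :: real assume T: "0 \<le> T"
      show "uniform_limit {0..T} (\<lambda>n. step_path \<kappa> \<beta> (ss n)) (step_path \<kappa> \<beta> s) sequentially"
        unfolding uniform_limit_iff
      proof (intro allI impI)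
        fix e :: real assume "0 < e"
        then have "\<forall>\<^sub>F n in sequentially. dist (ss n i) (s i) < e" for i
          using tendstoD[OF c] by blast
        then have "\<forall>\<^sub>F n in sequentially. \<forall>i\<in>{..nat \<lfloor>T * \<kappa>\<rfloor>}. dist (ss n i) (s i) < e"
          by (intro eventually_ball_finite) auto
        then show "\<forall>\<^sub>F n in sequentially. \<forall>t\<in>{0..T}. dist (step_path \<kappa> \<beta> (ss n) t) (step_path \<kappa> \<beta> s t) < e"
        proof (eventually_elim, intro ballI)
          fix n t assume elim: "\<forall>i\<in>{..nat \<lfloor>T * \<kappa>\<rfloor>}. dist (ss n i) (s i) < e" "t \<in> {0..T}"
          then have "nat \<lfloor>t * \<kappa>\<rfloor> \<in> {..nat \<lfloor>T * \<kappa>\<rfloor>}"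
            using assms(2) by (auto intro!: nat_mono floor_mono mult_right_mono)
          with elim show "dist (step_path \<kappa> \<beta> (ss n) t) (step_path \<kappa> \<beta> s t) < e"
            by (auto simp: step_path_def dist_real_def)
        qed
      qed
    qed
  qed
qed


section \<open>Conditioning on the tree\<close>

text \<open>The events in \<open>generated_events\<close> packaged as a measurable space, so that
  measurability of functions with respect to them can be expressed.\<close>

definition generated_algebra :: "'a measure \<Rightarrow> 'i set \<Rightarrow> 'b measure \<Rightarrow> ('i \<Rightarrow> 'a \<Rightarrow> 'b) \<Rightarrow> 'a measure" where
  "generated_algebra M I N Y = sigma (space M) (\<Union>i\<in>I. {Y i -` A \<inter> space M | A. A \<in> sets N})"

lemma generated_algebra_gen_subset:
  "(\<Union>i\<in>I. {Y i -` A \<inter> space M | A. A \<in> sets N}) \<subseteq> Pow (space M)"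
  by auto

lemma space_generated_algebra [simp]: "space (generated_algebra M I N Y) = space M"
  unfolding generated_algebra_def by (rule space_measure_of[OF generated_algebra_gen_subset])

lemma sets_generated_algebra: "sets (generated_algebra M I N Y) = generated_events M I N Y"
  unfolding generated_algebra_def generated_events_def
  by (rule sets_measure_of[OF generated_algebra_gen_subset])

lemma measurable_generated_algebra:
  assumes "i \<in> I" "Y i \<in> space M \<rightarrow> space N"
  shows "Y i \<in> measurable (generated_algebra M I N Y) N"
proof (rule measurableI)
  show "Y i \<omega> \<in> space N" if "\<omega> \<in> space (generated_algebra M I N Y)" for \<omega>
    using that assms by auto
  fix A assume "A \<in> sets N"
  then show "Y i -` A \<inter> space (generated_algebra M I N Y) \<in> sets (generated_algebra M I N Y)"
    unfolding sets_generated_algebra generated_events_def space_generated_algebra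
    using assms by (intro sigma_sets.Basic) auto
qed

lemma generated_events_subset:
  assumes "\<And>i. i \<in> I \<Longrightarrow> Y i \<in> measurable M N"
  shows "generated_events M I N Y \<subseteq> sets M"
  unfolding generated_events_def using assms by (intro sets.sigma_sets_subset) auto

lemma subalgebra_generated_algebra:
  assumes "\<And>i. i \<in> I \<Longrightarrow> Y i \<in> measurable M N"
  shows "subalgebra M (generated_algebra M I N Y)"
  unfolding subalgebra_def sets_generated_algebra using generated_events_subset[of I Y M N, OF assms] by simp

text \<open>Follows the copies back to the original step. It imitates \<open>reinforced\<close>
  including the fallback for \<open>u i\<close> out of range, so that the identity between them
  holds for every outcome and not only almost surely.\<close>

function root_step :: "(nat \<Rightarrow> bool) \<Rightarrow> (nat \<Rightarrow> nat) \<Rightarrow> nat \<Rightarrow> nat" where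
  "root_step e u i = (if 2 \<le> i \<and> e i \<and> u i \<in> {1..<i} then root_step e u (u i) else i)"
  by auto
termination
  by (relation "Wellfounded.measure (\<lambda>(e, u, i). i)") auto

declare root_step.simps [simp del]

lemma reinforced_root_step: "reinforced x e u i = x (root_step e u i)"
proof (induction i rule: less_induct)
  case (less i)
  show ?case
    by (subst reinforced.simps, subst root_step.simps) (use less in auto)
qed

lemma root_step_bounds: "1 \<le> i \<Longrightarrow> 1 \<le> root_step e u i \<and> root_step e u i \<le> i"
proof (induction i rule: less_induct)
  case (less i)
  show ?case
  proof (cases "2 \<le> i \<and> e i \<and> u i \<in> {1..<i}")
    case True
    then have "1 \<le> root_step e u (u i) \<and> root_step e u (u i) \<le> u i" by (intro less.IH) auto
    moreover have "root_step e u i = root_step e u (u i)" using True by (subst root_step.simps) simp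
    ultimately show ?thesis using True by auto
  next
    case False
    then have "root_step e u i = i" by (subst root_step.simps) auto
    then show ?thesis using less.prems by simp
  qed
qed

definition step_tree :: "(nat \<Rightarrow> bool) \<Rightarrow> (nat \<Rightarrow> nat) \<Rightarrow> nat \<Rightarrow> nat \<Rightarrow> nat" where
  "step_tree e u n = (\<lambda>i. if i \<in> {1..n} then root_step e u i else 0)"

lemma step_tree_in_trees: "step_tree e u n \<in> trees n"
  using root_step_bounds by (auto simp: step_tree_def trees_def)

lemma step_tree_Suc: "step_tree e u (Suc n) = (step_tree e u n)(Suc n := root_step e u (Suc n))"
  by (auto simp: step_tree_def)

lemma step_tree_apply: "i \<in> {1..n} \<Longrightarrow> step_tree e u n i = root_step e u i"
  by (simp add: step_tree_def)

lemma finite_trees: "finite (trees n)"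
proof (rule finite_subset)
  show "trees n \<subseteq> {f. \<forall>x. (x \<in> {1..n} \<longrightarrow> f x \<in> {..n}) \<and> (x \<notin> {1..n} \<longrightarrow> f x = 0)}"
  proof (intro subsetI CollectI allI)
    fix r x assume r: "r \<in> trees n"
    then have "if x \<in> {1..n} then r x \<in> {1..x} else r x = 0" unfolding trees_def by blast
    then show "(x \<in> {1..n} \<longrightarrow> r x \<in> {..n}) \<and> (x \<notin> {1..n} \<longrightarrow> r x = 0)"
      by (auto split: if_splits)
  qed
qed (rule finite_set_of_finite_funs; simp)

text \<open>The mass that \<open>tree_exp\<close> gives to a single tree, for comparison with the
  probability that the random tree of the walk takes this value.\<close>

definition tree_weight :: "real \<Rightarrow> nat \<Rightarrow> (nat \<Rightarrow> nat) \<Rightarrow> real" where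
  "tree_weight p n r = tree_exp p n (\<lambda>s. of_bool (s = r))"

lemma tree_exp_eq_sum: "tree_exp p n F = (\<Sum>r\<in>trees n. tree_weight p n r * F r)"
proof -
  have "tree_exp p n F = tree_exp p n (\<lambda>s. \<Sum>r\<in>trees n. F r * of_bool (s = r))"
  proof (rule tree_exp_cong)
    fix s assume "s \<in> trees n"
    then show "F s = (\<Sum>r\<in>trees n. F r * of_bool (s = r))"
      by (subst sum.remove[OF finite_trees]) (auto intro!: sum.neutral)
  qed
  then show ?thesis
    unfolding tree_exp_sum tree_exp_mult_left tree_weight_def by (simp add: mult.commute)
qed

lemma trees_Suc_restrict:
  assumes "r \<in> trees (Suc n)"
  shows "r(Suc n := 0) \<in> trees n"
  unfolding trees_def
proof (intro CollectI allI)
  fix i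
  have "if i \<in> {1..Suc n} then r i \<in> {1..i} else r i = 0" using assms unfolding trees_def by blast
  then show "if i \<in> {1..n} then (r(Suc n := 0)) i \<in> {1..i} else (r(Suc n := 0)) i = 0"
    by (auto split: if_splits simp: le_Suc_eq)
qed

lemma upd_tree_eq_iff:
  assumes "s \<in> trees n"
  shows "s(Suc n := k) = r \<longleftrightarrow> s = r(Suc n := 0) \<and> k = r (Suc n)"
proof -
  have "s (Suc n) = 0" using assms by (auto simp: trees_def dest!: spec[of _ "Suc n"])
  then show ?thesis by (metis fun_upd_idem_iff fun_upd_same fun_upd_upd)
qed

text \<open>A copy joins the cluster of \<open>r (Suc n)\<close> with probability
  \<open>p / n\<close> times its size. If no earlier step has this root, the cardinality and hence
  the weight is \<open>0\<close>.\<close>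

lemma tree_weight_Suc:
  assumes r: "r \<in> trees (Suc n)"
  shows "tree_weight p (Suc n) r = tree_weight p n (r(Suc n := 0)) *
    (if r (Suc n) = Suc n then 1 - real n * (p / real n)
     else p / real n * real (card {u \<in> {1..n}. r u = r (Suc n)}))"
proof -
  let ?s = "r(Suc n := 0)"
  have "tree_weight p (Suc n) r = tree_exp p n (\<lambda>s. (if r (Suc n) = Suc n then 1 - real n * (p / real n)
     else p / real n * real (card {u \<in> {1..n}. r u = r (Suc n)})) * of_bool (s = ?s))"
    unfolding tree_weight_def tree_exp.simps
  proof (rule tree_exp_cong)
    fix s assume s: "s \<in> trees n"
    have "(\<Sum>u=1..n. of_bool (s(Suc n := s u) = r) :: real) = (\<Sum>u=1..n. of_bool (s = ?s) * of_bool (r u = r (Suc n)))"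
      unfolding upd_tree_eq_iff[OF s] by (intro sum.cong) auto
    also have "\<dots> = of_bool (s = ?s) * real (card {u \<in> {1..n}. r u = r (Suc n)})"
      unfolding sum_distrib_left[symmetric] by (simp add: Int_def conj_commute)
    finally have 1: "(\<Sum>u=1..n. of_bool (s(Suc n := s u) = r) :: real) =
      of_bool (s = ?s) * real (card {u \<in> {1..n}. r u = r (Suc n)})" .
    have 2: "{u \<in> {1..n}. r u = r (Suc n)} = {}" if "r (Suc n) = Suc n"
    proof -
      have "r u \<noteq> Suc n" if "u \<in> {1..n}" for u using trees_le[OF r, of u] that by auto
      then show ?thesis using that by auto
    qed
    show "(1 - real n * (p / real n)) * of_bool (s(Suc n := Suc n) = r) +
        p / real n * (\<Sum>u=1..n. of_bool (s(Suc n := s u) = r)) =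
        (if r (Suc n) = Suc n then 1 - real n * (p / real n)
         else p / real n * real (card {u \<in> {1..n}. r u = r (Suc n)})) * of_bool (s = ?s)"
      unfolding 1 unfolding upd_tree_eq_iff[OF s] using 2 by (auto simp del: One_nat_def)
  qed
  then show ?thesis unfolding tree_exp_mult_left tree_weight_def by simp
qed

text \<open>An indicator generates only \<open>E\<close>, its complement and the trivial events, so
  the product rule for \<open>E\<close> makes the indicator independent of \<open>F\<close>.\<close>

lemma (in prob_space) expectation_indicator_indep:
  fixes F :: "'a \<Rightarrow> real"
  assumes G: "subalgebra M G" and F: "F \<in> borel_measurable G" "integrable M F" and E: "E \<in> events"
    and ind: "\<And>A. A \<in> sets G \<Longrightarrow> prob (A \<inter> E) = prob A * prob E"
  shows "expectation (\<lambda>\<omega>. indicator E \<omega> * F \<omega>) = prob E * expectation F"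
proof -
  have sp: "space G = space M" and sub: "sets G \<subseteq> events" using G by (auto simp: subalgebra_def)
  let ?A = "{F -` A \<inter> space M | A. A \<in> sets borel}"
  let ?B = "{(indicator E :: 'a \<Rightarrow> real) -` A \<inter> space M | A. A \<in> sets borel}"
  have FM: "F \<in> borel_measurable M" by (rule measurable_from_subalg[OF G F(1)])
  have iE: "(indicator E :: 'a \<Rightarrow> real) \<in> borel_measurable M" using E by simp
  have "indep_set ?B ?A"
  proof (rule indep_setI)
    show "?B \<subseteq> events" "?A \<subseteq> events"
      using FM iE by (auto intro: measurable_sets)
    fix a b assume "a \<in> ?B" "b \<in> ?A"
    then obtain A B where a: "a = (indicator E :: 'a \<Rightarrow> real) -` A \<inter> space M" and b: "b = F -` B \<inter> space M" "B \<in> sets borel"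
      by auto
    have bG: "b \<in> sets G" using measurable_sets[OF F(1) b(2)] by (simp add: b sp)
    then have bM: "b \<in> events" using sub by auto
    have "a = (if (1::real) \<in> A then E else {}) \<union> (if (0::real) \<in> A then space M - E else {})"
      unfolding a using sets.sets_into_space[OF E] by (auto simp: indicator_def of_bool_def split: if_splits)
    moreover have "prob ((space M - E) \<inter> b) = prob (space M - E) * prob b"
    proof -
      have "(space M - E) \<inter> b = b - b \<inter> E" using sets.sets_into_space[OF bM] by auto
      then have "prob ((space M - E) \<inter> b) = prob b - prob (b \<inter> E)"
        using bM E by (simp add: finite_measure_Diff)
      then show ?thesis by (simp add: ind[OF bG] prob_compl[OF E] left_diff_distrib right_diff_distrib mult.commute)
    qed
    moreover have "prob (E \<inter> b) = prob E * prob b" using ind[OF bG] by (simp add: Int_commute mult.commute)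
    moreover have "E \<union> (space M - E) = space M" using sets.sets_into_space[OF E] by auto
    moreover have "space M \<inter> b = b" using sets.sets_into_space[OF bM] by auto
    ultimately show "prob (a \<inter> b) = prob a * prob b" by (simp add: prob_space)
  qed
  then have "indep_set (sigma_sets (space M) ?B) (sigma_sets (space M) ?A)"
  proof (rule indep_set_sigma_sets)
    have "Int_stable {X -` A \<inter> space M | A. A \<in> sets borel}" for X :: "'a \<Rightarrow> real"
    proof (rule Int_stableI)
      fix a b assume "a \<in> {X -` A \<inter> space M | A. A \<in> sets borel}" "b \<in> {X -` A \<inter> space M | A. A \<in> sets borel}"
      then obtain A B where "a = X -` A \<inter> space M" "b = X -` B \<inter> space M" "A \<in> sets borel" "B \<in> sets borel" by auto
      then show "a \<inter> b \<in> {X -` A \<inter> space M | A. A \<in> sets borel}"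
        by (intro CollectI exI[of _ "A \<inter> B"]) auto
    qed
    then show "Int_stable ?B" "Int_stable ?A" by auto
  qed
  then have "indep_var borel (indicator E) borel F"
    unfolding indep_var_eq using FM iE by blast
  then have "expectation (\<lambda>\<omega>. indicator E \<omega> * F \<omega>) = expectation (indicator E) * expectation F"
    by (rule indep_var_lebesgue_integral) (use F E in \<open>auto simp: less_top[symmetric]\<close>)
  then show ?thesis using E by simp
qed

section \<open>The law of the random tree and its independence of the original steps\<close>

locale reinforcement = prob_space M for M :: "'a measure" +
  fixes p :: real and \<mu> :: "real measure" and X :: "nat \<Rightarrow> 'a \<Rightarrow> real"
    and \<epsilon> :: "nat \<Rightarrow> 'a \<Rightarrow> bool" and U :: "nat \<Rightarrow> 'a \<Rightarrow> nat"
  assumes p: "0 \<le> p" "p \<le> 1" and data: "reinforcement_data p \<mu> M X \<epsilon> U"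
begin

lemma indep_X: "indep_vars (\<lambda>_. borel) X {1..}"
  and distr_X: "1 \<le> i \<Longrightarrow> distr M borel (X i) = \<mu>"
  and indep_\<epsilon>: "indep_vars (\<lambda>_. count_space UNIV) \<epsilon> {2..}"
  and distr_\<epsilon>: "2 \<le> i \<Longrightarrow> distr M (count_space UNIV) (\<epsilon> i) = measure_pmf (bernoulli_pmf p)"
  and indep_U: "indep_vars (\<lambda>_. count_space UNIV) U {2..}"
  and distr_U: "2 \<le> i \<Longrightarrow> distr M (count_space UNIV) (U i) = measure_pmf (pmf_of_set {1..<i})"
  and indep_XU: "indep_sets
       (\<lambda>k. [generated_events M {1..} borel X,
             generated_events M {2..} (count_space UNIV) \<epsilon>,
             generated_events M {2..} (count_space UNIV) U] ! k) {..<3::nat}"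
  using data unfolding reinforcement_data_def by auto

lemma X_measurable: "1 \<le> i \<Longrightarrow> X i \<in> borel_measurable M"
  using indep_X unfolding indep_vars_def by auto

lemma \<epsilon>_measurable: "2 \<le> i \<Longrightarrow> \<epsilon> i \<in> measurable M (count_space UNIV)"
  using indep_\<epsilon> unfolding indep_vars_def by auto

lemma U_measurable: "2 \<le> i \<Longrightarrow> U i \<in> measurable M (count_space UNIV)"
  using indep_U unfolding indep_vars_def by auto

abbreviation "\<F>X \<equiv> generated_algebra M {1..} borel X"

lemma subalgebra_X: "subalgebra M \<F>X"
  by (rule subalgebra_generated_algebra) (simp add: X_measurable)

lemma X_measurable_\<F>X: "1 \<le> i \<Longrightarrow> X i \<in> borel_measurable \<F>X"
  by (rule measurable_generated_algebra) auto

lemma prob_\<epsilon>: "2 \<le> i \<Longrightarrow> prob {\<omega> \<in> space M. \<epsilon> i \<omega> \<in> b} = measure_pmf.prob (bernoulli_pmf p) b"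
proof -
  assume i: "2 \<le> i"
  have "measure_pmf.prob (bernoulli_pmf p) b = measure (distr M (count_space UNIV) (\<epsilon> i)) b"
    by (simp add: distr_\<epsilon>[OF i])
  also have "\<dots> = prob (\<epsilon> i -` b \<inter> space M)" by (rule measure_distr) (simp_all add: \<epsilon>_measurable i)
  finally show ?thesis by (simp add: vimage_def Int_def conj_commute)
qed

lemma prob_U: "2 \<le> i \<Longrightarrow> prob {\<omega> \<in> space M. U i \<omega> \<in> b} = measure_pmf.prob (pmf_of_set {1..<i}) b"
proof -
  assume i: "2 \<le> i"
  have "measure_pmf.prob (pmf_of_set {1..<i}) b = measure (distr M (count_space UNIV) (U i)) b"
    by (simp add: distr_U[OF i])
  also have "\<dots> = prob (U i -` b \<inter> space M)" by (rule measure_distr) (simp_all add: U_measurable i)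
  finally show ?thesis by (simp add: vimage_def Int_def conj_commute)
qed

lemma AE_U: "AE \<omega> in M. \<forall>i\<ge>2. U i \<omega> \<in> {1..<i}"
proof -
  have "AE \<omega> in M. U i \<omega> \<in> {1..<i}" if i: "2 \<le> i" for i
  proof -
    have "{1..<i} \<noteq> {}" using i by auto
    then have "prob {\<omega> \<in> space M. U i \<omega> \<in> {1..<i}} = 1"
      unfolding prob_U[OF i] by (subst measure_pmf_of_set) auto
    moreover have "{\<omega> \<in> space M. U i \<omega> \<in> {1..<i}} \<in> events"
      using measurable_sets[OF U_measurable[OF i], of "{1..<i}"]
      by (simp add: vimage_def Int_def conj_commute del: atLeastLessThan_iff)
    ultimately show ?thesis using prob_Collect_eq_1[of "\<lambda>\<omega>. U i \<omega> \<in> {1..<i}"] by blast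
  qed
  then show ?thesis by (auto simp: AE_all_countable)
qed

text \<open>Independence between the three families splits off \<open>A\<close> and separates the
  \<epsilon> from the \<open>U\<close>; independence within the families then yields the product
  over the indices.\<close>

lemma prob_cylinder:
  assumes A: "A \<in> sets \<F>X"
  shows "prob {\<omega> \<in> A. \<forall>i\<in>{2..N}. \<epsilon> i \<omega> \<in> b i \<and> U i \<omega> \<in> c i} =
    prob A * (\<Prod>i\<in>{2..N}. prob {\<omega> \<in> space M. \<epsilon> i \<omega> \<in> b i} * prob {\<omega> \<in> space M. U i \<omega> \<in> c i})"
proof -
  let ?E = "{\<omega> \<in> space M. \<forall>i\<in>{2..N}. \<epsilon> i \<omega> \<in> b i}" and ?V = "{\<omega> \<in> space M. \<forall>i\<in>{2..N}. U i \<omega> \<in> c i}"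
  have AM: "A \<subseteq> space M" using sets.sets_into_space[OF A] by simp
  have gen: "{\<omega> \<in> space M. \<forall>i\<in>{2..N}. Y i \<omega> \<in> c i} \<in> generated_events M {2..} (count_space UNIV) Y"
    for Y :: "nat \<Rightarrow> 'a \<Rightarrow> 'c" and c
  proof -
    let ?G = "generated_algebra M {2..} (count_space UNIV) Y"
    have "{\<omega> \<in> space ?G. Y i \<omega> \<in> c i} \<in> sets ?G" if "i \<in> {2..N}" for i
      using measurable_sets[OF measurable_generated_algebra[of i "{2..}" Y M "count_space UNIV"], of "c i"] that
      by (simp add: vimage_def Int_def conj_commute)
    then have "{\<omega> \<in> space ?G. \<forall>i\<in>{2..N}. Y i \<omega> \<in> c i} \<in> sets ?G"
      by (rule sets.sets_Collect_finite_All) auto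
    then show ?thesis by (simp add: sets_generated_algebra)
  qed
  have prod: "prob {\<omega> \<in> space M. \<forall>i\<in>{2..N}. Y i \<omega> \<in> c i} = (\<Prod>i\<in>{2..N}. prob {\<omega> \<in> space M. Y i \<omega> \<in> c i})"
    if "indep_vars (\<lambda>_. count_space UNIV) Y {2..}" for Y :: "nat \<Rightarrow> 'a \<Rightarrow> 'c" and c
  proof (cases "2 \<le> N")
    case True
    have "prob (\<Inter>i\<in>{2..N}. Y i -` c i \<inter> space M) = (\<Prod>i\<in>{2..N}. prob (Y i -` c i \<inter> space M))"
      by (rule indep_varsD[OF that]) (use True in auto)
    moreover have "(\<Inter>i\<in>{2..N}. Y i -` c i \<inter> space M) = {\<omega> \<in> space M. \<forall>i\<in>{2..N}. Y i \<omega> \<in> c i}"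
      using True by auto
    ultimately show ?thesis by (simp add: vimage_def Int_def conj_commute)
  qed (simp add: prob_space)
  have "prob (\<Inter>k\<in>{..<3}. [A, ?E, ?V] ! k) = (\<Prod>k\<in>{..<3}. prob ([A, ?E, ?V] ! k))"
    by (rule indep_setsD[OF indep_XU])
      (use gen[of \<epsilon> b] gen[of U c] A in \<open>auto simp: sets_generated_algebra less_Suc_eq numeral_3_eq_3\<close>)
  moreover have "(\<Inter>k\<in>{..<3}. [A, ?E, ?V] ! k) = {\<omega> \<in> A. \<forall>i\<in>{2..N}. \<epsilon> i \<omega> \<in> b i \<and> U i \<omega> \<in> c i}"
    using AM by (auto simp: numeral_3_eq_3 lessThan_Suc)
  moreover have "(\<Prod>k\<in>{..<3}. prob ([A, ?E, ?V] ! k)) = prob A * (prob ?E * prob ?V)"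
    by (simp add: numeral_3_eq_3 lessThan_Suc)
  ultimately show ?thesis
    unfolding prod[OF indep_\<epsilon>, of b] prod[OF indep_U, of c] prod.distrib by simp
qed

definition \<tau> :: "nat \<Rightarrow> 'a \<Rightarrow> nat \<Rightarrow> nat" where
  "\<tau> n \<omega> = step_tree (\<lambda>i. \<epsilon> i \<omega>) (\<lambda>i. U i \<omega>) n"

lemma \<tau>_in_trees: "\<tau> n \<omega> \<in> trees n"
  unfolding \<tau>_def by (rule step_tree_in_trees)

text \<open>A copied root is at most \<open>n\<close>, so the root \<open>Suc n\<close> occurs
  exactly when nothing is copied, and then \<open>U (Suc n)\<close> is free. Either way the new tree
  amounts to the old one and a rectangular constraint on the next pair of choices.\<close>

lemma \<tau>_Suc_eq_iff:
  assumes r: "r \<in> trees (Suc n)" and n: "1 \<le> n" and U: "U (Suc n) \<omega> \<in> {1..n}"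
  shows "\<tau> (Suc n) \<omega> = r \<longleftrightarrow> \<tau> n \<omega> = r(Suc n := 0) \<and>
     \<epsilon> (Suc n) \<omega> \<in> (if r (Suc n) = Suc n then {False} else {True}) \<and>
     U (Suc n) \<omega> \<in> (if r (Suc n) = Suc n then UNIV else {u \<in> {1..n}. r u = r (Suc n)})"
proof -
  let ?k = "root_step (\<lambda>i. \<epsilon> i \<omega>) (\<lambda>i. U i \<omega>) (Suc n)"
  have "\<tau> (Suc n) \<omega> = r \<longleftrightarrow> \<tau> n \<omega> = r(Suc n := 0) \<and> ?k = r (Suc n)"
    unfolding \<tau>_def step_tree_Suc by (rule upd_tree_eq_iff[OF step_tree_in_trees])
  moreover have k: "?k = (if \<epsilon> (Suc n) \<omega> then \<tau> n \<omega> (U (Suc n) \<omega>) else Suc n)"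
    using n U unfolding \<tau>_def by (subst root_step.simps) (auto simp: step_tree_apply)
  moreover have "\<tau> n \<omega> (U (Suc n) \<omega>) \<noteq> Suc n"
    using trees_le[OF \<tau>_in_trees, of n \<omega> "U (Suc n) \<omega>"] U by auto
  moreover have "(r(Suc n := 0)) (U (Suc n) \<omega>) = r (U (Suc n) \<omega>)" using U by auto
  ultimately show ?thesis using U by auto
qed

lemma measurable_\<epsilon>_in: "2 \<le> i \<Longrightarrow> {\<omega> \<in> space M. \<epsilon> i \<omega> \<in> b} \<in> events"
  using measurable_sets[OF \<epsilon>_measurable, of i b] by (simp add: vimage_def Int_def conj_commute)

lemma measurable_U_in: "2 \<le> i \<Longrightarrow> {\<omega> \<in> space M. U i \<omega> \<in> b} \<in> events"
  using measurable_sets[OF U_measurable, of i b] by (simp add: vimage_def Int_def conj_commute)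

lemma tree_event: "{\<omega> \<in> space M. \<tau> n \<omega> = r} \<in> events"
proof (induction n arbitrary: r)
  case 0
  have "\<tau> 0 \<omega> = (\<lambda>_. 0)" for \<omega> by (auto simp: \<tau>_def step_tree_def)
  then show ?case by (simp add: sets.sets_Collect_const)
next
  case (Suc n)
  let ?s = "r(Suc n := 0)" and ?k = "r (Suc n)"
  have iff: "\<tau> (Suc n) \<omega> = r \<longleftrightarrow> \<tau> n \<omega> = ?s \<and> root_step (\<lambda>i. \<epsilon> i \<omega>) (\<lambda>i. U i \<omega>) (Suc n) = ?k" for \<omega>
    unfolding \<tau>_def step_tree_Suc by (rule upd_tree_eq_iff[OF step_tree_in_trees])
  show ?case
  proof (cases "n = 0")
    case True
    have "root_step (\<lambda>i. \<epsilon> i \<omega>) (\<lambda>i. U i \<omega>) (Suc n) = Suc n" for \<omega>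
      using True by (subst root_step.simps) simp
    then have "{\<omega> \<in> space M. \<tau> (Suc n) \<omega> = r} = (if ?k = Suc n then {\<omega> \<in> space M. \<tau> n \<omega> = ?s} else {})"
      unfolding iff by auto
    then show ?thesis using Suc by simp
  next
    case False
    \<comment> \<open>Measurability concerns every outcome, so those with \<open>U (Suc n)\<close>
      out of range have to be kept here; they fall back to a new root.\<close>
    have "root_step (\<lambda>i. \<epsilon> i \<omega>) (\<lambda>i. U i \<omega>) (Suc n) = (if \<epsilon> (Suc n) \<omega> \<and> U (Suc n) \<omega> \<in> {1..n}
        then \<tau> n \<omega> (U (Suc n) \<omega>) else Suc n)" for \<omega>
      using False unfolding \<tau>_def by (subst root_step.simps) (auto simp: step_tree_apply)
    then have "{\<omega> \<in> space M. \<tau> (Suc n) \<omega> = r} = {\<omega> \<in> space M. \<tau> n \<omega> = ?s} \<inter>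
       (({\<omega> \<in> space M. \<epsilon> (Suc n) \<omega> \<in> {True}} \<inter> {\<omega> \<in> space M. U (Suc n) \<omega> \<in> {u \<in> {1..n}. ?s u = ?k}}) \<union>
        (if ?k = Suc n then space M - ({\<omega> \<in> space M. \<epsilon> (Suc n) \<omega> \<in> {True}} \<inter> {\<omega> \<in> space M. U (Suc n) \<omega> \<in> {1..n}}) else {}))"
      unfolding iff by (auto split: if_splits)
    moreover have "\<dots> \<in> events"
      using False by (intro sets.Int sets.Un Suc measurable_\<epsilon>_in measurable_U_in) (auto intro!: sets.Diff sets.Int measurable_\<epsilon>_in[of _ "{True}", simplified] measurable_U_in[of _ "{1..n}", simplified])
    ultimately show ?thesis by simp
  qed
qed

text \<open>The induction carries arbitrary constraints on all later choices, since passing from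
  \<open>n\<close> to \<open>Suc n\<close> trades the last step of the tree for one more constraint.
  At time one the tree is deterministic and only the cylinder is left.\<close>

lemma prob_tree_cylinder:
  assumes A: "A \<in> sets \<F>X" and n: "1 \<le> n"
  shows "n \<le> N \<Longrightarrow> r \<in> trees n \<Longrightarrow>
    prob {\<omega> \<in> A. (\<forall>i\<in>{Suc n..N}. \<epsilon> i \<omega> \<in> b i \<and> U i \<omega> \<in> c i) \<and> \<tau> n \<omega> = r} =
    prob A * tree_weight p n r *
      (\<Prod>i\<in>{Suc n..N}. prob {\<omega> \<in> space M. \<epsilon> i \<omega> \<in> b i} * prob {\<omega> \<in> space M. U i \<omega> \<in> c i})"
  using n
proof (induction n arbitrary: r b c rule: nat_induct_at_least)
  case base
  have one: "s = (\<lambda>_. 0)(1 := 1)" if "s \<in> trees 1" for s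
  proof
    fix i
    have "if i \<in> {1..1} then s i \<in> {1..i} else s i = 0" using that unfolding trees_def by blast
    then show "s i = ((\<lambda>_. 0)(1 := 1)) i" by (auto split: if_splits)
  qed
  have "\<tau> 1 \<omega> = r" for \<omega> using one[OF \<tau>_in_trees] one[OF base(2)] by simp
  moreover have "tree_weight p 1 r = 1"
    using tree_weight_Suc[of r 0 p] one[OF base(2)] base(2)
    by (simp add: tree_weight_def fun_eq_iff)
  ultimately show ?case using prob_cylinder[OF A, of N b c] by (simp add: numeral_2_eq_2)
next
  case (Suc n)
  note r = Suc.prems(2)
  let ?root = "r (Suc n) = Suc n" and ?C = "{u \<in> {1..n}. r u = r (Suc n)}"
  define b' where "b' = b(Suc n := if ?root then {False} else {True})"
  define c' where "c' = c(Suc n := if ?root then UNIV else ?C)"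
  define P where "P b c i = prob {\<omega> \<in> space M. \<epsilon> i \<omega> \<in> b i} * prob {\<omega> \<in> space M. U i \<omega> \<in> c i}" for b c i
  have AM: "A \<in> events" using A subalgebra_X by (auto simp: subalgebra_def)
  have ev: "{\<omega> \<in> A. (\<forall>i\<in>{Suc m..N}. \<epsilon> i \<omega> \<in> b i \<and> U i \<omega> \<in> c i) \<and> \<tau> m \<omega> = s} \<in> events" if "1 \<le> m" for m s b c
  proof -
    have "{\<omega> \<in> space M. \<forall>i\<in>{Suc m..N}. \<epsilon> i \<omega> \<in> b i \<and> U i \<omega> \<in> c i} \<in> events"
      using that by (intro sets.sets_Collect_finite_All sets.sets_Collect_conj measurable_\<epsilon>_in measurable_U_in) auto
    then have "A \<inter> {\<omega> \<in> space M. \<forall>i\<in>{Suc m..N}. \<epsilon> i \<omega> \<in> b i \<and> U i \<omega> \<in> c i} \<inter> {\<omega> \<in> space M. \<tau> m \<omega> = s} \<in> events"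
      using AM tree_event[of m s] by blast
    moreover have "A \<inter> {\<omega> \<in> space M. \<forall>i\<in>{Suc m..N}. \<epsilon> i \<omega> \<in> b i \<and> U i \<omega> \<in> c i} \<inter> {\<omega> \<in> space M. \<tau> m \<omega> = s}
       = {\<omega> \<in> A. (\<forall>i\<in>{Suc m..N}. \<epsilon> i \<omega> \<in> b i \<and> U i \<omega> \<in> c i) \<and> \<tau> m \<omega> = s}"
      using sets.sets_into_space[OF AM] by auto
    ultimately show ?thesis by simp
  qed
  have split: "{Suc n..N} = insert (Suc n) {Suc (Suc n)..N}" using Suc.prems by auto
  have "prob {\<omega> \<in> A. (\<forall>i\<in>{Suc (Suc n)..N}. \<epsilon> i \<omega> \<in> b i \<and> U i \<omega> \<in> c i) \<and> \<tau> (Suc n) \<omega> = r} =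
     prob {\<omega> \<in> A. (\<forall>i\<in>{Suc n..N}. \<epsilon> i \<omega> \<in> b' i \<and> U i \<omega> \<in> c' i) \<and> \<tau> n \<omega> = r(Suc n := 0)}"
  \<comment> \<open>The two events can differ only where \<open>U (Suc n)\<close> leaves its range,
    which has probability zero.\<close>
  proof (rule finite_measure_eq_AE)
    have b: "(\<forall>i\<in>{Suc n..N}. \<epsilon> i \<omega> \<in> b' i \<and> U i \<omega> \<in> c' i) \<longleftrightarrow>
       (\<epsilon> (Suc n) \<omega> \<in> (if ?root then {False} else {True}) \<and> U (Suc n) \<omega> \<in> (if ?root then UNIV else ?C)) \<and>
       (\<forall>i\<in>{Suc (Suc n)..N}. \<epsilon> i \<omega> \<in> b i \<and> U i \<omega> \<in> c i)" for \<omega>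
      unfolding split by (simp add: b'_def c'_def)
    show "AE \<omega> in M. (\<omega> \<in> {\<omega> \<in> A. (\<forall>i\<in>{Suc (Suc n)..N}. \<epsilon> i \<omega> \<in> b i \<and> U i \<omega> \<in> c i) \<and> \<tau> (Suc n) \<omega> = r}) \<longleftrightarrow>
     (\<omega> \<in> {\<omega> \<in> A. (\<forall>i\<in>{Suc n..N}. \<epsilon> i \<omega> \<in> b' i \<and> U i \<omega> \<in> c' i) \<and> \<tau> n \<omega> = r(Suc n := 0)})"
      using AE_U
    proof eventually_elim
      case (elim \<omega>)
      have "U (Suc n) \<omega> \<in> {1..<Suc n}" using elim Suc.hyps by simp
      then have "U (Suc n) \<omega> \<in> {1..n}" by auto
      from \<tau>_Suc_eq_iff[OF r Suc.hyps this] show ?case unfolding b mem_Collect_eq by blast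
    qed
  qed (use ev Suc.hyps in auto)
  also have "\<dots> = prob A * tree_weight p n (r(Suc n := 0)) * (\<Prod>i\<in>{Suc n..N}. P b' c' i)"
    unfolding P_def by (rule Suc.IH[OF _ trees_Suc_restrict[OF r]]) (use Suc.prems in auto)
  also have "(\<Prod>i\<in>{Suc n..N}. P b' c' i) = P b' c' (Suc n) * (\<Prod>i\<in>{Suc (Suc n)..N}. P b' c' i)"
    unfolding split by simp
  also have "(\<Prod>i\<in>{Suc (Suc n)..N}. P b' c' i) = (\<Prod>i\<in>{Suc (Suc n)..N}. P b c i)"
    by (intro prod.cong) (auto simp: P_def b'_def c'_def)
  also have "P b' c' (Suc n) = (if ?root then 1 - real n * (p / real n) else p / real n * real (card ?C))"
  proof -
    have 2: "2 \<le> Suc n" using Suc.hyps by simp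
    have C: "{1..<Suc n} \<inter> ?C = ?C" by auto
    have "{1..<Suc n} \<noteq> {}" using Suc.hyps by auto
    then have "measure_pmf.prob (pmf_of_set {1..<Suc n}) ?C =
        real (card ({1..<Suc n} \<inter> ?C)) / real (card {1..<Suc n})"
      by (rule measure_pmf_of_set) simp
    then have "measure_pmf.prob (pmf_of_set {1..<Suc n}) ?C = real (card ?C) / real n"
      unfolding C by simp
    then show ?thesis
      unfolding P_def prob_\<epsilon>[OF 2] prob_U[OF 2] b'_def c'_def using p Suc.hyps
      by (simp add: measure_pmf_single)
  qed
  finally show ?case
    unfolding tree_weight_Suc[OF r] P_def by (simp only: mult.assoc)
qed

lemma prob_tree:
  assumes A: "A \<in> sets \<F>X" and r: "r \<in> trees n"
  shows "prob (A \<inter> {\<omega> \<in> space M. \<tau> n \<omega> = r}) = prob A * tree_weight p n r"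
proof (cases "n = 0")
  case True
  have "\<tau> 0 \<omega> = (\<lambda>_. 0)" for \<omega> by (auto simp: \<tau>_def step_tree_def)
  moreover have "r = (\<lambda>_. 0)" using r True trees_0 by auto
  moreover have "A \<subseteq> space M" using sets.sets_into_space[OF A] by simp
  ultimately show ?thesis using True by (simp add: tree_weight_def Int_absorb2)
next
  case False
  have "A \<subseteq> space M" using sets.sets_into_space[OF A] by simp
  then have "A \<inter> {\<omega> \<in> space M. \<tau> n \<omega> = r} =
      {\<omega> \<in> A. (\<forall>i\<in>{Suc n..n}. \<epsilon> i \<omega> \<in> UNIV \<and> U i \<omega> \<in> UNIV) \<and> \<tau> n \<omega> = r}" by auto
  then show ?thesis using prob_tree_cylinder[OF A, of n n r "\<lambda>_. UNIV" "\<lambda>_. UNIV"] False r by simp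
qed

text \<open>Fubini's theorem for the tree and the original steps: there are finitely many trees, and
  each \<open>\<Phi> r\<close> is independent of the event that the random tree is
  \<open>r\<close>.\<close>

lemma expectation_tree:
  assumes meas: "\<And>r. r \<in> trees n \<Longrightarrow> \<Phi> r \<in> borel_measurable \<F>X"
    and int: "\<And>r. r \<in> trees n \<Longrightarrow> integrable M (\<Phi> r)"
  shows "integrable M (\<lambda>\<omega>. \<Phi> (\<tau> n \<omega>) \<omega>)"
    and "expectation (\<lambda>\<omega>. \<Phi> (\<tau> n \<omega>) \<omega>) = tree_exp p n (\<lambda>r. expectation (\<Phi> r))"
proof -
  let ?E = "\<lambda>r. {\<omega> \<in> space M. \<tau> n \<omega> = r}"
  have eq: "\<Phi> (\<tau> n \<omega>) \<omega> = (\<Sum>r\<in>trees n. indicator (?E r) \<omega> * \<Phi> r \<omega>)" if "\<omega> \<in> space M" for \<omega>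
    using that by (subst sum.remove[OF finite_trees \<tau>_in_trees[of n \<omega>]]) (auto intro!: sum.neutral simp: indicator_def)
  have i: "integrable M (\<lambda>\<omega>. indicator (?E r) \<omega> * \<Phi> r \<omega>)" if "r \<in> trees n" for r
    using integrable_mult_indicator[OF tree_event int[OF that], of n r] by simp
  have "integrable M (\<lambda>\<omega>. \<Sum>r\<in>trees n. indicator (?E r) \<omega> * \<Phi> r \<omega>)"
    by (intro Bochner_Integration.integrable_sum i)
  then show "integrable M (\<lambda>\<omega>. \<Phi> (\<tau> n \<omega>) \<omega>)"
    by (subst Bochner_Integration.integrable_cong[OF refl eq])
  have "expectation (\<lambda>\<omega>. \<Phi> (\<tau> n \<omega>) \<omega>) = expectation (\<lambda>\<omega>. \<Sum>r\<in>trees n. indicator (?E r) \<omega> * \<Phi> r \<omega>)"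
    by (rule Bochner_Integration.integral_cong[OF refl eq])
  also have "\<dots> = (\<Sum>r\<in>trees n. expectation (\<lambda>\<omega>. indicator (?E r) \<omega> * \<Phi> r \<omega>))"
    by (intro Bochner_Integration.integral_sum i)
  also have "\<dots> = (\<Sum>r\<in>trees n. tree_weight p n r * expectation (\<Phi> r))"
  proof (intro sum.cong refl)
    fix r assume r: "r \<in> trees n"
    have w: "prob (?E r) = tree_weight p n r"
      using prob_tree[of "space M" r n] r sets.top[of \<F>X] by (simp add: prob_space Int_def)
    have "expectation (\<lambda>\<omega>. indicator (?E r) \<omega> * \<Phi> r \<omega>) = prob (?E r) * expectation (\<Phi> r)"
      by (rule expectation_indicator_indep[OF subalgebra_X meas[OF r] int[OF r] tree_event])
        (simp add: prob_tree[OF _ r] w)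
    then show "expectation (\<lambda>\<omega>. indicator (?E r) \<omega> * \<Phi> r \<omega>) = tree_weight p n r * expectation (\<Phi> r)"
      using w by simp
  qed
  finally show "expectation (\<lambda>\<omega>. \<Phi> (\<tau> n \<omega>) \<omega>) = tree_exp p n (\<lambda>r. expectation (\<Phi> r))"
    unfolding tree_exp_eq_sum .
qed

end


section \<open>Convergence of characteristic functions\<close>

lemma integrable_mult_of_squares:
  fixes f g :: "'a \<Rightarrow> real"
  assumes "f \<in> borel_measurable M" "g \<in> borel_measurable M"
    "integrable M (\<lambda>x. (f x)\<^sup>2)" "integrable M (\<lambda>x. (g x)\<^sup>2)"
  shows "integrable M (\<lambda>x. f x * g x)"
proof (rule Bochner_Integration.integrable_bound)
  show "integrable M (\<lambda>x. (f x)\<^sup>2 + (g x)\<^sup>2)" using assms by simp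
  show "AE x in M. norm (f x * g x) \<le> norm ((f x)\<^sup>2 + (g x)\<^sup>2)"
  proof (rule AE_I2)
    fix x
    have "2 * \<bar>f x\<bar> * \<bar>g x\<bar> \<le> \<bar>f x\<bar>\<^sup>2 + \<bar>g x\<bar>\<^sup>2" by (rule sum_squares_bound)
    moreover have "0 \<le> \<bar>f x\<bar> * \<bar>g x\<bar>" by simp
    ultimately have "\<bar>f x\<bar> * \<bar>g x\<bar> \<le> (f x)\<^sup>2 + (g x)\<^sup>2"
      unfolding power2_abs by linarith
    then show "norm (f x * g x) \<le> norm ((f x)\<^sup>2 + (g x)\<^sup>2)" by (simp add: abs_mult)
  qed
qed (use assms in auto)

lemma integrable_square_sum:
  fixes f :: "'i \<Rightarrow> 'a \<Rightarrow> real"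
  assumes "\<And>i. i \<in> I \<Longrightarrow> f i \<in> borel_measurable M" "\<And>i. i \<in> I \<Longrightarrow> integrable M (\<lambda>x. (f i x)\<^sup>2)"
  shows "integrable M (\<lambda>x. (\<Sum>i\<in>I. f i x)\<^sup>2)"
  unfolding power2_eq_square sum_product
  by (intro Bochner_Integration.integrable_sum integrable_mult_of_squares assms)

text \<open>The cubic term covers the large \<open>t\<close>, for which the error is not below \<open>\<delta> * t^2\<close>.\<close>

lemma (in prob_space) char_near_gaussian:
  fixes X :: "'a \<Rightarrow> real"
  assumes [measurable]: "X \<in> borel_measurable M" and i2: "integrable M (\<lambda>\<omega>. (X \<omega>)\<^sup>2)"
    and mean: "expectation X = 0" and var: "expectation (\<lambda>\<omega>. (X \<omega>)\<^sup>2) = 1" and \<delta>: "0 < \<delta>"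
  obtains K where "0 \<le> K"
    "\<And>t. cmod (char (distr M borel X) t - of_real (exp (- t\<^sup>2 / 2))) \<le> \<delta> * t\<^sup>2 + K * \<bar>t\<bar> ^ 3"
proof -
  have i1: "integrable M X" by (rule square_integrable_imp_integrable[OF _ i2]) simp
  \<comment> \<open>The error functional of the second order expansion of a characteristic function.
    It tends to \<open>0\<close> with \<open>t\<close> by dominated convergence, for which second
    moments suffice.\<close>
  define \<psi> where "\<psi> t = expectation (\<lambda>\<omega>. min (6 * (X \<omega>)\<^sup>2) (t * \<bar>X \<omega>\<bar> ^ 3))" for t
  have i\<psi>: "integrable M (\<lambda>\<omega>. min (6 * (X \<omega>)\<^sup>2) (t * \<bar>X \<omega>\<bar> ^ 3))" if "0 \<le> t" for t
    by (rule Bochner_Integration.integrable_bound[of _ "\<lambda>\<omega>. 6 * (X \<omega>)\<^sup>2"])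
      (use i2 that in \<open>auto simp: min_def\<close>)
  have "(\<lambda>n. \<psi> (1 / real (Suc n))) \<longlonglongrightarrow> expectation (\<lambda>\<omega>. 0)"
    unfolding \<psi>_def
  proof (rule integral_dominated_convergence[where w = "\<lambda>\<omega>. 6 * (X \<omega>)\<^sup>2"])
    show "AE \<omega> in M. (\<lambda>n. min (6 * (X \<omega>)\<^sup>2) (1 / real (Suc n) * \<bar>X \<omega>\<bar> ^ 3)) \<longlonglongrightarrow> 0"
    proof (rule AE_I2)
      fix \<omega>
      have "(\<lambda>n. min (6 * (X \<omega>)\<^sup>2) (1 / real (Suc n) * \<bar>X \<omega>\<bar> ^ 3)) \<longlonglongrightarrow> min (6 * (X \<omega>)\<^sup>2) (0 * \<bar>X \<omega>\<bar> ^ 3)"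
        by (intro tendsto_intros LIMSEQ_Suc[OF lim_1_over_n])
      then show "(\<lambda>n. min (6 * (X \<omega>)\<^sup>2) (1 / real (Suc n) * \<bar>X \<omega>\<bar> ^ 3)) \<longlonglongrightarrow> 0" by simp
    qed
    show "AE \<omega> in M. norm (min (6 * (X \<omega>)\<^sup>2) (1 / real (Suc n) * \<bar>X \<omega>\<bar> ^ 3)) \<le> 6 * (X \<omega>)\<^sup>2" for n
      by (rule AE_I2) (auto simp: min_def)
  qed (use i2 in auto)
  then have "(\<lambda>n. \<psi> (1 / real (Suc n))) \<longlonglongrightarrow> 0" by simp
  from order_tendstoD(2)[OF this, of "6 * \<delta>"] \<delta>
  obtain n where n: "\<psi> (1 / real (Suc n)) < 6 * \<delta>" by (auto simp: eventually_sequentially)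
  define \<eta> where "\<eta> = 1 / real (Suc n)"
  have \<eta>: "0 < \<eta>" by (simp add: \<eta>_def)
  have \<psi>_mono: "\<psi> s \<le> \<psi> t" if "0 \<le> s" "s \<le> t" for s t
    unfolding \<psi>_def using that
    by (intro integral_mono i\<psi> min.mono mult_right_mono) auto
  have \<psi>6: "\<psi> t \<le> 6" if "0 \<le> t" for t
  proof -
    have "\<psi> t \<le> expectation (\<lambda>\<omega>. 6 * (X \<omega>)\<^sup>2)"
      unfolding \<psi>_def using that i2 by (intro integral_mono i\<psi>) auto
    then show ?thesis using var i2 by simp
  qed
  \<comment> \<open>Below \<eta> monotonicity gives \<open>6 * \<delta>\<close>; above it the crude
    bound \<open>6\<close> is hidden in a term linear in \<open>t\<close>. After multiplication by
    \<open>t^2 / 6\<close> this becomes the cubic term of the claim.\<close>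
  have \<psi>: "\<psi> \<bar>t\<bar> \<le> 6 * \<delta> + 6 * \<bar>t\<bar> / \<eta>" for t
  proof (cases "\<bar>t\<bar> \<le> \<eta>")
    case True
    then have "\<psi> \<bar>t\<bar> \<le> 6 * \<delta>" using \<psi>_mono[of "\<bar>t\<bar>" \<eta>] n by (simp add: \<eta>_def)
    moreover have "0 \<le> 6 * \<bar>t\<bar> / \<eta>" using \<eta> by simp
    ultimately show ?thesis by linarith
  next
    case False
    then have "6 \<le> 6 * \<bar>t\<bar> / \<eta>" using \<eta> by (simp add: pos_le_divide_eq)
    then show ?thesis using \<psi>6[of "\<bar>t\<bar>"] \<delta> by simp
  qed
  have expb: "\<bar>(1 - x) - exp (- x)\<bar> \<le> x" "\<bar>(1 - x) - exp (- x)\<bar> \<le> x\<^sup>2" if "0 \<le> x" for x :: real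
  proof -
    have le: "1 - x \<le> exp (- x)" using exp_ge_add_one_self[of "- x"] by simp
    have "exp (- x) \<le> 1" using that by simp
    then show "\<bar>(1 - x) - exp (- x)\<bar> \<le> x" using le by linarith
    have "exp (- x) = 1 / exp x" by (simp add: exp_minus field_simps)
    also have "\<dots> \<le> 1 / (1 + x)" using that exp_ge_add_one_self[of x] by (intro divide_left_mono) auto
    also have "1 / (1 + x) \<le> 1 - x + x\<^sup>2"
    proof -
      have "1 \<le> (1 - x + x\<^sup>2) * (1 + x)" using that by (simp add: algebra_simps power2_eq_square)
      then show ?thesis using that by (simp add: pos_divide_le_eq)
    qed
    finally show "\<bar>(1 - x) - exp (- x)\<bar> \<le> x\<^sup>2" using le by linarith
  qed
  \<comment> \<open>For small \<open>t\<close> the quadratic bound gives a fourth power of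
    \<open>t\<close>, for large \<open>t\<close> the linear bound gives a square; both are below the
    cube.\<close>
  have second: "\<bar>(1 - t\<^sup>2 / 2) - exp (- t\<^sup>2 / 2)\<bar> \<le> \<bar>t\<bar> ^ 3" for t :: real
  proof (cases "\<bar>t\<bar> \<le> 1")
    case True
    have "\<bar>(1 - t\<^sup>2 / 2) - exp (- (t\<^sup>2 / 2))\<bar> \<le> (t\<^sup>2 / 2)\<^sup>2" by (rule expb) simp
    also have "(t\<^sup>2 / 2)\<^sup>2 = \<bar>t\<bar> ^ 4 / 4" by (simp add: power_divide)
    also have "\<bar>t\<bar> ^ 4 / 4 \<le> \<bar>t\<bar> ^ 4" by simp
    also have "\<dots> \<le> \<bar>t\<bar> ^ 3" using True by (intro power_decreasing) auto
    finally show ?thesis by simp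
  next
    case False
    have "\<bar>(1 - t\<^sup>2 / 2) - exp (- (t\<^sup>2 / 2))\<bar> \<le> t\<^sup>2 / 2" by (rule expb) simp
    also have "\<dots> \<le> \<bar>t\<bar> ^ 2" by simp
    also have "\<dots> \<le> \<bar>t\<bar> ^ 3" using False by (intro power_increasing) auto
    finally show ?thesis by simp
  qed
  show ?thesis
  proof (rule that)
    show "0 \<le> 1 / \<eta> + 1" using \<eta> by simp
    fix t
    have "cmod (char (distr M borel X) t - complex_of_real (1 - t\<^sup>2 * 1 / 2)) \<le> t\<^sup>2 / 6 * \<psi> \<bar>t\<bar>"
      unfolding \<psi>_def by (rule char_approx3') (use i1 i2 mean var in auto)
    also have "\<dots> \<le> t\<^sup>2 / 6 * (6 * \<delta> + 6 * \<bar>t\<bar> / \<eta>)" by (intro mult_left_mono \<psi>) auto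
    also have "\<dots> = \<delta> * t\<^sup>2 + \<bar>t\<bar> ^ 3 / \<eta>"
    proof -
      have "t\<^sup>2 * \<bar>t\<bar> = \<bar>t\<bar> ^ 3" by (simp add: power2_eq_square power3_eq_cube)
      then show ?thesis by (simp add: algebra_simps)
    qed
    finally have 1: "cmod (char (distr M borel X) t - complex_of_real (1 - t\<^sup>2 / 2)) \<le> \<delta> * t\<^sup>2 + \<bar>t\<bar> ^ 3 / \<eta>" by simp
    have "cmod (char (distr M borel X) t - of_real (exp (- t\<^sup>2 / 2))) \<le>
       cmod (char (distr M borel X) t - complex_of_real (1 - t\<^sup>2 / 2)) +
       cmod (complex_of_real (1 - t\<^sup>2 / 2) - of_real (exp (- t\<^sup>2 / 2)))"
      by (rule norm_triangle_ineq[THEN order_trans[rotated]]) simp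
    also have "cmod (complex_of_real (1 - t\<^sup>2 / 2) - of_real (exp (- t\<^sup>2 / 2))) = \<bar>(1 - t\<^sup>2 / 2) - exp (- t\<^sup>2 / 2)\<bar>"
      by (simp only: of_real_diff[symmetric] norm_of_real)
    finally show "cmod (char (distr M borel X) t - of_real (exp (- t\<^sup>2 / 2))) \<le> \<delta> * t\<^sup>2 + (1 / \<eta> + 1) * \<bar>t\<bar> ^ 3"
      using 1 second[of t] by (simp add: algebra_simps)
  qed
qed

lemma (in prob_space) expectation_cos_char:
  assumes [measurable]: "Y \<in> borel_measurable M"
  shows "expectation (\<lambda>\<omega>. cos (b + Y \<omega>)) = Re (cis b * char (distr M borel Y) 1)"
proof -
  have "cis b * char (distr M borel Y) 1 = (CLINT \<omega>|M. cis b * iexp (Y \<omega>))"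
    by (simp add: char_def integral_distr)
  moreover have "integrable M (\<lambda>\<omega>. cis b * iexp (Y \<omega>))"
    by (intro integrable_mult_right integrable_iexp) auto
  ultimately have "Re (cis b * char (distr M borel Y) 1) = expectation (\<lambda>\<omega>. Re (cis b * iexp (Y \<omega>)))"
    by (simp only: integral_Re)
  also have "(\<lambda>\<omega>. Re (cis b * iexp (Y \<omega>))) = (\<lambda>\<omega>. cos (b + Y \<omega>))"
    by (simp add: cis_conv_exp[symmetric] cis_mult)
  finally show ?thesis by simp
qed

lemma exp_minus_lipschitz: "\<bar>exp (- x) - exp (- y)\<bar> \<le> \<bar>x - y\<bar>" if "0 \<le> x" "0 \<le> y" for x y :: real
proof -
  have "exp (- x) - exp (- y) \<le> y - x" if "0 \<le> x" "x \<le> y" for x y :: real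
  proof -
    have "exp (- x) * (1 + (x - y)) \<le> exp (- x) * exp (x - y)"
      by (intro mult_left_mono exp_ge_add_one_self) auto
    also have "\<dots> = exp (- y)" by (simp add: exp_add[symmetric])
    finally have "exp (- x) - exp (- y) \<le> exp (- x) * (y - x)" by (simp add: algebra_simps)
    also have "\<dots> \<le> 1 * (y - x)" using that by (intro mult_right_mono) auto
    finally show ?thesis by simp
  qed
  from this[of x y] this[of y x] that show ?thesis by (cases "x \<le> y") (auto simp: abs_if)
qed

section \<open>The standardized walk along a fixed and along the random tree\<close>

definition walk :: "(nat \<Rightarrow> 'a \<Rightarrow> real) \<Rightarrow> (nat \<Rightarrow> nat) \<Rightarrow> nat \<Rightarrow> 'a \<Rightarrow> real" where
  "walk X r m \<omega> = (\<Sum>i=1..m. X (r i) \<omega>)"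

lemma walk_Suc: "walk X r (Suc m) \<omega> = walk X r m \<omega> + X (r (Suc m)) \<omega>"
  by (simp add: walk_def)

lemma walk_upd [simp]: "m < i \<Longrightarrow> walk X (r(i := k)) m \<omega> = walk X r m \<omega>"
  unfolding walk_def by (intro sum.cong) auto

lemma walk_cluster:
  "r \<in> trees n \<Longrightarrow> m \<le> n \<Longrightarrow> m \<le> L \<Longrightarrow> walk X r m \<omega> = (\<Sum>j=1..L. cluster r m j * X j \<omega>)"
  unfolding walk_def by (rule sum_fibres)

text \<open>Mean zero and variance one can be assumed because a reinforced step is one of the
  original steps, so reinforcement commutes with affine maps.\<close>

locale standard_reinforcement = reinforcement +
  assumes p_bounds: "0 < p" "p < 1 / 2"
    and mean_X: "\<And>i. 1 \<le> i \<Longrightarrow> expectation (X i) = 0"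
    and square_integrable_X: "\<And>i. 1 \<le> i \<Longrightarrow> integrable M (\<lambda>\<omega>. (X i \<omega>)\<^sup>2)"
    and second_moment_X: "\<And>i. 1 \<le> i \<Longrightarrow> expectation (\<lambda>\<omega>. (X i \<omega>)\<^sup>2) = 1"
begin

definition W :: "nat \<Rightarrow> 'a \<Rightarrow> real" where
  "W m \<omega> = (\<Sum>i=1..m. reinforced (\<lambda>j. X j \<omega>) (\<lambda>j. \<epsilon> j \<omega>) (\<lambda>j. U j \<omega>) i)"

text \<open>The tree at any later time \<open>n\<close> also describes the earlier times, so values
  of the walk at several times are read off one tree.\<close>

lemma W_eq_walk: "m \<le> n \<Longrightarrow> W m \<omega> = walk X (\<tau> n \<omega>) m \<omega>"
  unfolding W_def walk_def reinforced_root_step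
  by (intro sum.cong refl) (simp add: \<tau>_def step_tree_apply)

lemma integrable_X: "1 \<le> i \<Longrightarrow> integrable M (X i)"
  by (rule square_integrable_imp_integrable[OF X_measurable square_integrable_X])

lemma expectation_X_X:
  assumes "1 \<le> i" "1 \<le> j"
  shows "expectation (\<lambda>\<omega>. X i \<omega> * X j \<omega>) = of_bool (i = j)"
proof (cases "i = j")
  case True
  then show ?thesis using second_moment_X[OF assms(1)] by (simp add: power2_eq_square)
next
  case False
  have "indep_vars (\<lambda>_. borel) X {i, j}"
    by (rule indep_vars_subset[OF indep_X]) (use assms in auto)
  then have "expectation (\<lambda>\<omega>. \<Prod>k\<in>{i, j}. X k \<omega>) = (\<Prod>k\<in>{i, j}. expectation (X k))"
    by (intro indep_vars_lebesgue_integral) (use assms integrable_X in auto)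
  then show ?thesis using False mean_X assms by simp
qed

lemma walk_measurable_\<F>X:
  assumes "r \<in> trees n" "m \<le> n"
  shows "walk X r m \<in> borel_measurable \<F>X"
proof -
  have "(\<lambda>\<omega>. \<Sum>i=1..m. X (r i) \<omega>) \<in> borel_measurable \<F>X"
    using trees_pos[OF assms(1)] assms(2) by (intro borel_measurable_sum X_measurable_\<F>X) fastforce
  then show ?thesis unfolding walk_def .
qed

lemma walk_measurable: "r \<in> trees n \<Longrightarrow> m \<le> n \<Longrightarrow> walk X r m \<in> borel_measurable M"
  by (rule measurable_from_subalg[OF subalgebra_X walk_measurable_\<F>X])

lemma walk_square_integrable:
  assumes "r \<in> trees n" "m \<le> n"
  shows "integrable M (\<lambda>\<omega>. (walk X r m \<omega>)\<^sup>2)"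
  unfolding walk_def
proof (intro integrable_square_sum)
  fix i assume "i \<in> {1..m}"
  then have "1 \<le> r i" using trees_pos[OF assms(1), of i] assms(2) by auto
  then show "X (r i) \<in> borel_measurable M" "integrable M (\<lambda>\<omega>. (X (r i) \<omega>)\<^sup>2)"
    using X_measurable square_integrable_X by auto
qed

text \<open>The original steps are orthonormal, so only the diagonal of the product of the two
  cluster sums survives.\<close>

lemma expectation_walk_walk:
  assumes r: "r \<in> trees n" and ab: "a \<le> b" "b \<le> n"
  shows "expectation (\<lambda>\<omega>. walk X r a \<omega> * walk X r b \<omega>) = pairs r a b"
proof -
  have XX: "integrable M (\<lambda>\<omega>. X i \<omega> * X j \<omega>)" if "1 \<le> i" "1 \<le> j" for i j
    by (intro integrable_mult_of_squares X_measurable square_integrable_X that)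
  have "expectation (\<lambda>\<omega>. walk X r a \<omega> * walk X r b \<omega>) =
      expectation (\<lambda>\<omega>. \<Sum>i=1..b. \<Sum>j=1..b. cluster r a i * cluster r b j * (X i \<omega> * X j \<omega>))"
    using ab by (simp add: walk_cluster[OF r, of _ b] sum_product mult_ac del: One_nat_def)
  also have "\<dots> = (\<Sum>i=1..b. \<Sum>j=1..b. cluster r a i * cluster r b j * expectation (\<lambda>\<omega>. X i \<omega> * X j \<omega>))"
    using XX by (subst Bochner_Integration.integral_sum) (auto intro!: sum.cong Bochner_Integration.integrable_sum)
  also have "\<dots> = (\<Sum>i=1..b. \<Sum>j=1..b. if i = j then cluster r a i * cluster r b j else 0)"
    using expectation_X_X by (intro sum.cong refl) auto
  also have "\<dots> = pairs r a b"
    unfolding pairs_def by (intro sum.cong refl) (simp add: sum.delta)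
  finally show ?thesis .
qed

lemma W_measurable [measurable]: "W m \<in> borel_measurable M"
proof -
  have "(\<lambda>\<omega>. W m \<omega>) \<in> borel_measurable M"
  proof -
    have "integrable M (\<lambda>\<omega>. walk X (\<tau> m \<omega>) m \<omega>)"
      by (rule expectation_tree(1)[of _ "\<lambda>r \<omega>. walk X r m \<omega>"])
        (blast intro: walk_measurable_\<F>X square_integrable_imp_integrable walk_measurable walk_square_integrable)+
    then show ?thesis unfolding W_eq_walk[OF order_refl] by (rule borel_measurable_integrable)
  qed
  then show ?thesis by simp
qed

lemma W_square_integrable: "integrable M (\<lambda>\<omega>. (W m \<omega>)\<^sup>2)"
  unfolding W_eq_walk[OF order_refl]
  by (rule expectation_tree(1)[of _ "\<lambda>r \<omega>. (walk X r m \<omega>)\<^sup>2"])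
    (blast intro: walk_square_integrable borel_measurable_power walk_measurable_\<F>X)+

lemma expectation_W_W:
  assumes "a \<le> b"
  shows "expectation (\<lambda>\<omega>. W a \<omega> * W b \<omega>) = tree_exp p b (\<lambda>r. pairs r a b)"
proof -
  have "expectation (\<lambda>\<omega>. W a \<omega> * W b \<omega>) = expectation (\<lambda>\<omega>. walk X (\<tau> b \<omega>) a \<omega> * walk X (\<tau> b \<omega>) b \<omega>)"
    using assms by (simp add: W_eq_walk[of _ b])
  also have "\<dots> = tree_exp p b (\<lambda>r. expectation (\<lambda>\<omega>. walk X r a \<omega> * walk X r b \<omega>))"
  proof (rule expectation_tree(2))
    fix r assume r: "r \<in> trees b"
    show "(\<lambda>\<omega>. walk X r a \<omega> * walk X r b \<omega>) \<in> borel_measurable \<F>X"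
      by (intro borel_measurable_times walk_measurable_\<F>X[OF r] assms order_refl)
    show "integrable M (\<lambda>\<omega>. walk X r a \<omega> * walk X r b \<omega>)"
      by (intro integrable_mult_of_squares walk_measurable[OF r] walk_square_integrable[OF r] assms order_refl)
  qed
  also have "\<dots> = tree_exp p b (\<lambda>r. pairs r a b)"
    by (rule tree_exp_cong) (simp add: expectation_walk_walk assms)
  finally show ?thesis .
qed

section \<open>Gaussian approximation of linear combinations of values of the walk\<close>

lemma char_X_near_gaussian:
  assumes "0 < \<delta>"
  obtains K where "0 \<le> K"
    "\<And>t. cmod (char \<mu> t - of_real (exp (- t\<^sup>2 / 2))) \<le> \<delta> * t\<^sup>2 + K * \<bar>t\<bar> ^ 3"
  using char_near_gaussian[OF X_measurable square_integrable_X mean_X second_moment_X assms, of 1]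
  by (auto simp: distr_X)

lemma expectation_cos_weighted_sum:
  "expectation (\<lambda>\<omega>. cos (b + (\<Sum>j=1..n. w j * X j \<omega>))) = Re (cis b * (\<Prod>j=1..n. char \<mu> (w j)))"
proof -
  have m: "X j \<in> borel_measurable M" if "j \<in> {1..n}" for j using that by (intro X_measurable) auto
  have "indep_vars (\<lambda>_. borel) (\<lambda>j \<omega>. w j * X j \<omega>) {1..n}"
    by (rule indep_vars_compose2[where M' = "\<lambda>_. borel", OF indep_vars_subset[OF indep_X]]) auto
  then have "char (distr M borel (\<lambda>\<omega>. \<Sum>j=1..n. w j * X j \<omega>)) 1 = (\<Prod>j=1..n. char (distr M borel (\<lambda>\<omega>. w j * X j \<omega>)) 1)"
    by (rule char_distr_sum)
  also have "\<dots> = (\<Prod>j=1..n. char \<mu> (w j))"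
  proof (rule prod.cong[OF refl])
    fix j assume j: "j \<in> {1..n}"
    have "char (distr M borel (\<lambda>\<omega>. w j * X j \<omega>)) 1 = char (distr M borel (X j)) (w j)"
      unfolding char_def using m[OF j] by (simp add: integral_distr)
    then show "char (distr M borel (\<lambda>\<omega>. w j * X j \<omega>)) 1 = char \<mu> (w j)"
      using j by (simp add: distr_X)
  qed
  finally show ?thesis
    using expectation_cos_char[of "\<lambda>\<omega>. \<Sum>j=1..n. w j * X j \<omega>" b] m by simp
qed

text \<open>Lindeberg's replacement at the level of characteristic functions: a product of factors
  bounded by one changes at most by the sum of the changes of its factors. The Gaussian product has
  variance \<open>\<Sum>j. (w j)^2\<close>; replacing it by \<open>v\<close> costs half the
  difference, as \<open>exp (- x)\<close> is 1-Lipschitz on nonnegative \<open>x\<close>.\<close>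

lemma cos_weighted_sum_near_gaussian:
  assumes K: "\<And>t. cmod (char \<mu> t - of_real (exp (- t\<^sup>2 / 2))) \<le> \<delta> * t\<^sup>2 + K * \<bar>t\<bar> ^ 3" and v: "0 \<le> v"
  shows "\<bar>expectation (\<lambda>\<omega>. cos (b + (\<Sum>j=1..n. w j * X j \<omega>))) - cos b * exp (- v / 2)\<bar>
    \<le> \<delta> * (\<Sum>j=1..n. (w j)\<^sup>2) + K * (\<Sum>j=1..n. \<bar>w j\<bar> ^ 3) + \<bar>(\<Sum>j=1..n. (w j)\<^sup>2) - v\<bar> / 2"
proof -
  define s where "s = (\<Sum>j=1..n. (w j)\<^sup>2)"
  have s0: "0 \<le> s" by (auto simp: s_def intro: sum_nonneg)
  have prob\<mu>: "real_distribution \<mu>"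
    using real_distribution_distr[OF X_measurable[of 1]] distr_X[of 1] by simp
  have G: "(\<Prod>j=1..n. complex_of_real (exp (- (w j)\<^sup>2 / 2))) = of_real (exp (- s / 2))"
  proof -
    have "(\<Prod>j=1..n. exp (- (w j)\<^sup>2 / 2)) = exp (\<Sum>j=1..n. - (w j)\<^sup>2 / 2)" by (simp add: exp_sum)
    also have "(\<Sum>j=1..n. - (w j)\<^sup>2 / 2) = - s / 2" by (simp add: s_def sum_divide_distrib sum_negf)
    finally show ?thesis by (simp only: of_real_prod[symmetric])
  qed
  have "cmod ((\<Prod>j=1..n. char \<mu> (w j)) - of_real (exp (- s / 2))) \<le>
      (\<Sum>j=1..n. cmod (char \<mu> (w j) - of_real (exp (- (w j)\<^sup>2 / 2))))"
    unfolding G[symmetric]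
    by (rule norm_prod_diff) (auto intro: real_distribution.cmod_char_le_1[OF prob\<mu>])
  also have "\<dots> \<le> (\<Sum>j=1..n. \<delta> * (w j)\<^sup>2 + K * \<bar>w j\<bar> ^ 3)" by (intro sum_mono K)
  also have "\<dots> = \<delta> * s + K * (\<Sum>j=1..n. \<bar>w j\<bar> ^ 3)" by (simp add: s_def sum.distrib sum_distrib_left)
  finally have 1: "cmod ((\<Prod>j=1..n. char \<mu> (w j)) - of_real (exp (- s / 2))) \<le> \<delta> * s + K * (\<Sum>j=1..n. \<bar>w j\<bar> ^ 3)" .
  have "\<bar>Re (cis b * (\<Prod>j=1..n. char \<mu> (w j))) - cos b * exp (- s / 2)\<bar>
      = \<bar>Re (cis b * ((\<Prod>j=1..n. char \<mu> (w j)) - of_real (exp (- s / 2))))\<bar>"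
    by (simp add: algebra_simps)
  also have "\<dots> \<le> cmod (cis b * ((\<Prod>j=1..n. char \<mu> (w j)) - of_real (exp (- s / 2))))" by (rule abs_Re_le_cmod)
  also have "\<dots> = cmod ((\<Prod>j=1..n. char \<mu> (w j)) - of_real (exp (- s / 2)))" by (simp add: norm_mult)
  finally have 2: "\<bar>Re (cis b * (\<Prod>j=1..n. char \<mu> (w j))) - cos b * exp (- s / 2)\<bar> \<le>
      \<delta> * s + K * (\<Sum>j=1..n. \<bar>w j\<bar> ^ 3)" using 1 by linarith
  have "\<bar>cos b * exp (- s / 2) - cos b * exp (- v / 2)\<bar> = \<bar>cos b\<bar> * \<bar>exp (- (s / 2)) - exp (- (v / 2))\<bar>"
    by (simp add: abs_mult right_diff_distrib[symmetric])
  also have "\<dots> \<le> 1 * \<bar>s / 2 - v / 2\<bar>"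
    using s0 v by (intro mult_mono exp_minus_lipschitz abs_cos_le_one) auto
  finally have 3: "\<bar>cos b * exp (- s / 2) - cos b * exp (- v / 2)\<bar> \<le> \<bar>s - v\<bar> / 2"
    by (simp add: diff_divide_distrib[symmetric])
  show ?thesis unfolding expectation_cos_weighted_sum s_def[symmetric] using 2 3 by linarith
qed

text \<open>Given the tree, a combination of walk values is a weighted sum of independent steps with
  weights \<open>w r\<close>. The error bound of the previous lemma holds for each tree and is
  averaged over the trees.\<close>

lemma cos_W_near_gaussian:
  fixes c :: "nat \<Rightarrow> real" and a :: "nat \<Rightarrow> nat"
  assumes K: "\<And>t. cmod (char \<mu> t - of_real (exp (- t\<^sup>2 / 2))) \<le> \<delta> * t\<^sup>2 + K * \<bar>t\<bar> ^ 3" and v: "0 \<le> v"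
    and a: "\<And>l. l \<in> F \<Longrightarrow> a l \<le> n"
  defines "w \<equiv> \<lambda>r j. \<Sum>l\<in>F. c l * cluster r (a l) j"
  shows "\<bar>expectation (\<lambda>\<omega>. cos (b + (\<Sum>l\<in>F. c l * W (a l) \<omega>))) - cos b * exp (- v / 2)\<bar>
    \<le> \<delta> * tree_exp p n (\<lambda>r. \<Sum>j=1..n. (w r j)\<^sup>2) + K * tree_exp p n (\<lambda>r. \<Sum>j=1..n. \<bar>w r j\<bar> ^ 3)
      + 1 / 2 * tree_exp p n (\<lambda>r. \<bar>(\<Sum>j=1..n. (w r j)\<^sup>2) - v\<bar>)"
proof -
  have lin: "(\<Sum>l\<in>F. c l * walk X r (a l) \<omega>) = (\<Sum>j=1..n. w r j * X j \<omega>)" if "r \<in> trees n" for r \<omega>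
  proof -
    have "(\<Sum>l\<in>F. c l * walk X r (a l) \<omega>) = (\<Sum>l\<in>F. \<Sum>j=1..n. c l * cluster r (a l) j * X j \<omega>)"
      by (intro sum.cong refl) (simp add: walk_cluster[OF that a a] sum_distrib_left mult.assoc)
    then show ?thesis unfolding w_def sum_distrib_right by (simp only: sum.swap[of _ F])
  qed
  let ?\<Phi> = "\<lambda>r \<omega>. cos (b + (\<Sum>l\<in>F. c l * walk X r (a l) \<omega>))"
  have "expectation (\<lambda>\<omega>. cos (b + (\<Sum>l\<in>F. c l * W (a l) \<omega>))) = expectation (\<lambda>\<omega>. ?\<Phi> (\<tau> n \<omega>) \<omega>)"
    by (intro Bochner_Integration.integral_cong refl arg_cong[where f = cos] arg_cong2[where f = "(+)"]
        sum.cong arg_cong2[where f = "(*)"] W_eq_walk a)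
  also have "\<dots> = tree_exp p n (\<lambda>r. expectation (?\<Phi> r))"
  proof (rule expectation_tree(2))
    fix r assume r: "r \<in> trees n"
    have h: "(\<lambda>\<omega>. b + (\<Sum>l\<in>F. c l * walk X r (a l) \<omega>)) \<in> borel_measurable \<F>X"
      using walk_measurable_\<F>X[OF r a] by (intro borel_measurable_add borel_measurable_sum borel_measurable_times) auto
    show m: "?\<Phi> r \<in> borel_measurable \<F>X"
      by (rule measurable_compose[OF h]) (intro borel_measurable_continuous_onI continuous_intros)
    show "integrable M (?\<Phi> r)"
      by (rule integrable_const_bound[of _ 1]) (use measurable_from_subalg[OF subalgebra_X m] in auto)
  qed
  also have "\<dots> = tree_exp p n (\<lambda>r. expectation (\<lambda>\<omega>. cos (b + (\<Sum>j=1..n. w r j * X j \<omega>))))"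
    by (rule tree_exp_cong) (simp only: lin)
  finally have "\<bar>expectation (\<lambda>\<omega>. cos (b + (\<Sum>l\<in>F. c l * W (a l) \<omega>))) - cos b * exp (- v / 2)\<bar> =
     \<bar>tree_exp p n (\<lambda>r. expectation (\<lambda>\<omega>. cos (b + (\<Sum>j=1..n. w r j * X j \<omega>))) - cos b * exp (- v / 2))\<bar>"
    by (simp only: tree_exp_diff tree_exp_const)
  also have "\<dots> \<le> tree_exp p n (\<lambda>r. \<bar>expectation (\<lambda>\<omega>. cos (b + (\<Sum>j=1..n. w r j * X j \<omega>))) - cos b * exp (- v / 2)\<bar>)"
    by (rule tree_exp_abs) (use p in auto)
  also have "\<dots> \<le> tree_exp p n (\<lambda>r. \<delta> * (\<Sum>j=1..n. (w r j)\<^sup>2) + K * (\<Sum>j=1..n. \<bar>w r j\<bar> ^ 3)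
      + 1 / 2 * \<bar>(\<Sum>j=1..n. (w r j)\<^sup>2) - v\<bar>)"
    using cos_weighted_sum_near_gaussian[OF K v] by (intro tree_exp_mono p) simp
  also have "\<dots> = \<delta> * tree_exp p n (\<lambda>r. \<Sum>j=1..n. (w r j)\<^sup>2) + K * tree_exp p n (\<lambda>r. \<Sum>j=1..n. \<bar>w r j\<bar> ^ 3)
      + 1 / 2 * tree_exp p n (\<lambda>r. \<bar>(\<Sum>j=1..n. (w r j)\<^sup>2) - v\<bar>)"
    by (simp only: tree_exp_add tree_exp_mult_left)
  finally show ?thesis .
qed

end

text \<open>Symmetric in the two times, so that double sums over pairs of times need no case
  distinction by order.\<close>

definition limit_cov :: "real \<Rightarrow> real \<Rightarrow> real \<Rightarrow> real" where
  "limit_cov p s t = max s t powr p * min s t powr (1 - p) / (1 - 2 * p)"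

lemma limit_cov_le: "s \<le> t \<Longrightarrow> limit_cov p s t = t powr p * s powr (1 - p) / (1 - 2 * p)"
  by (simp add: limit_cov_def max_def min_def)

lemma limit_cov_commute: "limit_cov p s t = limit_cov p t s"
  by (simp add: limit_cov_def max.commute min.commute)

lemma pairs_eq_sum:
  assumes "r \<in> trees n" "b \<le> L"
  shows "(\<Sum>j=1..L. cluster r a j * cluster r b j) = pairs r a b"
  unfolding pairs_def
proof (rule sum.mono_neutral_right)
  show "\<forall>i\<in>{1..L} - {1..b}. cluster r a i * cluster r b i = 0"
    using cluster_zero[OF assms(1), of b] by auto
qed (use assms in auto)

lemma pairs_upd_later: "a \<le> b \<Longrightarrow> b < i \<Longrightarrow> pairs (r(i := k)) a b = pairs r a b"
  by (simp add: pairs_def)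

context standard_reinforcement
begin

text \<open>Expanding the squares yields \<open>pairs\<close> at all pairs of times, each of which
  converges in mean to its covariance. The trees are taken at the common time \<open>N n\<close>;
  consistency of the tree laws brings each pair back to its own later time.\<close>

lemma weight_squares_tendsto:
  fixes t c :: "nat \<Rightarrow> real"
  assumes F: "finite F" and t: "\<And>l. l \<in> F \<Longrightarrow> 0 \<le> t l" "\<And>l. l \<in> F \<Longrightarrow> t l \<le> T"
  defines "v \<equiv> \<Sum>l\<in>F. \<Sum>m\<in>F. c l * c m * limit_cov p (t l) (t m)"
    and "N \<equiv> \<lambda>n. nat \<lfloor>T * real n\<rfloor>" and "a \<equiv> \<lambda>n l. nat \<lfloor>t l * real n\<rfloor>"
  shows "(\<lambda>n. tree_exp p (N n) (\<lambda>r. \<bar>(\<Sum>j=1..N n. (\<Sum>l\<in>F. c l / sqrt (real n) * cluster r (a n l) j)\<^sup>2) - v\<bar>)) \<longlonglongrightarrow> 0"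
proof -
  have p01: "0 \<le> p" "p \<le> 1" using p by auto
  have aN: "a n l \<le> N n" if "l \<in> F" for n l
    unfolding a_def N_def using t[OF that] by (intro nat_mono floor_mono mult_right_mono) auto
  define P where "P n l m r = pairs r (min (a n l) (a n m)) (max (a n l) (a n m))" for n l m r
  define E where "E l m n = tree_exp p (N n) (\<lambda>r. \<bar>P n l m r / real n - limit_cov p (t l) (t m)\<bar>)" for l m n
  have E: "E l m \<longlonglongrightarrow> 0" if lm: "l \<in> F" "m \<in> F" for l m
  proof -
    have le: "E l m \<longlonglongrightarrow> 0" if lm: "l \<in> F" "m \<in> F" "t l \<le> t m" for l m
    proof -
      have ale: "a n l \<le> a n m" for n
        unfolding a_def using lm by (intro nat_mono floor_mono mult_right_mono) auto
      have "E l m = (\<lambda>n. tree_exp p (a n m) (\<lambda>r.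
         \<bar>pairs r (a n l) (a n m) / real n - t m powr p * t l powr (1 - p) / (1 - 2 * p)\<bar>))"
      proof
        fix n
        show "E l m n = tree_exp p (a n m) (\<lambda>r.
         \<bar>pairs r (a n l) (a n m) / real n - t m powr p * t l powr (1 - p) / (1 - 2 * p)\<bar>)"
          unfolding E_def P_def limit_cov_le[OF lm(3)] min_absorb1[OF ale] max_absorb2[OF ale]
          by (rule tree_exp_extend) (simp_all add: aN lm pairs_upd_later ale)
      qed
      then show ?thesis
        using pairs_floor_tendsto[OF p_bounds t(1)[OF lm(1)] lm(3)] by (simp add: a_def)
    qed
    show ?thesis
    proof (cases "t l \<le> t m")
      case False
      have "E l m = E m l" unfolding E_def P_def by (simp add: min.commute max.commute limit_cov_commute)
      then show ?thesis using le[of m l] False lm by simp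
    qed (use le lm in auto)
  qed
  have "(\<lambda>n. \<Sum>l\<in>F. \<Sum>m\<in>F. \<bar>c l * c m\<bar> * E l m n) \<longlonglongrightarrow> (\<Sum>l\<in>F. \<Sum>m\<in>F. \<bar>c l * c m\<bar> * 0)"
    by (intro tendsto_sum tendsto_mult_left E)
  then have lim: "(\<lambda>n. \<Sum>l\<in>F. \<Sum>m\<in>F. \<bar>c l * c m\<bar> * E l m n) \<longlonglongrightarrow> 0" by simp
  show ?thesis
  proof (rule tendsto_sandwich[OF _ _ tendsto_const lim])
    show "\<forall>\<^sub>F n in sequentially. 0 \<le> tree_exp p (N n) (\<lambda>r. \<bar>(\<Sum>j=1..N n. (\<Sum>l\<in>F. c l / sqrt (real n) * cluster r (a n l) j)\<^sup>2) - v\<bar>)"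
      using p01 by (intro always_eventually allI tree_exp_nonneg) auto
    show "\<forall>\<^sub>F n in sequentially. tree_exp p (N n) (\<lambda>r. \<bar>(\<Sum>j=1..N n. (\<Sum>l\<in>F. c l / sqrt (real n) * cluster r (a n l) j)\<^sup>2) - v\<bar>)
       \<le> (\<Sum>l\<in>F. \<Sum>m\<in>F. \<bar>c l * c m\<bar> * E l m n)"
    proof (intro always_eventually allI)
      fix n
      have "tree_exp p (N n) (\<lambda>r. \<bar>(\<Sum>j=1..N n. (\<Sum>l\<in>F. c l / sqrt (real n) * cluster r (a n l) j)\<^sup>2) - v\<bar>)
        \<le> tree_exp p (N n) (\<lambda>r. \<Sum>l\<in>F. \<Sum>m\<in>F. \<bar>c l * c m\<bar> * \<bar>P n l m r / real n - limit_cov p (t l) (t m)\<bar>)"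
      proof (rule tree_exp_mono[OF p01])
        fix r assume r: "r \<in> trees (N n)"
        have "(\<Sum>j=1..N n. (\<Sum>l\<in>F. c l / sqrt (real n) * cluster r (a n l) j)\<^sup>2) =
           (\<Sum>j=1..N n. \<Sum>l\<in>F. \<Sum>m\<in>F. c l * c m / real n * (cluster r (a n l) j * cluster r (a n m) j))"
          unfolding power2_eq_square sum_product
          by (intro sum.cong refl) (simp add: mult_ac)
        also have "\<dots> = (\<Sum>l\<in>F. \<Sum>m\<in>F. \<Sum>j=1..N n. c l * c m / real n * (cluster r (a n l) j * cluster r (a n m) j))"
          by (simp only: sum.swap[of _ _ "{1..N n}"])
        also have "\<dots> = (\<Sum>l\<in>F. \<Sum>m\<in>F. c l * c m * (P n l m r / real n))"
        proof (intro sum.cong refl)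
          fix l m assume lm: "l \<in> F" "m \<in> F"
          have "(\<Sum>j=1..N n. cluster r (a n l) j * cluster r (a n m) j) = P n l m r"
            unfolding P_def pairs_eq_sum[OF r max.boundedI[OF aN[OF lm(1)] aN[OF lm(2)]], symmetric]
            by (intro sum.cong refl) (simp add: min_def max_def mult.commute)
          then show "(\<Sum>j=1..N n. c l * c m / real n * (cluster r (a n l) j * cluster r (a n m) j)) =
             c l * c m * (P n l m r / real n)"
            unfolding sum_distrib_left[symmetric] by simp
        qed
        finally have "(\<Sum>j=1..N n. (\<Sum>l\<in>F. c l / sqrt (real n) * cluster r (a n l) j)\<^sup>2) - v =
            (\<Sum>l\<in>F. \<Sum>m\<in>F. c l * c m * (P n l m r / real n - limit_cov p (t l) (t m)))"
          unfolding v_def by (simp add: sum_subtractf right_diff_distrib)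
        also have "\<bar>\<dots>\<bar> \<le> (\<Sum>l\<in>F. \<Sum>m\<in>F. \<bar>c l * c m * (P n l m r / real n - limit_cov p (t l) (t m))\<bar>)"
          by (intro order_trans[OF sum_abs] sum_mono sum_abs)
        finally show "\<bar>(\<Sum>j=1..N n. (\<Sum>l\<in>F. c l / sqrt (real n) * cluster r (a n l) j)\<^sup>2) - v\<bar> \<le>
           (\<Sum>l\<in>F. \<Sum>m\<in>F. \<bar>c l * c m\<bar> * \<bar>P n l m r / real n - limit_cov p (t l) (t m)\<bar>)"
          by (simp only: abs_mult)
      qed
      also have "\<dots> = (\<Sum>l\<in>F. \<Sum>m\<in>F. \<bar>c l * c m\<bar> * E l m n)"
        unfolding E_def by (simp only: tree_exp_sum tree_exp_mult_left)
      finally show "tree_exp p (N n) (\<lambda>r. \<bar>(\<Sum>j=1..N n. (\<Sum>l\<in>F. c l / sqrt (real n) * cluster r (a n l) j)\<^sup>2) - v\<bar>)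
       \<le> (\<Sum>l\<in>F. \<Sum>m\<in>F. \<bar>c l * c m\<bar> * E l m n)" .
    qed
  qed
qed

text \<open>By monotonicity of cluster sizes every weight is at most \<open>C / sqrt n\<close> times
  the size at time \<open>N n\<close>, which leaves \<open>C^3 / n powr (3 / 2)\<close> times the
  sum of cubes.\<close>

lemma weight_cubes_tendsto:
  fixes t c :: "nat \<Rightarrow> real"
  assumes F: "finite F" and t: "\<And>l. l \<in> F \<Longrightarrow> t l \<le> T" and T: "0 \<le> T"
  defines "N \<equiv> \<lambda>n. nat \<lfloor>T * real n\<rfloor>" and "a \<equiv> \<lambda>n l. nat \<lfloor>t l * real n\<rfloor>"
  shows "(\<lambda>n. tree_exp p (N n) (\<lambda>r. \<Sum>j=1..N n. \<bar>\<Sum>l\<in>F. c l / sqrt (real n) * cluster r (a n l) j\<bar> ^ 3)) \<longlonglongrightarrow> 0"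
proof -
  have p01: "0 \<le> p" "p \<le> 1" using p by auto
  have aN: "a n l \<le> N n" if "l \<in> F" for n l
    unfolding a_def N_def using t[OF that] by (intro nat_mono floor_mono mult_right_mono) auto
  define C where "C = (\<Sum>l\<in>F. \<bar>c l\<bar>)"
  have C0: "0 \<le> C" by (auto simp: C_def intro: sum_nonneg)
  have "(\<lambda>n. C ^ 3 * (tree_exp p (N n) (\<lambda>r. cube_sum r (N n)) / real n powr (3 / 2))) \<longlonglongrightarrow> 0"
    unfolding N_def by (intro tendsto_mult_right_zero cube_sum_floor_tendsto p_bounds T)
  note lim = this
  show ?thesis
  proof (rule tendsto_sandwich[OF _ _ tendsto_const lim])
    show "\<forall>\<^sub>F n in sequentially. 0 \<le> tree_exp p (N n) (\<lambda>r. \<Sum>j=1..N n. \<bar>\<Sum>l\<in>F. c l / sqrt (real n) * cluster r (a n l) j\<bar> ^ 3)"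
      using p01 by (intro always_eventually allI tree_exp_nonneg sum_nonneg) auto
    show "\<forall>\<^sub>F n in sequentially. tree_exp p (N n) (\<lambda>r. \<Sum>j=1..N n. \<bar>\<Sum>l\<in>F. c l / sqrt (real n) * cluster r (a n l) j\<bar> ^ 3)
       \<le> C ^ 3 * (tree_exp p (N n) (\<lambda>r. cube_sum r (N n)) / real n powr (3 / 2))"
      using eventually_gt_at_top[of 0]
    proof eventually_elim
      case (elim n)
      have "tree_exp p (N n) (\<lambda>r. \<Sum>j=1..N n. \<bar>\<Sum>l\<in>F. c l / sqrt (real n) * cluster r (a n l) j\<bar> ^ 3)
        \<le> tree_exp p (N n) (\<lambda>r. (C / sqrt (real n)) ^ 3 * cube_sum r (N n))"
      proof (rule tree_exp_mono[OF p01])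
        fix r
        have "\<bar>\<Sum>l\<in>F. c l / sqrt (real n) * cluster r (a n l) j\<bar> \<le> C / sqrt (real n) * cluster r (N n) j" for j
        proof -
          have "\<bar>\<Sum>l\<in>F. c l / sqrt (real n) * cluster r (a n l) j\<bar> \<le> (\<Sum>l\<in>F. \<bar>c l / sqrt (real n) * cluster r (a n l) j\<bar>)"
            by (rule sum_abs)
          also have "\<dots> \<le> (\<Sum>l\<in>F. \<bar>c l\<bar> / sqrt (real n) * cluster r (N n) j)"
          proof (rule sum_mono)
            fix l assume "l \<in> F"
            then show "\<bar>c l / sqrt (real n) * cluster r (a n l) j\<bar> \<le> \<bar>c l\<bar> / sqrt (real n) * cluster r (N n) j"
              using cluster_mono[OF aN, of l r n j] cluster_nonneg[of r "a n l" j]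
              by (simp add: abs_mult mult_left_mono divide_right_mono)
          qed
          also have "\<dots> = C / sqrt (real n) * cluster r (N n) j"
            by (simp add: C_def sum_distrib_right sum_divide_distrib)
          finally show ?thesis .
        qed
        then have "(\<Sum>j=1..N n. \<bar>\<Sum>l\<in>F. c l / sqrt (real n) * cluster r (a n l) j\<bar> ^ 3) \<le>
            (\<Sum>j=1..N n. (C / sqrt (real n) * cluster r (N n) j) ^ 3)"
          by (intro sum_mono power_mono) auto
        then show "(\<Sum>j=1..N n. \<bar>\<Sum>l\<in>F. c l / sqrt (real n) * cluster r (a n l) j\<bar> ^ 3) \<le>
            (C / sqrt (real n)) ^ 3 * cube_sum r (N n)"
          by (simp only: cube_sum_def sum_distrib_left power_mult_distrib)
      qed
      also have "\<dots> = (C / sqrt (real n)) ^ 3 * tree_exp p (N n) (\<lambda>r. cube_sum r (N n))"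
        by (rule tree_exp_mult_left)
      also have "(C / sqrt (real n)) ^ 3 = C ^ 3 / real n powr (3 / 2)"
        using elim by (simp add: power_divide powr_half_sqrt[symmetric] powr_power)
      finally show ?case by simp
    qed
  qed
qed

lemma cos_W_tendsto:
  fixes t c :: "nat \<Rightarrow> real"
  assumes F: "finite F" and t: "\<And>l. l \<in> F \<Longrightarrow> 0 \<le> t l"
  defines "v \<equiv> \<Sum>l\<in>F. \<Sum>m\<in>F. c l * c m * limit_cov p (t l) (t m)"
  assumes v: "0 \<le> v"
  shows "(\<lambda>n. expectation (\<lambda>\<omega>. cos (b + (\<Sum>l\<in>F. c l / sqrt (real n) * W (nat \<lfloor>t l * real n\<rfloor>) \<omega>))))
     \<longlonglongrightarrow> cos b * exp (- v / 2)"
proof -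
  have p01: "0 \<le> p" "p \<le> 1" using p by auto
  \<comment> \<open>The sum is a convenient upper bound for all times, valid also for empty
    \<open>F\<close>.\<close>
  define T where "T = (\<Sum>l\<in>F. t l)"
  have T: "0 \<le> T" "\<And>l. l \<in> F \<Longrightarrow> t l \<le> T"
    unfolding T_def using t F by (auto intro: sum_nonneg member_le_sum)
  define N where "N n = nat \<lfloor>T * real n\<rfloor>" for n
  define a where "a n l = nat \<lfloor>t l * real n\<rfloor>" for n l
  define w where "w n r j = (\<Sum>l\<in>F. c l / sqrt (real n) * cluster r (a n l) j)" for n r j
  define A where "A n = tree_exp p (N n) (\<lambda>r. \<bar>(\<Sum>j=1..N n. (w n r j)\<^sup>2) - v\<bar>)" for n
  define B where "B n = tree_exp p (N n) (\<lambda>r. \<Sum>j=1..N n. \<bar>w n r j\<bar> ^ 3)" for n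
  have A: "A \<longlonglongrightarrow> 0"
    unfolding A_def w_def v_def N_def a_def by (rule weight_squares_tendsto) (use F t T in auto)
  have B: "B \<longlonglongrightarrow> 0"
    unfolding B_def w_def N_def a_def by (rule weight_cubes_tendsto) (use F T in auto)
  have aN: "a n l \<le> N n" if "l \<in> F" for n l
    unfolding a_def N_def using T(2)[OF that] by (intro nat_mono floor_mono mult_right_mono) auto
  show ?thesis unfolding a_def[symmetric]
  proof (rule tendstoI)
    fix e :: real assume e: "0 < e"
    \<comment> \<open>The sum of squared weights tends to \<open>v\<close> in mean, so the first
      error term has limit \<open>\<delta> * v\<close>, below \<open>e\<close>; the denominator
      \<open>v + 1\<close> covers \<open>v = 0\<close>. The constant \<open>K\<close> may depend on
      \<delta>, since its factor tends to \<open>0\<close>.\<close>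
    define \<delta> where "\<delta> = e / (v + 1)"
    have \<delta>: "0 < \<delta>" using e v by (simp add: \<delta>_def)
    have \<delta>v: "\<delta> * (v + 0) < e"
      using e v by (simp add: \<delta>_def pos_divide_less_eq)
    obtain K where K: "0 \<le> K" "\<And>t. cmod (char \<mu> t - of_real (exp (- t\<^sup>2 / 2))) \<le> \<delta> * t\<^sup>2 + K * \<bar>t\<bar> ^ 3"
      using char_X_near_gaussian[OF \<delta>] by blast
    have "(\<lambda>n. \<delta> * (v + A n) + K * B n + 1 / 2 * A n) \<longlonglongrightarrow> \<delta> * (v + 0) + K * 0 + 1 / 2 * 0"
      by (intro tendsto_intros A B)
    then have "\<forall>\<^sub>F n in sequentially. \<delta> * (v + A n) + K * B n + 1 / 2 * A n < e"
      using \<delta>v by (intro order_tendstoD(2)[where y = "\<delta> * (v + 0) + K * 0 + 1 / 2 * 0"]) auto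
    then show "\<forall>\<^sub>F n in sequentially. dist (expectation (\<lambda>\<omega>. cos (b + (\<Sum>l\<in>F. c l / sqrt (real n) * W (a n l) \<omega>))))
       (cos b * exp (- v / 2)) < e"
    proof eventually_elim
      case (elim n)
      have "tree_exp p (N n) (\<lambda>r. \<Sum>j=1..N n. (w n r j)\<^sup>2) \<le> tree_exp p (N n) (\<lambda>r. v + \<bar>(\<Sum>j=1..N n. (w n r j)\<^sup>2) - v\<bar>)"
        by (rule tree_exp_mono[OF p01]) linarith
      also have "\<dots> = v + A n" unfolding A_def by (simp only: tree_exp_add tree_exp_const)
      finally have "\<delta> * tree_exp p (N n) (\<lambda>r. \<Sum>j=1..N n. (w n r j)\<^sup>2) \<le> \<delta> * (v + A n)"
        using \<delta> by (intro mult_left_mono) auto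
      moreover have "\<bar>expectation (\<lambda>\<omega>. cos (b + (\<Sum>l\<in>F. c l / sqrt (real n) * W (a n l) \<omega>))) - cos b * exp (- v / 2)\<bar>
         \<le> \<delta> * tree_exp p (N n) (\<lambda>r. \<Sum>j=1..N n. (w n r j)\<^sup>2) + K * B n + 1 / 2 * A n"
        unfolding A_def B_def w_def by (rule cos_W_near_gaussian[OF K(2) v aN])
      ultimately show ?case
        using elim unfolding dist_real_def by linarith
    qed
  qed
qed

section \<open>The martingale and its maximal inequality\<close>

definition Xhat :: "nat \<Rightarrow> 'a \<Rightarrow> real" where
  "Xhat i \<omega> = reinforced (\<lambda>j. X j \<omega>) (\<lambda>j. \<epsilon> j \<omega>) (\<lambda>j. U j \<omega>) i"

lemma Xhat_eq: "i \<in> {1..n} \<Longrightarrow> Xhat i \<omega> = X (\<tau> n \<omega> i) \<omega>"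
  by (simp add: Xhat_def reinforced_root_step \<tau>_def step_tree_apply)

lemma W_eq_sum_Xhat: "W m \<omega> = (\<Sum>i=1..m. Xhat i \<omega>)"
  by (simp add: W_def Xhat_def)

text \<open>Along a tree in \<open>trees n\<close> the first \<open>n\<close> steps of the walk are
  functions of \<open>X 1, ..., X n\<close>, of which \<open>X (Suc n)\<close> is
  independent.\<close>

lemma expectation_next_X:
  assumes r: "r \<in> trees n" and g: "g \<in> borel_measurable (PiM {1..n} (\<lambda>_. borel))" "\<And>x. \<bar>g x\<bar> \<le> (1::real)"
  shows "expectation (\<lambda>\<omega>. X (Suc n) \<omega> * g (\<lambda>i\<in>{1..n}. X (r i) \<omega>)) = 0"
proof -
  define h where "h x = g (\<lambda>i\<in>{1..n}. x (r i))" for x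
  have "(\<lambda>x. \<lambda>i\<in>{1..n}. x (r i)) \<in> measurable (PiM {1..n} (\<lambda>_. borel)) (PiM {1..n} (\<lambda>_. borel :: real measure))"
    using trees_pos[OF r] by (intro measurable_restrict measurable_component_singleton) auto
  from measurable_compose[OF this g(1)] have h: "h \<in> borel_measurable (PiM {1..n} (\<lambda>_. borel))"
    unfolding h_def .
  have "indep_var (PiM {Suc n} (\<lambda>_. borel)) (\<lambda>\<omega>. \<lambda>i\<in>{Suc n}. X i \<omega>) (PiM {1..n} (\<lambda>_. borel)) (\<lambda>\<omega>. \<lambda>i\<in>{1..n}. X i \<omega>)"
    by (rule indep_var_restrict[OF indep_X]) auto
  then have "indep_var borel ((\<lambda>x. x (Suc n)) \<circ> (\<lambda>\<omega>. \<lambda>i\<in>{Suc n}. X i \<omega>)) borel (h \<circ> (\<lambda>\<omega>. \<lambda>i\<in>{1..n}. X i \<omega>))"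
    by (rule indep_var_compose) (use h in auto)
  moreover have "(\<lambda>x. x (Suc n)) \<circ> (\<lambda>\<omega>. \<lambda>i\<in>{Suc n}. X i \<omega>) = X (Suc n)" by auto
  moreover have "h \<circ> (\<lambda>\<omega>. \<lambda>i\<in>{1..n}. X i \<omega>) = (\<lambda>\<omega>. g (\<lambda>i\<in>{1..n}. X (r i) \<omega>))"
    unfolding h_def comp_def using trees_pos[OF r] by (intro ext arg_cong[where f = g]) (auto simp: restrict_def)
  ultimately have ind: "indep_var borel (X (Suc n)) borel (\<lambda>\<omega>. g (\<lambda>i\<in>{1..n}. X (r i) \<omega>))" by simp
  have "integrable M (\<lambda>\<omega>. g (\<lambda>i\<in>{1..n}. X (r i) \<omega>))"
    by (rule integrable_const_bound[of _ 1]) (use g indep_var_rv2[OF ind] in auto)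
  from indep_var_lebesgue_integral[OF ind integrable_X this] show ?thesis by (simp add: mean_X)
qed

text \<open>A new step has conditional mean zero, and a copied one the mean \<open>W n / n\<close>
  of a uniformly chosen earlier step; hence the factor \<open>1 + p / n\<close>. Bounded test
  functions of the steps of the walk express conditioning on its past.\<close>

lemma martingale_step:
  assumes g: "g \<in> borel_measurable (PiM {1..n} (\<lambda>_. borel))" "\<And>x. \<bar>g x\<bar> \<le> (1::real)"
  shows "expectation (\<lambda>\<omega>. (W (Suc n) \<omega> - (1 + p / real n) * W n \<omega>) * g (\<lambda>i\<in>{1..n}. Xhat i \<omega>)) = 0"
proof -
  define q where "q = p / real n"
  define G where "G r \<omega> = g (\<lambda>i\<in>{1..n}. X (r i) \<omega>)" for r \<omega>
  have G\<F>: "G r \<in> borel_measurable \<F>X" if r: "\<And>i. i \<in> {1..n} \<Longrightarrow> 1 \<le> r i" for r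
  proof -
    have "(\<lambda>\<omega>. \<lambda>i\<in>{1..n}. X (r i) \<omega>) \<in> measurable \<F>X (PiM {1..n} (\<lambda>_. borel))"
      using r by (intro measurable_restrict X_measurable_\<F>X) auto
    from measurable_compose[OF this g(1)] show ?thesis unfolding G_def .
  qed
  have GM: "G r \<in> borel_measurable M" if "\<And>i. i \<in> {1..n} \<Longrightarrow> 1 \<le> r i" for r
    by (rule measurable_from_subalg[OF subalgebra_X G\<F>[OF that]])
  have intG: "integrable M (\<lambda>\<omega>. f \<omega> * G r \<omega>)" if "integrable M f" "\<And>i. i \<in> {1..n} \<Longrightarrow> 1 \<le> r i" for f r
  proof (rule Bochner_Integration.integrable_bound[OF that(1)])
    show "(\<lambda>\<omega>. f \<omega> * G r \<omega>) \<in> borel_measurable M" using GM[OF that(2)] that(1) by simp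
    show "AE \<omega> in M. norm (f \<omega> * G r \<omega>) \<le> norm (f \<omega>)"
      using g(2) by (intro AE_I2) (simp add: abs_mult G_def mult_left_le)
  qed
  define \<Phi> where "\<Phi> r \<omega> = (walk X r (Suc n) \<omega> - (1 + q) * walk X r n \<omega>) * G r \<omega>" for r \<omega>
  have iw: "integrable M (walk X r m)" if "r \<in> trees k" "m \<le> k" for r m k
    by (rule square_integrable_imp_integrable[OF walk_measurable[OF that] walk_square_integrable[OF that]])
  have pos: "1 \<le> r i" if "r \<in> trees k" "n \<le> k" "i \<in> {1..n}" for r k i
    using trees_pos[OF that(1), of i] that by auto
  have "expectation (\<lambda>\<omega>. (W (Suc n) \<omega> - (1 + p / real n) * W n \<omega>) * g (\<lambda>i\<in>{1..n}. Xhat i \<omega>))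
      = expectation (\<lambda>\<omega>. \<Phi> (\<tau> (Suc n) \<omega>) \<omega>)"
  proof (intro Bochner_Integration.integral_cong refl)
    fix \<omega>
    have "(\<lambda>i\<in>{1..n}. Xhat i \<omega>) = (\<lambda>i\<in>{1..n}. X (\<tau> (Suc n) \<omega> i) \<omega>)"
      by (intro restrict_ext Xhat_eq) auto
    then show "(W (Suc n) \<omega> - (1 + p / real n) * W n \<omega>) * g (\<lambda>i\<in>{1..n}. Xhat i \<omega>) = \<Phi> (\<tau> (Suc n) \<omega>) \<omega>"
      by (simp add: \<Phi>_def G_def q_def W_eq_walk[of "Suc n" "Suc n"] W_eq_walk[of n "Suc n"])
  qed
  also have "\<dots> = tree_exp p (Suc n) (\<lambda>r. expectation (\<Phi> r))"
  proof (rule expectation_tree(2))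
    fix r assume r: "r \<in> trees (Suc n)"
    show "\<Phi> r \<in> borel_measurable \<F>X"
      unfolding \<Phi>_def using walk_measurable_\<F>X[OF r, of "Suc n"] walk_measurable_\<F>X[OF r, of n] G\<F>[of r] pos[OF r]
      by (intro borel_measurable_times borel_measurable_diff borel_measurable_const) auto
    show "integrable M (\<Phi> r)"
      unfolding \<Phi>_def using iw[OF r] pos[OF r]
      by (intro intG Bochner_Integration.integrable_diff integrable_mult_right) auto
  qed
  also have "\<dots> = tree_exp p n (\<lambda>_. 0)"
    unfolding tree_exp.simps q_def[symmetric]
  proof (rule tree_exp_cong)
    fix r assume r: "r \<in> trees n"
    note pr = pos[OF r order_refl]
    define D where "D = expectation (\<lambda>\<omega>. walk X r n \<omega> * G r \<omega>)"
    have upd: "expectation (\<Phi> (r(Suc n := k))) = expectation (\<lambda>\<omega>. X k \<omega> * G r \<omega>) - q * D" if k: "1 \<le> k" for k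
    proof -
      have "G (r(Suc n := k)) = G r" unfolding G_def
        by (intro ext arg_cong[where f = g] restrict_ext) auto
      then have "\<Phi> (r(Suc n := k)) = (\<lambda>\<omega>. X k \<omega> * G r \<omega> - q * (walk X r n \<omega> * G r \<omega>))"
        unfolding \<Phi>_def by (auto simp: walk_Suc algebra_simps)
      then show ?thesis
        unfolding D_def using intG[OF integrable_X[OF k] pr] intG[OF iw[OF r order_refl] pr] by simp
    qed
    have new: "expectation (\<Phi> (r(Suc n := Suc n))) = - q * D"
      using upd[of "Suc n"] expectation_next_X[OF r g] by (simp add: G_def)
    have copy: "(\<Sum>u=1..n. expectation (\<Phi> (r(Suc n := r u)))) = D - real n * q * D"
    proof -
      have "(\<Sum>u=1..n. expectation (\<Phi> (r(Suc n := r u)))) = (\<Sum>u=1..n. expectation (\<lambda>\<omega>. X (r u) \<omega> * G r \<omega>) - q * D)"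
        by (intro sum.cong refl upd pr)
      moreover have "D = (\<Sum>u=1..n. expectation (\<lambda>\<omega>. X (r u) \<omega> * G r \<omega>))"
        unfolding D_def walk_def sum_distrib_right
        by (intro Bochner_Integration.integral_sum intG integrable_X pr)
      ultimately show ?thesis by (simp add: sum_subtractf)
    qed
    show "(1 - real n * q) * expectation (\<Phi> (r(Suc n := Suc n))) +
        q * (\<Sum>u=1..n. expectation (\<Phi> (r(Suc n := r u)))) = 0"
      unfolding new copy by (simp add: algebra_simps)
  qed
  finally show ?thesis by simp
qed

definition Mart :: "nat \<Rightarrow> 'a \<Rightarrow> real" where
  "Mart m \<omega> = W m \<omega> / growth p m"

lemma Mart_measurable [measurable]: "Mart m \<in> borel_measurable M"
  unfolding Mart_def by measurable

lemma Mart_square_integrable: "integrable M (\<lambda>\<omega>. (Mart m \<omega>)\<^sup>2)"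
  using W_square_integrable by (simp add: Mart_def power_divide)

lemma Mart_integrable: "integrable M (Mart m)"
  by (rule square_integrable_imp_integrable[OF Mart_measurable Mart_square_integrable])

lemma Xhat_restrict_measurable:
  "(\<lambda>\<omega>. \<lambda>i\<in>{1..n}. Xhat i \<omega>) \<in> measurable M (PiM {1..n} (\<lambda>_. borel))"
proof (rule measurable_restrict)
  fix i assume "i \<in> {1..n}"
  then obtain j where j: "i = Suc j" by (cases i) auto
  have "Xhat i = (\<lambda>\<omega>. W i \<omega> - W j \<omega>)" by (auto simp: W_eq_sum_Xhat j)
  then show "Xhat i \<in> borel_measurable M" by simp
qed

text \<open>A function of the first \<open>j\<close> steps is also a function of the first
  \<open>m\<close> steps, so every later increment is orthogonal to it.\<close>

lemma martingale_orthogonal: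
  assumes g: "g \<in> borel_measurable (PiM {1..j} (\<lambda>_. borel))" "\<And>x. \<bar>g x\<bar> \<le> (1::real)"
  shows "j \<le> m \<Longrightarrow> expectation (\<lambda>\<omega>. (Mart m \<omega> - Mart j \<omega>) * g (\<lambda>i\<in>{1..j}. Xhat i \<omega>)) = 0"
proof (induction m rule: dec_induct)
  case (step m)
  define G where "G \<omega> = g (\<lambda>i\<in>{1..j}. Xhat i \<omega>)" for \<omega>
  have Gm: "G \<in> borel_measurable M"
    unfolding G_def by (rule measurable_compose[OF Xhat_restrict_measurable g(1)])
  have intG: "integrable M (\<lambda>\<omega>. f \<omega> * G \<omega>)" if "integrable M f" for f
  proof (rule Bochner_Integration.integrable_bound[OF that])
    show "(\<lambda>\<omega>. f \<omega> * G \<omega>) \<in> borel_measurable M" using Gm that by simp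
    show "AE \<omega> in M. norm (f \<omega> * G \<omega>) \<le> norm (f \<omega>)"
      using g(2) by (intro AE_I2) (simp add: abs_mult G_def mult_left_le)
  qed
  define g' where "g' x = g (restrict x {1..j})" for x
  have "g' \<in> borel_measurable (PiM {1..m} (\<lambda>_. borel))"
    unfolding g'_def
    by (rule measurable_compose[OF measurable_restrict_subset g(1)]) (use step in auto)
  from martingale_step[OF this]
  have "expectation (\<lambda>\<omega>. (W (Suc m) \<omega> - (1 + p / real m) * W m \<omega>) * g' (\<lambda>i\<in>{1..m}. Xhat i \<omega>)) = 0"
    using g(2) by (simp add: g'_def)
  moreover have "g' (\<lambda>i\<in>{1..m}. Xhat i \<omega>) = G \<omega>" for \<omega>
    unfolding g'_def G_def using step by (intro arg_cong[where f = g]) (auto simp: restrict_def)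
  ultimately have 0: "expectation (\<lambda>\<omega>. (W (Suc m) \<omega> - (1 + p / real m) * W m \<omega>) * G \<omega>) = 0" by simp
  have eq: "(Mart (Suc m) \<omega> - Mart j \<omega>) * G \<omega> = (Mart m \<omega> - Mart j \<omega>) * G \<omega> +
      1 / growth p (Suc m) * ((W (Suc m) \<omega> - (1 + p / real m) * W m \<omega>) * G \<omega>)" for \<omega>
  proof -
    have "Mart (Suc m) \<omega> - Mart m \<omega> = 1 / growth p (Suc m) * (W (Suc m) \<omega> - (1 + p / real m) * W m \<omega>)"
    proof -
      have "1 + p / real m \<noteq> 0" using p by (intro less_imp_neq[symmetric] add_pos_nonneg) auto
      then have "Mart m \<omega> = (1 + p / real m) * W m \<omega> / growth p (Suc m)"
        unfolding Mart_def growth_Suc by simp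
      then show ?thesis unfolding Mart_def[of "Suc m"] by (simp add: diff_divide_distrib)
    qed
    then have "Mart (Suc m) \<omega> - Mart j \<omega> = (Mart m \<omega> - Mart j \<omega>) +
       1 / growth p (Suc m) * (W (Suc m) \<omega> - (1 + p / real m) * W m \<omega>)" by linarith
    then show ?thesis by (simp only: distrib_right mult.assoc)
  qed
  have iW: "integrable M (W k)" for k
    by (rule square_integrable_imp_integrable[OF W_measurable W_square_integrable])
  have "expectation (\<lambda>\<omega>. (Mart (Suc m) \<omega> - Mart j \<omega>) * G \<omega>) = expectation (\<lambda>\<omega>. (Mart m \<omega> - Mart j \<omega>) * G \<omega>) +
      1 / growth p (Suc m) * expectation (\<lambda>\<omega>. (W (Suc m) \<omega> - (1 + p / real m) * W m \<omega>) * G \<omega>)"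
    unfolding eq
    by (subst Bochner_Integration.integral_add)
      (auto intro!: integrable_mult_right intG Bochner_Integration.integrable_diff Mart_integrable iW)
  also have "expectation (\<lambda>\<omega>. (Mart m \<omega> - Mart j \<omega>) * G \<omega>) = 0"
    unfolding G_def by (rule step.IH)
  finally have "expectation (\<lambda>\<omega>. (Mart (Suc m) \<omega> - Mart j \<omega>) * G \<omega>) = 0" unfolding 0 by simp
  then show ?case unfolding G_def .
qed simp

text \<open>Doob's argument at the first passage of \<open>2 h\<close>: the excess above \<open>h\<close> has to be paid by the
  tail of the final increment.\<close>

lemma martingale_maximal:
  assumes ab: "a \<le> b" and h: "0 < h"
  shows "h\<^sup>2 * prob {\<omega> \<in> space M. \<exists>j\<in>{a..b}. 2 * h \<le> \<bar>Mart j \<omega> - Mart a \<omega>\<bar>} \<le>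
    expectation (\<lambda>\<omega>. (Mart b \<omega> - Mart a \<omega>)\<^sup>2 * of_bool (h \<le> \<bar>Mart b \<omega> - Mart a \<omega>\<bar>))"
proof -
  define Y where "Y i \<omega> = Mart i \<omega> - Mart a \<omega>" for i \<omega>
  have Ym[measurable]: "Y i \<in> borel_measurable M" for i unfolding Y_def by measurable
  have Yi: "integrable M (Y i)" for i unfolding Y_def by (intro Bochner_Integration.integrable_diff Mart_integrable)
  have Y2: "integrable M (\<lambda>\<omega>. (Y b \<omega>)\<^sup>2)"
    unfolding Y_def power2_diff
    by (intro Bochner_Integration.integrable_diff Bochner_Integration.integrable_add Mart_square_integrable)
      (simp add: mult.assoc, intro integrable_mult_right integrable_mult_of_squares Mart_measurable Mart_square_integrable)
  \<comment> \<open>The event that the first passage takes place at time \<open>j\<close>; for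
    \<open>j \<in> {a..b}\<close> these events partition \<open>V\<close>.\<close>
  define A where "A j = {\<omega> \<in> space M. (\<forall>i\<in>{a..<j}. \<bar>Y i \<omega>\<bar> < 2 * h) \<and> 2 * h \<le> \<bar>Y j \<omega>\<bar>}" for j
  have Am[measurable]: "A j \<in> events" for j unfolding A_def by measurable
  define V where "V = {\<omega> \<in> space M. \<exists>j\<in>{a..b}. 2 * h \<le> \<bar>Y j \<omega>\<bar>}"
  have Vm[measurable]: "V \<in> events" unfolding V_def by measurable
  have ind: "indicator V \<omega> = (\<Sum>j\<in>{a..b}. indicator (A j) \<omega> :: real)" if "\<omega> \<in> space M" for \<omega>
  proof (cases "\<omega> \<in> V")
    case True
    define j where "j = (LEAST j. j \<in> {a..b} \<and> 2 * h \<le> \<bar>Y j \<omega>\<bar>)"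
    have ex: "\<exists>j. j \<in> {a..b} \<and> 2 * h \<le> \<bar>Y j \<omega>\<bar>" using True by (auto simp: V_def)
    have j: "j \<in> {a..b}" "2 * h \<le> \<bar>Y j \<omega>\<bar>" using LeastI_ex[OF ex] unfolding j_def by auto
    have least: "\<not> (2 * h \<le> \<bar>Y i \<omega>\<bar>)" if "i < j" "a \<le> i" for i
      using not_less_Least[of i "\<lambda>j. j \<in> {a..b} \<and> 2 * h \<le> \<bar>Y j \<omega>\<bar>"] that j(1) unfolding j_def[symmetric] by auto
    have "\<omega> \<in> A j" using least j that by (auto simp: A_def not_le)
    moreover have "\<omega> \<notin> A i" if "i \<in> {a..b} - {j}" for i
    proof
      assume i: "\<omega> \<in> A i"
      have "i < j \<or> j < i" using that by auto
      then show False
      proof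
        assume "i < j"
        then show False using least[of i] i that by (auto simp: A_def)
      next
        assume "j < i"
        then have "\<bar>Y j \<omega>\<bar> < 2 * h" using i j(1) by (auto simp: A_def)
        then show False using j(2) by simp
      qed
    qed
    ultimately show ?thesis using True j(1) by (subst sum.remove[of _ j]) (auto intro!: sum.neutral)
  next
    case False
    then have "\<omega> \<notin> A j" if "j \<in> {a..b}" for j using that by (auto simp: A_def V_def)
    then show ?thesis using False by (auto intro!: sum.neutral[symmetric])
  qed
  have first: "2 * h * prob (A j) \<le> expectation (\<lambda>\<omega>. \<bar>Y b \<omega>\<bar> * indicator (A j) \<omega>)" if j: "j \<in> {a..b}" for j
  proof -
    \<comment> \<open>Increments of the martingale written as functions of the steps of the walk,
      the form that test functions must have.\<close>
    define y where "y i x = (\<Sum>l=1..i. x l) / growth p i - (\<Sum>l=1..a. x l) / growth p a" for i and x :: "nat \<Rightarrow> real"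
    \<comment> \<open>With the sign as a factor, \<open>Y j * g\<close> is the absolute value on
      \<open>A j\<close>. Orthogonality then replaces \<open>Y j\<close> by \<open>Y b\<close>,
      which does the work of the submartingale property of the absolute value.\<close>
    define g where "g x = sgn (y j x) * of_bool ((\<forall>i\<in>{a..<j}. \<bar>y i x\<bar> < 2 * h) \<and> 2 * h \<le> \<bar>y j x\<bar>)" for x
    have ym: "y i \<in> borel_measurable (PiM {1..j} (\<lambda>_. borel))" if "i \<le> j" for i
      unfolding y_def using j that
      by (intro borel_measurable_diff borel_measurable_divide borel_measurable_sum measurable_component_singleton borel_measurable_const) auto
    have gm: "g \<in> borel_measurable (PiM {1..j} (\<lambda>_. borel))"
    proof -
      have [measurable]: "y i \<in> borel_measurable (PiM {1..j} (\<lambda>_. borel))" if "i \<in> {a..<j}" for i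
        using ym that by simp
      have [measurable]: "y j \<in> borel_measurable (PiM {1..j} (\<lambda>_. borel))" using ym by simp
      show ?thesis unfolding g_def by measurable
    qed
    have yY: "y i (\<lambda>l\<in>{1..j}. Xhat l \<omega>) = Y i \<omega>" if "i \<le> j" for i \<omega>
    proof -
      have "(\<Sum>l=1..k. (\<lambda>l\<in>{1..j}. Xhat l \<omega>) l) = W k \<omega>" if "k \<le> j" for k
        unfolding W_eq_sum_Xhat using that by (intro sum.cong) auto
      then show ?thesis unfolding y_def Y_def Mart_def using that j by simp
    qed
    have gY: "g (\<lambda>l\<in>{1..j}. Xhat l \<omega>) = sgn (Y j \<omega>) * indicator (A j) \<omega>" if "\<omega> \<in> space M" for \<omega>
    proof -
      have "(\<forall>i\<in>{a..<j}. \<bar>y i (\<lambda>l\<in>{1..j}. Xhat l \<omega>)\<bar> < 2 * h) \<longleftrightarrow> (\<forall>i\<in>{a..<j}. \<bar>Y i \<omega>\<bar> < 2 * h)"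
        using yY by (intro ball_cong refl) (simp only: atLeastLessThan_iff less_imp_le)
      then show ?thesis
        unfolding g_def yY[OF order_refl] using that by (simp add: A_def indicator_def)
    qed
    have orth: "expectation (\<lambda>\<omega>. (Mart b \<omega> - Mart j \<omega>) * g (\<lambda>l\<in>{1..j}. Xhat l \<omega>)) = 0"
      by (rule martingale_orthogonal[OF gm]) (use j in \<open>auto simp: g_def sgn_if\<close>)
    have bnd: "integrable M (\<lambda>\<omega>. Y i \<omega> * (sgn (Y j \<omega>) * indicator (A j) \<omega>))" for i
      by (rule Bochner_Integration.integrable_bound[OF Yi[of i]]) (auto simp: sgn_if indicator_def)
    have "2 * h * prob (A j) = expectation (\<lambda>\<omega>. 2 * h * indicator (A j) \<omega>)" by simp
    also have "\<dots> \<le> expectation (\<lambda>\<omega>. Y j \<omega> * (sgn (Y j \<omega>) * indicator (A j) \<omega>))"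
    proof (intro integral_mono bnd)
      show "integrable M (\<lambda>\<omega>. 2 * h * indicator (A j) \<omega>)"
        by (intro integrable_mult_right integrable_real_indicator) (auto simp: less_top[symmetric])
      show "2 * h * indicator (A j) \<omega> \<le> Y j \<omega> * (sgn (Y j \<omega>) * indicator (A j) \<omega>)" for \<omega>
        by (cases "\<omega> \<in> A j") (auto simp: A_def abs_sgn[symmetric])
    qed
    also have "\<dots> = expectation (\<lambda>\<omega>. Y b \<omega> * (sgn (Y j \<omega>) * indicator (A j) \<omega>))
       - expectation (\<lambda>\<omega>. (Mart b \<omega> - Mart j \<omega>) * g (\<lambda>l\<in>{1..j}. Xhat l \<omega>))"
    proof -
      have "expectation (\<lambda>\<omega>. (Mart b \<omega> - Mart j \<omega>) * g (\<lambda>l\<in>{1..j}. Xhat l \<omega>)) =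
          expectation (\<lambda>\<omega>. Y b \<omega> * (sgn (Y j \<omega>) * indicator (A j) \<omega>) - Y j \<omega> * (sgn (Y j \<omega>) * indicator (A j) \<omega>))"
      proof (intro Bochner_Integration.integral_cong refl)
        fix \<omega> assume \<omega>: "\<omega> \<in> space M"
        show "(Mart b \<omega> - Mart j \<omega>) * g (\<lambda>l\<in>{1..j}. Xhat l \<omega>) =
            Y b \<omega> * (sgn (Y j \<omega>) * indicator (A j) \<omega>) - Y j \<omega> * (sgn (Y j \<omega>) * indicator (A j) \<omega>)"
          unfolding gY[OF \<omega>] Y_def by (simp add: algebra_simps)
      qed
      then show ?thesis using bnd by simp
    qed
    also have "\<dots> \<le> expectation (\<lambda>\<omega>. \<bar>Y b \<omega>\<bar> * indicator (A j) \<omega>)"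
      unfolding orth diff_0_right
      by (intro integral_mono bnd Bochner_Integration.integrable_bound[OF Yi[of b]])
        (auto simp: sgn_if indicator_def)
    finally show ?thesis .
  qed
  have absI: "integrable M (\<lambda>\<omega>. \<bar>Y b \<omega>\<bar> * indicator B \<omega>)" if "B \<in> events" for B
    by (rule Bochner_Integration.integrable_bound[OF Yi[of b]]) (use that in \<open>auto simp: indicator_def\<close>)
  have tail: "integrable M (\<lambda>\<omega>. (Y b \<omega>)\<^sup>2 * of_bool (h \<le> \<bar>Y b \<omega>\<bar>))"
    by (rule Bochner_Integration.integrable_bound[OF Y2]) auto
  have "2 * h * prob V = expectation (\<lambda>\<omega>. 2 * h * indicator V \<omega>)" by simp
  also have "\<dots> = expectation (\<lambda>\<omega>. \<Sum>j\<in>{a..b}. 2 * h * indicator (A j) \<omega>)"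
    by (intro Bochner_Integration.integral_cong refl) (simp add: ind sum_distrib_left)
  also have "\<dots> = (\<Sum>j\<in>{a..b}. 2 * h * prob (A j))"
    by (subst Bochner_Integration.integral_sum) (auto simp: less_top[symmetric])
  also have "\<dots> \<le> (\<Sum>j\<in>{a..b}. expectation (\<lambda>\<omega>. \<bar>Y b \<omega>\<bar> * indicator (A j) \<omega>))" by (intro sum_mono first)
  also have "\<dots> = expectation (\<lambda>\<omega>. \<Sum>j\<in>{a..b}. \<bar>Y b \<omega>\<bar> * indicator (A j) \<omega>)"
    by (subst Bochner_Integration.integral_sum) (auto intro: absI)
  also have "\<dots> = expectation (\<lambda>\<omega>. \<bar>Y b \<omega>\<bar> * indicator V \<omega>)"
    by (intro Bochner_Integration.integral_cong refl) (simp add: ind sum_distrib_left)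
  \<comment> \<open>The absolute value is split at \<open>h\<close>: the part below \<open>h\<close>
    is paid by half of the left hand side \<open>2 * h * prob V\<close>, the part above is at most
    the square over \<open>h\<close>.\<close>
  also have "\<dots> \<le> expectation (\<lambda>\<omega>. h * indicator V \<omega> + (Y b \<omega>)\<^sup>2 * of_bool (h \<le> \<bar>Y b \<omega>\<bar>) / h)"
  proof (intro integral_mono absI)
    fix \<omega>
    have "\<bar>Y b \<omega>\<bar> \<le> (Y b \<omega>)\<^sup>2 / h" if "h \<le> \<bar>Y b \<omega>\<bar>"
      using mult_right_mono[OF that abs_ge_zero[of "Y b \<omega>"]] h
      by (simp add: pos_le_divide_eq power2_eq_square mult.commute)
    then show "\<bar>Y b \<omega>\<bar> * indicator V \<omega> \<le> h * indicator V \<omega> + (Y b \<omega>)\<^sup>2 * of_bool (h \<le> \<bar>Y b \<omega>\<bar>) / h"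
      using h by (cases "h \<le> \<bar>Y b \<omega>\<bar>") (auto simp: indicator_def add_increasing)
  qed (use tail in \<open>auto simp: less_top[symmetric]\<close>)
  also have "\<dots> = h * prob V + expectation (\<lambda>\<omega>. (Y b \<omega>)\<^sup>2 * of_bool (h \<le> \<bar>Y b \<omega>\<bar>)) / h"
    using tail by (subst Bochner_Integration.integral_add) (auto simp: less_top[symmetric])
  finally have "h * prob V \<le> expectation (\<lambda>\<omega>. (Y b \<omega>)\<^sup>2 * of_bool (h \<le> \<bar>Y b \<omega>\<bar>)) / h" by simp
  then have "h\<^sup>2 * prob V \<le> expectation (\<lambda>\<omega>. (Y b \<omega>)\<^sup>2 * of_bool (h \<le> \<bar>Y b \<omega>\<bar>))"
    using h by (simp add: pos_le_divide_eq power2_eq_square mult_ac)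
  then show ?thesis unfolding V_def Y_def .
qed

end


section \<open>Convergence on a time grid\<close>

text \<open>The normal case reduces to the standard normal distribution. A constant variable of mean
  zero vanishes almost surely and satisfies the same formulas with variance
  \<open>0\<close>.\<close>

lemma (in prob_space) centered_gaussian:
  assumes Z: "gaussian_variable M Z" and mean: "expectation Z = 0"
  shows "integrable M (\<lambda>\<omega>. (Z \<omega>)\<^sup>2)" and "integrable M (\<lambda>\<omega>. (Z \<omega>) ^ 4)"
    and "expectation (\<lambda>\<omega>. (Z \<omega>) ^ 4) = 3 * (expectation (\<lambda>\<omega>. (Z \<omega>)\<^sup>2))\<^sup>2"
    and "expectation (\<lambda>\<omega>. cos (b + Z \<omega>)) = cos b * exp (- expectation (\<lambda>\<omega>. (Z \<omega>)\<^sup>2) / 2)"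
proof -
  have Zm[measurable]: "Z \<in> borel_measurable M" using Z by (simp add: gaussian_variable_def)
  have "integrable M (\<lambda>\<omega>. (Z \<omega>)\<^sup>2) \<and> integrable M (\<lambda>\<omega>. (Z \<omega>) ^ 4) \<and>
    expectation (\<lambda>\<omega>. (Z \<omega>) ^ 4) = 3 * (expectation (\<lambda>\<omega>. (Z \<omega>)\<^sup>2))\<^sup>2 \<and>
    expectation (\<lambda>\<omega>. cos (b + Z \<omega>)) = cos b * exp (- expectation (\<lambda>\<omega>. (Z \<omega>)\<^sup>2) / 2)"
  proof (cases "\<exists>m \<sigma>. 0 < \<sigma> \<and> distributed M lborel Z (\<lambda>x. ennreal (normal_density m \<sigma> x))")
    case True
    then obtain m \<sigma> where \<sigma>: "0 < \<sigma>" and D: "distributed M lborel Z (normal_density m \<sigma>)" by auto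
    have "m = 0" using normal_distributed_expectation[OF \<sigma> D] mean by simp
    define V where "V \<omega> = Z \<omega> / \<sigma>" for \<omega>
    have Vm[measurable]: "V \<in> borel_measurable M" unfolding V_def by measurable
    have ZV: "Z \<omega> = \<sigma> * V \<omega>" for \<omega> using \<sigma> by (simp add: V_def)
    have "distributed M lborel V std_normal_density"
      using D normal_standard_normal_convert[OF \<sigma>, of Z m] \<open>m = 0\<close> by (simp add: V_def[abs_def])
    then have "distr M lborel V = std_normal_distribution"
      by (simp add: distributed_distr_eq_density)
    moreover have "distr M lborel V = distr M borel V" by (rule distr_cong) auto
    ultimately have dV: "distr M borel V = std_normal_distribution" by simp
    have V2: "integrable M (\<lambda>\<omega>. (V \<omega>)\<^sup>2)" "expectation (\<lambda>\<omega>. (V \<omega>)\<^sup>2) = 1"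
      using std_normal_distribution_even_moments[of 1] unfolding dV[symmetric]
      by (simp_all add: integrable_distr_eq integral_distr)
    have V4: "integrable M (\<lambda>\<omega>. (V \<omega>) ^ 4)" "expectation (\<lambda>\<omega>. (V \<omega>) ^ 4) = 3"
      using std_normal_distribution_even_moments[of 2] unfolding dV[symmetric]
      by (simp_all add: integrable_distr_eq integral_distr fact_numeral)
    have "char (distr M borel Z) 1 = char (distr M borel V) \<sigma>"
      unfolding char_def by (simp add: integral_distr ZV)
    then have "expectation (\<lambda>\<omega>. cos (b + Z \<omega>)) = cos b * exp (- \<sigma>\<^sup>2 / 2)"
      unfolding expectation_cos_char[OF Zm] dV char_std_normal_distribution by simp
    then show ?thesis unfolding ZV power_mult_distrib using V2 V4 by (simp add: power2_eq_square power4_eq_xxxx)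
  next
    case False
    then obtain c where c: "AE \<omega> in M. Z \<omega> = c" using Z unfolding gaussian_variable_def by blast
    have "expectation Z = expectation (\<lambda>_. c)" by (rule integral_cong_AE) (use c in auto)
    then have "c = 0" using mean by (simp add: prob_space)
    then have Z0: "AE \<omega> in M. Z \<omega> = 0" using c by simp
    have 2: "AE \<omega> in M. (Z \<omega>)\<^sup>2 = 0" "AE \<omega> in M. (Z \<omega>) ^ 4 = 0" "AE \<omega> in M. cos (b + Z \<omega>) = cos b"
      using Z0 by auto
    have "expectation (\<lambda>\<omega>. cos (b + Z \<omega>)) = expectation (\<lambda>_. cos b)"
      by (rule integral_cong_AE) (use 2 in auto)
    moreover have "integrable M (\<lambda>\<omega>. (Z \<omega>)\<^sup>2)" "integrable M (\<lambda>\<omega>. (Z \<omega>) ^ 4)"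
      using 2 by (auto intro!: integrableI_bounded simp: nn_integral_0_iff_AE[THEN iffD2])
    moreover have "expectation (\<lambda>\<omega>. (Z \<omega>)\<^sup>2) = 0" "expectation (\<lambda>\<omega>. (Z \<omega>) ^ 4) = 0"
      using 2 by (auto intro: integral_eq_zero_AE)
    ultimately show ?thesis by (simp add: prob_space)
  qed
  then show "integrable M (\<lambda>\<omega>. (Z \<omega>)\<^sup>2)" and "integrable M (\<lambda>\<omega>. (Z \<omega>) ^ 4)"
    and "expectation (\<lambda>\<omega>. (Z \<omega>) ^ 4) = 3 * (expectation (\<lambda>\<omega>. (Z \<omega>)\<^sup>2))\<^sup>2"
    and "expectation (\<lambda>\<omega>. cos (b + Z \<omega>)) = cos b * exp (- expectation (\<lambda>\<omega>. (Z \<omega>)\<^sup>2) / 2)" by auto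
qed

section \<open>Moments of the limit process\<close>

locale nrbm =
  fixes p :: real and N :: "'b measure" and B :: "real \<Rightarrow> 'b \<Rightarrow> real"
  assumes p_range: "0 < p" "p < 1 / 2" and nrbm: "noise_reinforced_brownian_motion p N B"

sublocale nrbm \<subseteq> prob_space N
  using nrbm by (simp add: noise_reinforced_brownian_motion_def)

context nrbm
begin

lemma B_continuous: "\<omega> \<in> space N \<Longrightarrow> continuous_on {0..} (\<lambda>t. B t \<omega>)"
  using nrbm by (simp add: noise_reinforced_brownian_motion_def)

lemma B_gaussian: "finite F \<Longrightarrow> F \<subseteq> {0..} \<Longrightarrow> gaussian_variable N (\<lambda>\<omega>. \<Sum>t\<in>F. c t * B t \<omega>)"
  using nrbm unfolding noise_reinforced_brownian_motion_def gaussian_process_def by blast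

lemma B_gaussian_single: "0 \<le> t \<Longrightarrow> gaussian_variable N (B t)"
  using B_gaussian[of "{t}" "\<lambda>_. 1"] by simp

lemma B_measurable: "0 \<le> t \<Longrightarrow> B t \<in> borel_measurable N"
  using B_gaussian_single[of t] by (simp add: gaussian_variable_def)

lemma B_mean: "0 \<le> t \<Longrightarrow> expectation (B t) = 0"
  using nrbm by (simp add: noise_reinforced_brownian_motion_def)

lemma B_square_integrable: "0 \<le> t \<Longrightarrow> integrable N (\<lambda>\<omega>. (B t \<omega>)\<^sup>2)"
  by (rule centered_gaussian(1)[OF B_gaussian_single B_mean])

lemma B_integrable: "0 \<le> t \<Longrightarrow> integrable N (B t)"
  by (rule square_integrable_imp_integrable[OF B_measurable B_square_integrable])

lemma B_cov: "0 \<le> s \<Longrightarrow> 0 \<le> t \<Longrightarrow> expectation (\<lambda>\<omega>. B s \<omega> * B t \<omega>) = limit_cov p s t"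
proof -
  have le: "expectation (\<lambda>\<omega>. B t \<omega> * B s \<omega>) = limit_cov p s t" if "0 \<le> s" "s \<le> t" for s t
    using nrbm that unfolding noise_reinforced_brownian_motion_def limit_cov_le[OF that(2)] by blast
  assume "0 \<le> s" "0 \<le> t"
  then show ?thesis
    using le[of s t] le[of t s] by (cases "s \<le> t") (simp_all add: mult.commute limit_cov_commute)
qed

text \<open>\<open>gaussian_process\<close> speaks of sums over sets of times; injectivity of
  \<open>t\<close> allows the coefficients to be carried over from the indices.\<close>

lemma B_combination:
  fixes t c :: "nat \<Rightarrow> real"
  assumes F: "finite F" and t: "\<And>l. l \<in> F \<Longrightarrow> 0 \<le> t l" "inj_on t F"
  shows "gaussian_variable N (\<lambda>\<omega>. \<Sum>l\<in>F. c l * B (t l) \<omega>)"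
    and "expectation (\<lambda>\<omega>. \<Sum>l\<in>F. c l * B (t l) \<omega>) = 0"
    and "expectation (\<lambda>\<omega>. (\<Sum>l\<in>F. c l * B (t l) \<omega>)\<^sup>2) = (\<Sum>l\<in>F. \<Sum>m\<in>F. c l * c m * limit_cov p (t l) (t m))"
proof -
  have "(\<Sum>s\<in>t ` F. c (the_inv_into F t s) * B s \<omega>) = (\<Sum>l\<in>F. c l * B (t l) \<omega>)" for \<omega>
    using t(2) by (subst sum.reindex) (auto simp: the_inv_into_f_f intro!: sum.cong)
  then show "gaussian_variable N (\<lambda>\<omega>. \<Sum>l\<in>F. c l * B (t l) \<omega>)"
    using B_gaussian[of "t ` F" "\<lambda>s. c (the_inv_into F t s)"] F t by auto
  show "expectation (\<lambda>\<omega>. \<Sum>l\<in>F. c l * B (t l) \<omega>) = 0"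
    using t by (subst Bochner_Integration.integral_sum) (auto simp: B_mean B_integrable)
  have i: "integrable N (\<lambda>\<omega>. B (t l) \<omega> * B (t m) \<omega>)" if "l \<in> F" "m \<in> F" for l m
    by (intro integrable_mult_of_squares B_measurable B_square_integrable t that)
  have "expectation (\<lambda>\<omega>. (\<Sum>l\<in>F. c l * B (t l) \<omega>)\<^sup>2) =
      expectation (\<lambda>\<omega>. \<Sum>l\<in>F. \<Sum>m\<in>F. c l * c m * (B (t l) \<omega> * B (t m) \<omega>))"
    unfolding power2_eq_square sum_product by (simp add: mult_ac)
  also have "\<dots> = (\<Sum>l\<in>F. \<Sum>m\<in>F. c l * c m * expectation (\<lambda>\<omega>. B (t l) \<omega> * B (t m) \<omega>))"
    using i by (subst Bochner_Integration.integral_sum) (auto intro!: sum.cong Bochner_Integration.integrable_sum)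
  also have "\<dots> = (\<Sum>l\<in>F. \<Sum>m\<in>F. c l * c m * limit_cov p (t l) (t m))"
    using t by (intro sum.cong refl) (simp add: B_cov)
  finally show "expectation (\<lambda>\<omega>. (\<Sum>l\<in>F. c l * B (t l) \<omega>)\<^sup>2) = (\<Sum>l\<in>F. \<Sum>m\<in>F. c l * c m * limit_cov p (t l) (t m))" .
qed

end

text \<open>Walk and limit live on unrelated probability spaces; only their laws are
  compared.\<close>

locale reinforcement_limit = standard_reinforcement M p \<mu> X \<epsilon> U + N: nrbm p N B
  for M :: "'a measure" and p \<mu> X \<epsilon> U and N :: "'b measure" and B
begin

definition grid :: "nat \<Rightarrow> nat \<Rightarrow> 'a \<Rightarrow> nat \<Rightarrow> real" where
  "grid k n \<omega> l = W (nat \<lfloor>real l / real k * real n\<rfloor>) \<omega> / sqrt (real n)"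

lemma grid_coordinate_measurable [measurable]: "(\<lambda>\<omega>. grid k n \<omega> l) \<in> borel_measurable M"
  unfolding grid_def by measurable

lemma grid_measurable: "grid k n \<in> borel_measurable M"
  by (rule measurable_coordinatewise_then_product) (rule grid_coordinate_measurable)

lemma B_grid_measurable: "(\<lambda>\<omega> l. B (real l / real k) \<omega>) \<in> borel_measurable N"
  by (rule measurable_coordinatewise_then_product) (simp add: N.B_measurable)

lemma W_second_moment: "expectation (\<lambda>\<omega>. (W m \<omega>)\<^sup>2) \<le> real m / (1 - 2 * p)"
  using expectation_W_W[of m m] mean_pairs_le[OF p_bounds, of m]
  by (simp add: mean_pairs_def power2_eq_square)

lemma grid_square_integrable: "integrable M (\<lambda>\<omega>. (grid k n \<omega> l)\<^sup>2)"
  using W_square_integrable by (simp add: grid_def power_divide)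

text \<open>Uniform in \<open>n\<close>, including \<open>n = 0\<close>, where division by
  \<open>sqrt 0\<close> gives \<open>0\<close>. This is the moment hypothesis of the criterion for
  weak convergence.\<close>

lemma grid_second_moment: "expectation (\<lambda>\<omega>. (grid k n \<omega> l)\<^sup>2) \<le> real l / real k / (1 - 2 * p)"
proof (cases "n = 0")
  case True
  then show ?thesis using p_bounds by (simp add: grid_def)
next
  case False
  let ?a = "nat \<lfloor>real l / real k * real n\<rfloor>"
  have "expectation (\<lambda>\<omega>. (grid k n \<omega> l)\<^sup>2) = expectation (\<lambda>\<omega>. (W ?a \<omega>)\<^sup>2) / real n"
    by (simp add: grid_def power_divide)
  also have "\<dots> \<le> real ?a / (1 - 2 * p) / real n" by (intro divide_right_mono W_second_moment) auto
  also have "\<dots> \<le> (real l / real k * real n) / (1 - 2 * p) / real n"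
    using p_bounds by (intro divide_right_mono) auto
  also have "\<dots> = real l / real k / (1 - 2 * p)" using False by simp
  finally show ?thesis .
qed

theorem grid_convergence:
  fixes g :: "(nat \<Rightarrow> real) \<Rightarrow> real"
  assumes k: "0 < k" and g: "continuous_on UNIV g" "\<And>x. \<bar>g x\<bar> \<le> C"
  shows "(\<lambda>n. expectation (\<lambda>\<omega>. g (grid k n \<omega>))) \<longlonglongrightarrow> N.expectation (\<lambda>\<omega>. g (\<lambda>l. B (real l / real k) \<omega>))"
proof -
  have lim: "(\<lambda>n. expectation (\<lambda>\<omega>. cos (b + (\<Sum>l\<in>F. c l * grid k n \<omega> l)))) \<longlonglongrightarrow>
      N.expectation (\<lambda>\<omega>. cos (b + (\<Sum>l\<in>F. c l * B (real l / real k) \<omega>)))"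
    if F: "finite F" for F :: "nat set" and b :: real and c :: "nat \<Rightarrow> real"
  proof -
  define v where "v = (\<Sum>l\<in>F. \<Sum>m\<in>F. c l * c m * limit_cov p (real l / real k) (real m / real k))"
  have inj: "inj_on (\<lambda>l. real l / real k) F" using k by (auto simp: inj_on_def)
  note B = N.B_combination[OF F _ inj, of c]
  have v: "N.expectation (\<lambda>\<omega>. (\<Sum>l\<in>F. c l * B (real l / real k) \<omega>)\<^sup>2) = v"
    unfolding v_def by (rule B(3)) simp
  \<comment> \<open>Positive semidefiniteness of the covariance comes from the existence of the
    process.\<close>
  have "0 \<le> v" unfolding v[symmetric] by (intro Bochner_Integration.integral_nonneg) simp
  have "(\<lambda>n. expectation (\<lambda>\<omega>. cos (b + (\<Sum>l\<in>F. c l / sqrt (real n) * W (nat \<lfloor>real l / real k * real n\<rfloor>) \<omega>))))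
     \<longlonglongrightarrow> cos b * exp (- v / 2)"
    unfolding v_def by (rule cos_W_tendsto) (use F \<open>0 \<le> v\<close> in \<open>auto simp: v_def\<close>)
  also have "cos b * exp (- v / 2) = N.expectation (\<lambda>\<omega>. cos (b + (\<Sum>l\<in>F. c l * B (real l / real k) \<omega>)))"
    unfolding v[symmetric] by (rule N.centered_gaussian(4)[symmetric, OF B(1,2)]) auto
  finally show ?thesis
    by (simp add: grid_def)
  qed
  show ?thesis
    by (rule weak_convergence_trig[where Z = "\<lambda>\<omega> l. B (real l / real k) \<omega>", OF prob_space_axioms N.prob_space_axioms
          grid_measurable B_grid_measurable grid_square_integrable grid_second_moment _ lim g])
      (simp_all add: N.B_square_integrable)
qed

end


section \<open>Oscillation between grid points\<close>

text \<open>The truncated square is the square of \<open>min |x| (sqrt \<eta>)\<close>, which is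
  1-Lipschitz and bounded by \<open>sqrt \<eta>\<close>. It serves to replace a coefficient
  depending on \<open>n\<close> by its limit.\<close>

lemma min_square_lipschitz:
  fixes x y \<eta> :: real
  assumes "0 \<le> \<eta>"
  shows "\<bar>min (x\<^sup>2) \<eta> - min (y\<^sup>2) \<eta>\<bar> \<le> 2 * sqrt \<eta> * \<bar>x - y\<bar>"
proof -
  define a where "a x = min \<bar>x\<bar> (sqrt \<eta>)" for x :: real
  have a: "0 \<le> a x" "a x \<le> sqrt \<eta>" for x using assms by (auto simp: a_def)
  have sq: "min (x\<^sup>2) \<eta> = (a x)\<^sup>2" for x
  proof (cases "\<bar>x\<bar> \<le> sqrt \<eta>")
    case True
    then have "x\<^sup>2 \<le> \<eta>" using power_mono[OF True, of 2] assms by simp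
    then show ?thesis using True by (simp add: a_def min_absorb1)
  next
    case False
    then have "\<eta> \<le> x\<^sup>2" using power_mono[of "sqrt \<eta>" "\<bar>x\<bar>" 2] assms by simp
    then show ?thesis using False assms by (simp add: a_def)
  qed
  have "\<bar>(a x)\<^sup>2 - (a y)\<^sup>2\<bar> = \<bar>a x + a y\<bar> * \<bar>a x - a y\<bar>"
    by (simp add: abs_mult[symmetric] power2_eq_square algebra_simps)
  also have "\<dots> \<le> (2 * sqrt \<eta>) * \<bar>x - y\<bar>"
  proof (intro mult_mono)
    show "\<bar>a x + a y\<bar> \<le> 2 * sqrt \<eta>" using a[of x] a[of y] by linarith
    show "\<bar>a x - a y\<bar> \<le> \<bar>x - y\<bar>" unfolding a_def by linarith
  qed (use assms in auto)
  finally show ?thesis by (simp add: sq)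
qed

text \<open>Truncating at \<open>c^2 / 2\<close> instead of \<open>c^2\<close> leaves at least half
  of the square on the tail, so the discontinuous tail is dominated by a continuous
  function.\<close>

lemma square_tail_le:
  fixes x c :: real
  assumes "0 \<le> c"
  shows "x\<^sup>2 * of_bool (c \<le> \<bar>x\<bar>) \<le> 2 * (x\<^sup>2 - min (x\<^sup>2) (c\<^sup>2 / 2))"
proof (cases "c \<le> \<bar>x\<bar>")
  case True
  then have "c\<^sup>2 \<le> x\<^sup>2" using power_mono[OF True assms, of 2] by simp
  then show ?thesis using True by simp
qed simp

lemma square_minus_min_le:
  fixes x \<eta> :: real
  assumes "0 < \<eta>"
  shows "x\<^sup>2 - min (x\<^sup>2) \<eta> \<le> x ^ 4 / \<eta>"
proof (cases "x\<^sup>2 \<le> \<eta>")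
  case False
  then have "\<eta> * x\<^sup>2 \<le> x\<^sup>2 * x\<^sup>2" by (intro mult_right_mono) auto
  then have "x\<^sup>2 \<le> x ^ 4 / \<eta>"
    using assms by (simp add: pos_le_divide_eq mult.commute flip: power_add)
  then show ?thesis using False assms by simp
qed (use assms in simp)

context reinforcement_limit
begin

lemma grid_0 [simp]: "grid k n \<omega> 0 = 0"
  by (simp add: grid_def W_def)

lemma grid_prod_integrable: "integrable M (\<lambda>\<omega>. grid k n \<omega> l * grid k n \<omega> m)"
  by (intro integrable_mult_of_squares grid_coordinate_measurable grid_square_integrable)

lemma grid_cov_tendsto:
  assumes "0 < k" "l \<le> m"
  shows "(\<lambda>n. expectation (\<lambda>\<omega>. grid k n \<omega> l * grid k n \<omega> m)) \<longlonglongrightarrow> limit_cov p (real l / real k) (real m / real k)"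
proof -
  define s t where "s = real l / real k" and "t = real m / real k"
  have st: "0 \<le> s" "s \<le> t" using assms by (auto simp: s_def t_def intro: divide_right_mono)
  define a b where "a n = nat \<lfloor>s * real n\<rfloor>" and "b n = nat \<lfloor>t * real n\<rfloor>" for n
  have ab: "a n \<le> b n" for n
    unfolding a_def b_def using st by (intro nat_mono floor_mono mult_right_mono) auto
  have E: "expectation (\<lambda>\<omega>. grid k n \<omega> l * grid k n \<omega> m) = tree_exp p (b n) (\<lambda>r. pairs r (a n) (b n) / real n)" for n
  proof -
    have "expectation (\<lambda>\<omega>. grid k n \<omega> l * grid k n \<omega> m) = expectation (\<lambda>\<omega>. W (a n) \<omega> * W (b n) \<omega>) / real n"
      by (simp add: grid_def a_def b_def s_def t_def)
    also have "\<dots> = 1 / real n * tree_exp p (b n) (\<lambda>r. pairs r (a n) (b n))"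
      by (simp add: expectation_W_W[OF ab])
    also have "\<dots> = tree_exp p (b n) (\<lambda>r. 1 / real n * pairs r (a n) (b n))"
      by (rule tree_exp_mult_left[symmetric])
    finally show ?thesis by simp
  qed
  have "(\<lambda>n. tree_exp p (b n) (\<lambda>r. pairs r (a n) (b n) / real n) - limit_cov p s t) \<longlonglongrightarrow> 0"
  proof (rule Lim_null_comparison)
    show "(\<lambda>n. tree_exp p (b n) (\<lambda>r. \<bar>pairs r (a n) (b n) / real n - limit_cov p s t\<bar>)) \<longlonglongrightarrow> 0"
      unfolding a_def b_def limit_cov_le[OF st(2)] by (rule pairs_floor_tendsto[OF p_bounds st])
    have "\<bar>tree_exp p (b n) (\<lambda>r. pairs r (a n) (b n) / real n) - limit_cov p s t\<bar> \<le>
        tree_exp p (b n) (\<lambda>r. \<bar>pairs r (a n) (b n) / real n - limit_cov p s t\<bar>)" for n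
      using tree_exp_abs[OF p, of "b n" "\<lambda>r. pairs r (a n) (b n) / real n - limit_cov p s t"]
      by (simp only: tree_exp_diff tree_exp_const)
    then show "\<forall>\<^sub>F n in sequentially. norm (tree_exp p (b n) (\<lambda>r. pairs r (a n) (b n) / real n) - limit_cov p s t)
        \<le> tree_exp p (b n) (\<lambda>r. \<bar>pairs r (a n) (b n) / real n - limit_cov p s t\<bar>)" by simp
  qed
  then show ?thesis unfolding E s_def[symmetric] t_def[symmetric] by (rule LIM_zero_cancel)
qed

definition osc :: "nat \<Rightarrow> nat \<Rightarrow> real \<Rightarrow> nat \<Rightarrow> 'a set" where
  "osc k n e i = {\<omega> \<in> space M. \<exists>j\<in>{nat \<lfloor>real i / real k * real n\<rfloor>..nat \<lfloor>real (Suc i) / real k * real n\<rfloor>}.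
     e * sqrt (real n) < \<bar>W j \<omega> - W (nat \<lfloor>real i / real k * real n\<rfloor>) \<omega>\<bar>}"

lemma osc_event [measurable]: "osc k n e i \<in> events"
  unfolding osc_def by measurable

definition ratio :: "nat \<Rightarrow> nat \<Rightarrow> nat \<Rightarrow> real" where
  "ratio k n i = growth p (nat \<lfloor>real (Suc i) / real k * real n\<rfloor>) / growth p (nat \<lfloor>real i / real k * real n\<rfloor>)"

text \<open>With \<open>A = growth p\<close>, the increment \<open>W j - W a\<close> is
  \<open>A j * (Mart j - Mart a) + (A j / A a - 1) * W a\<close>, and each part is allowed half of
  \<open>e * sqrt n\<close>. The maximal inequality at level \<open>2 * h\<close> treats the
  martingale part, Chebyshev's inequality the drift; \<open>G\<close> is the martingale increment in
  the scale of the grid, where \<open>h\<close> becomes \<open>e / 4\<close>.\<close>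

lemma prob_osc_le:
  fixes k n i :: nat
  assumes n: "0 < n" and e: "0 < e"
  defines "G \<equiv> \<lambda>\<omega>. grid k n \<omega> (Suc i) - ratio k n i * grid k n \<omega> i"
  shows "prob (osc k n e i) \<le> 16 / e\<^sup>2 * expectation (\<lambda>\<omega>. (G \<omega>)\<^sup>2 * of_bool (e / 4 \<le> \<bar>G \<omega>\<bar>))
     + 4 / e\<^sup>2 * ((ratio k n i - 1)\<^sup>2 * expectation (\<lambda>\<omega>. (grid k n \<omega> i)\<^sup>2))"
proof -
  define a where "a = nat \<lfloor>real i / real k * real n\<rfloor>"
  define b where "b = nat \<lfloor>real (Suc i) / real k * real n\<rfloor>"
  define A where "A = growth p"
  define q where "q = A b / A a"
  define h where "h = e * sqrt (real n) / (4 * A b)"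
  have ab: "a \<le> b" unfolding a_def b_def by (intro nat_mono floor_mono mult_right_mono divide_right_mono) auto
  have A: "0 < A j" for j unfolding A_def by (rule growth_pos[OF p(1)])
  have Amono: "i \<le> j \<Longrightarrow> A i \<le> A j" for i j unfolding A_def by (rule growth_mono[OF p(1)])
  have sn: "0 < sqrt (real n)" using n by simp
  have h: "0 < h" using e A[of b] sn by (simp add: h_def)
  have q1: "1 \<le> q" using A[of a] Amono[OF ab] by (simp add: q_def)
  have ratio: "ratio k n i = q" by (simp add: ratio_def q_def A_def a_def b_def)
  have G: "G \<omega> = A b / sqrt (real n) * (Mart b \<omega> - Mart a \<omega>)" for \<omega>
  proof -
    have "G \<omega> = W b \<omega> / sqrt (real n) - A b / A a * (W a \<omega> / sqrt (real n))"
      by (simp only: G_def ratio q_def grid_def a_def b_def)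
    then show ?thesis
      using A[of a] A[of b] by (simp add: Mart_def A_def[symmetric] right_diff_distrib)
  qed
  define V where "V = {\<omega> \<in> space M. \<exists>j\<in>{a..b}. 2 * h \<le> \<bar>Mart j \<omega> - Mart a \<omega>\<bar>}"
  define V' where "V' = {\<omega> \<in> space M. (e * sqrt (real n) / 2)\<^sup>2 \<le> ((q - 1) * W a \<omega>)\<^sup>2}"
  have [measurable]: "V \<in> events" "V' \<in> events" unfolding V_def V'_def by measurable
  have sub: "osc k n e i \<subseteq> V \<union> V'"
  proof
    fix \<omega> assume "\<omega> \<in> osc k n e i"
    then obtain j where \<omega>: "\<omega> \<in> space M" and j: "j \<in> {a..b}" "e * sqrt (real n) < \<bar>W j \<omega> - W a \<omega>\<bar>"
      by (auto simp: osc_def a_def b_def)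
    have "W j \<omega> - W a \<omega> = A j * (Mart j \<omega> - Mart a \<omega>) + (A j / A a - 1) * W a \<omega>"
      using A[of j] A[of a] by (simp add: Mart_def A_def[symmetric] field_simps)
    then have "\<bar>W j \<omega> - W a \<omega>\<bar> \<le> \<bar>A j * (Mart j \<omega> - Mart a \<omega>)\<bar> + \<bar>(A j / A a - 1) * W a \<omega>\<bar>"
      by (simp only: abs_triangle_ineq)
    also have "\<dots> \<le> A b * \<bar>Mart j \<omega> - Mart a \<omega>\<bar> + (q - 1) * \<bar>W a \<omega>\<bar>"
    proof (intro add_mono)
      have j': "A j \<le> A b" "A a \<le> A j" using j Amono by auto
      then show "\<bar>A j * (Mart j \<omega> - Mart a \<omega>)\<bar> \<le> A b * \<bar>Mart j \<omega> - Mart a \<omega>\<bar>"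
        using A[of j] by (simp add: abs_mult mult_right_mono)
      have "0 \<le> A j / A a - 1" using j' A[of a] by simp
      moreover have "A j / A a - 1 \<le> q - 1" unfolding q_def using j' A[of a] by (simp add: divide_right_mono)
      ultimately show "\<bar>(A j / A a - 1) * W a \<omega>\<bar> \<le> (q - 1) * \<bar>W a \<omega>\<bar>"
        by (simp add: abs_mult mult_right_mono)
    qed
    finally have "e * sqrt (real n) < A b * \<bar>Mart j \<omega> - Mart a \<omega>\<bar> + (q - 1) * \<bar>W a \<omega>\<bar>" using j by linarith
    then consider "e * sqrt (real n) / 2 \<le> A b * \<bar>Mart j \<omega> - Mart a \<omega>\<bar>" | "e * sqrt (real n) / 2 \<le> (q - 1) * \<bar>W a \<omega>\<bar>"
      by linarith
    then show "\<omega> \<in> V \<union> V'"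
    proof cases
      case 1
      then have "2 * h \<le> \<bar>Mart j \<omega> - Mart a \<omega>\<bar>"
        using A[of b] by (simp add: h_def pos_divide_le_eq mult_ac)
      then show ?thesis using \<omega> j by (auto simp: V_def)
    next
      case 2
      then have "(e * sqrt (real n) / 2)\<^sup>2 \<le> ((q - 1) * \<bar>W a \<omega>\<bar>)\<^sup>2"
        using e sn by (intro power_mono) auto
      then show ?thesis using \<omega> by (simp add: V'_def power_mult_distrib)
    qed
  qed
  have V: "prob V \<le> 16 / e\<^sup>2 * expectation (\<lambda>\<omega>. (G \<omega>)\<^sup>2 * of_bool (e / 4 \<le> \<bar>G \<omega>\<bar>))"
  proof -
    have "h\<^sup>2 * prob V \<le> expectation (\<lambda>\<omega>. (Mart b \<omega> - Mart a \<omega>)\<^sup>2 * of_bool (h \<le> \<bar>Mart b \<omega> - Mart a \<omega>\<bar>))"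
      unfolding V_def by (rule martingale_maximal[OF ab h])
    also have "(\<lambda>\<omega>. (Mart b \<omega> - Mart a \<omega>)\<^sup>2 * of_bool (h \<le> \<bar>Mart b \<omega> - Mart a \<omega>\<bar>)) =
       (\<lambda>\<omega>. (sqrt (real n) / A b)\<^sup>2 * ((G \<omega>)\<^sup>2 * of_bool (e / 4 \<le> \<bar>G \<omega>\<bar>)))"
    proof
      fix \<omega>
      define D where "D = Mart b \<omega> - Mart a \<omega>"
      have "e / 4 \<le> \<bar>G \<omega>\<bar> \<longleftrightarrow> h \<le> \<bar>D\<bar>"
        using A[of b] sn unfolding G D_def[symmetric] h_def
        by (simp add: abs_mult pos_divide_le_eq pos_le_divide_eq mult_ac)
      moreover have "(sqrt (real n) / A b)\<^sup>2 * (G \<omega>)\<^sup>2 = D\<^sup>2"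
        using A[of b] sn unfolding G D_def[symmetric] power_mult_distrib[symmetric] by simp
      ultimately show "(Mart b \<omega> - Mart a \<omega>)\<^sup>2 * of_bool (h \<le> \<bar>Mart b \<omega> - Mart a \<omega>\<bar>) =
        (sqrt (real n) / A b)\<^sup>2 * ((G \<omega>)\<^sup>2 * of_bool (e / 4 \<le> \<bar>G \<omega>\<bar>))"
        unfolding D_def[symmetric] by (simp only: mult.assoc[symmetric])
    qed
    also have "expectation \<dots> = (sqrt (real n) / A b)\<^sup>2 * expectation (\<lambda>\<omega>. (G \<omega>)\<^sup>2 * of_bool (e / 4 \<le> \<bar>G \<omega>\<bar>))"
      by simp
    also have "h\<^sup>2 = (sqrt (real n) / A b)\<^sup>2 * (e\<^sup>2 / 16)"
      by (simp add: h_def power_divide power_mult_distrib mult_ac)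
    finally have "e\<^sup>2 / 16 * prob V \<le> expectation (\<lambda>\<omega>. (G \<omega>)\<^sup>2 * of_bool (e / 4 \<le> \<bar>G \<omega>\<bar>))"
      unfolding mult.assoc by (rule mult_left_le_imp_le) (use A[of b] sn in simp)
    then show ?thesis using e by (simp add: pos_le_divide_eq mult_ac)
  qed
  have V': "prob V' \<le> 4 / e\<^sup>2 * ((ratio k n i - 1)\<^sup>2 * expectation (\<lambda>\<omega>. (grid k n \<omega> i)\<^sup>2))"
  proof -
    have i: "integrable M (\<lambda>\<omega>. ((q - 1) * W a \<omega>)\<^sup>2)"
      unfolding power_mult_distrib by (intro integrable_mult_right W_square_integrable)
    have "prob V' \<le> expectation (\<lambda>\<omega>. ((q - 1) * W a \<omega>)\<^sup>2) / (e * sqrt (real n) / 2)\<^sup>2"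
      unfolding V'_def using e sn by (intro integral_Markov_inequality_measure[where A = "{}"] i) auto
    also have "\<dots> = 4 / e\<^sup>2 * ((q - 1)\<^sup>2 * expectation (\<lambda>\<omega>. (grid k n \<omega> i)\<^sup>2))"
    proof -
      have "grid k n \<omega> i = W a \<omega> / sqrt (real n)" for \<omega> by (simp only: grid_def a_def)
      then show ?thesis by (simp add: power_mult_distrib power_divide)
    qed
    finally show ?thesis by (simp add: ratio)
  qed
  have "prob (osc k n e i) \<le> prob (V \<union> V')" by (rule finite_measure_mono[OF sub]) simp
  also have "\<dots> \<le> prob V + prob V'" by (rule measure_Un_le) simp_all
  finally show ?thesis using V V' by linarith
qed

text \<open>The first term comes from the Gaussian fourth moment \<open>3 * v^2\<close> with
  \<open>v \<le> 1 / ((1 - 2 * p) * k)\<close>; the second is the drift, whose growth ratio exceeds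
  one by at most \<open>1 / i\<close>, and which for \<open>i = 0\<close> is \<open>0\<close> as
  \<open>1 / real 0 = 0\<close>.\<close>

lemma prob_osc_limit:
  assumes k: "0 < k" and e: "0 < e" and \<delta>: "0 < \<delta>"
  shows "\<forall>\<^sub>F n in sequentially. prob (osc k n e i) <
    3072 / ((1 - 2 * p)\<^sup>2 * e ^ 4) / (real k)\<^sup>2 + 4 / ((1 - 2 * p) * e\<^sup>2) / real k * (1 / real i) + \<delta>"
proof -
  define s t where "s = real i / real k" and "t = real (Suc i) / real k"
  have st: "0 \<le> s" "s \<le> t" "0 < t" "t - s = 1 / real k" using k
    by (auto simp: s_def t_def divide_right_mono diff_divide_distrib[symmetric])
  have c: "0 < 1 - 2 * p" using p_bounds by simp
  text \<open>For \<open>i = 0\<close> the ratio of growth factors explodes, but it multiplies \<open>W 0 = 0\<close>.\<close>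
  define q where "q n = (if i = 0 then 0 else ratio k n i)" for n
  define \<rho> where "\<rho> = (if i = 0 then 0 else (t / s) powr p)"
  have q: "q \<longlonglongrightarrow> \<rho>"
  proof (cases "i = 0")
    case False
    then have "0 < s" using k by (simp add: s_def)
    from growth_ratio_tendsto[OF p_bounds(1) this st(3)] False show ?thesis
      by (simp add: q_def[abs_def] \<rho>_def ratio_def s_def t_def)
  qed (simp add: q_def[abs_def] \<rho>_def)
  \<comment> \<open>Half the square of the threshold \<open>e / 4\<close>, as the tail estimate
    requires. It equals \<open>e^2 / 32\<close>, whence
    \<open>3072 = 16 * 2 * 3 * 32\<close>.\<close>
  define \<eta> where "\<eta> = (e / 4)\<^sup>2 / 2"
  have \<eta>: "0 < \<eta>" using e by (simp add: \<eta>_def)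
  define G where "G n \<omega> = grid k n \<omega> (Suc i) - q n * grid k n \<omega> i" for n \<omega>
  \<comment> \<open>Weak convergence on the grid applies to a functional not depending on
    \<open>n\<close>, so the coefficient \<open>q n\<close> is replaced by its limit \<rho>.\<close>
  define G' where "G' n \<omega> = grid k n \<omega> (Suc i) - \<rho> * grid k n \<omega> i" for n \<omega>
  define Z where "Z \<omega> = B t \<omega> - \<rho> * B s \<omega>" for \<omega>
  have Gm[measurable]: "G n \<in> borel_measurable M" "G' n \<in> borel_measurable M" for n
    unfolding G_def G'_def by measurable
  have expand: "(x - r * y)\<^sup>2 = x * x - 2 * r * (y * x) + r\<^sup>2 * (y * y)" for x y r :: real
    by (simp add: power2_eq_square algebra_simps)
  have Gi: "integrable M (\<lambda>\<omega>. (G n \<omega>)\<^sup>2)" for n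
    unfolding G_def expand
    by (intro Bochner_Integration.integrable_add Bochner_Integration.integrable_diff integrable_mult_right grid_prod_integrable)
  define \<kappa> where "\<kappa> = limit_cov p"
  define v where "v = \<kappa> t t - 2 * \<rho> * \<kappa> s t + \<rho>\<^sup>2 * \<kappa> s s"
  have EG: "(\<lambda>n. expectation (\<lambda>\<omega>. (G n \<omega>)\<^sup>2)) \<longlonglongrightarrow> v"
  proof -
    have "expectation (\<lambda>\<omega>. (G n \<omega>)\<^sup>2) = expectation (\<lambda>\<omega>. grid k n \<omega> (Suc i) * grid k n \<omega> (Suc i))
       - 2 * q n * expectation (\<lambda>\<omega>. grid k n \<omega> i * grid k n \<omega> (Suc i)) + (q n)\<^sup>2 * expectation (\<lambda>\<omega>. grid k n \<omega> i * grid k n \<omega> i)" for n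
      unfolding G_def expand using grid_prod_integrable by simp
    then show ?thesis
      unfolding v_def \<kappa>_def s_def t_def
      by (simp only:) (intro tendsto_intros q grid_cov_tendsto k; simp)
  qed
  have Zg: "gaussian_variable N Z" "N.expectation Z = 0" "N.expectation (\<lambda>\<omega>. (Z \<omega>)\<^sup>2) = v"
  proof -
    have "inj_on (\<lambda>l. real l / real k) {i, Suc i}" using k by (auto simp: inj_on_def)
    note B = N.B_combination[OF _ _ this, of "\<lambda>l. if l = i then - \<rho> else 1"]
    have Z: "Z = (\<lambda>\<omega>. \<Sum>l\<in>{i, Suc i}. (if l = i then - \<rho> else 1) * B (real l / real k) \<omega>)"
      by (auto simp: Z_def s_def t_def)
    show "gaussian_variable N Z" unfolding Z by (rule B(1)) auto
    show "N.expectation Z = 0" unfolding Z by (rule B(2)) auto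
    have "N.expectation (\<lambda>\<omega>. (Z \<omega>)\<^sup>2) = (\<Sum>l\<in>{i, Suc i}. \<Sum>m\<in>{i, Suc i}. (if l = i then - \<rho> else 1) * (if m = i then - \<rho> else 1) *
        limit_cov p (real l / real k) (real m / real k))" unfolding Z by (rule B(3)) auto
    also have "\<dots> = v"
      using limit_cov_commute[of p t s] by (simp add: v_def \<kappa>_def s_def t_def power2_eq_square)
    finally show "N.expectation (\<lambda>\<omega>. (Z \<omega>)\<^sup>2) = v" .
  qed
  have v0: "0 \<le> v" unfolding Zg(3)[symmetric] by (intro Bochner_Integration.integral_nonneg) simp
  have \<kappa>tt: "\<kappa> u u = u / (1 - 2 * p)" if "0 \<le> u" for u
    using that by (simp add: \<kappa>_def limit_cov_def powr_add[symmetric])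
  \<comment> \<open>For \<open>i > 0\<close>, \<open>Z\<close> is \<open>t powr p\<close> times an
    increment of the limiting martingale \<open>t powr (- p) * B t\<close>. Its variance is
    \<open>(t - x) / (1 - 2 * p)\<close> with \<open>x\<close> between \<open>s\<close> and
    \<open>t\<close>, hence of the order of the block length.\<close>
  have v1: "v \<le> 1 / (real k * (1 - 2 * p))"
  proof (cases "i = 0")
    case True
    then show ?thesis using st k by (simp add: v_def \<rho>_def \<kappa>tt t_def)
  next
    case False
    then have s: "0 < s" using k by (simp add: s_def)
    define x where "x = t powr (2 * p) * s powr (1 - 2 * p)"
    have 1: "\<rho> * \<kappa> s t = x / (1 - 2 * p)"
    proof -
      have "(t / s) powr p * (t powr p * s powr (1 - p)) = (t powr p * t powr p) * (s powr (1 - p) / s powr p)"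
        using s st by (simp add: powr_divide mult_ac)
      also have "\<dots> = x" unfolding x_def using s
        by (simp add: powr_add[symmetric] powr_diff[symmetric] algebra_simps)
      finally show ?thesis using False unfolding \<rho>_def \<kappa>_def limit_cov_le[OF st(2)] by simp
    qed
    have 2: "\<rho>\<^sup>2 * \<kappa> s s = x / (1 - 2 * p)"
    proof -
      have "((t / s) powr p)\<^sup>2 * s = (t powr p * t powr p) * (s powr 1 / (s powr p * s powr p))"
        using s st by (simp add: powr_divide power2_eq_square)
      also have "\<dots> = x" unfolding x_def using s
        by (simp only: powr_add[symmetric] powr_diff[symmetric]) (simp add: algebra_simps)
      finally show ?thesis using False s by (simp add: \<rho>_def \<kappa>tt)
    qed
    have "s = s powr (2 * p) * s powr (1 - 2 * p)" using s by (simp add: powr_add[symmetric])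
    also have "\<dots> \<le> x" unfolding x_def using s st p_bounds by (intro mult_right_mono powr_mono2) auto
    finally have "s \<le> x" .
    have "v = t / (1 - 2 * p) - 2 * (x / (1 - 2 * p)) + x / (1 - 2 * p)"
      unfolding v_def mult.assoc 1 2 using st by (simp add: \<kappa>tt)
    then have "v = (t - x) / (1 - 2 * p)" by (simp add: diff_divide_distrib)
    also have "\<dots> \<le> (t - s) / (1 - 2 * p)" using \<open>s \<le> x\<close> c by (intro divide_right_mono) auto
    finally show ?thesis using st by simp
  qed
  define m where "m = N.expectation (\<lambda>\<omega>. min ((Z \<omega>)\<^sup>2) \<eta>)"
  have Em: "(\<lambda>n. expectation (\<lambda>\<omega>. min ((G n \<omega>)\<^sup>2) \<eta>)) \<longlonglongrightarrow> m"
  proof -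
    have coord: "continuous_on UNIV (\<lambda>x :: nat \<Rightarrow> real. x l)" for l by simp
    have "(\<lambda>n. expectation (\<lambda>\<omega>. min ((grid k n \<omega> (Suc i) - \<rho> * grid k n \<omega> i)\<^sup>2) \<eta>)) \<longlonglongrightarrow>
       N.expectation (\<lambda>\<omega>. min ((B (real (Suc i) / real k) \<omega> - \<rho> * B (real i / real k) \<omega>)\<^sup>2) \<eta>)"
      by (rule grid_convergence[OF k, of "\<lambda>x. min ((x (Suc i) - \<rho> * x i)\<^sup>2) \<eta>" \<eta>])
        (use \<eta> in \<open>auto intro!: continuous_intros coord\<close>)
    then have 1: "(\<lambda>n. expectation (\<lambda>\<omega>. min ((G' n \<omega>)\<^sup>2) \<eta>)) \<longlonglongrightarrow> m"
      by (simp only: G'_def m_def Z_def s_def t_def)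
    have mi: "integrable M (\<lambda>\<omega>. min ((f \<omega>)\<^sup>2) \<eta>)" if [measurable]: "f \<in> borel_measurable M" for f
      by (rule integrable_const_bound[of _ \<eta>]) (use \<eta> in auto)
    have "(\<lambda>n. expectation (\<lambda>\<omega>. min ((G n \<omega>)\<^sup>2) \<eta>) - expectation (\<lambda>\<omega>. min ((G' n \<omega>)\<^sup>2) \<eta>)) \<longlonglongrightarrow> 0"
    proof (rule Lim_null_comparison)
      have "(\<lambda>n. 2 * sqrt \<eta> * \<bar>q n - \<rho>\<bar> * (1 + s / (1 - 2 * p))) \<longlonglongrightarrow> 2 * sqrt \<eta> * \<bar>\<rho> - \<rho>\<bar> * (1 + s / (1 - 2 * p))"
        by (intro tendsto_intros q)
      then show "(\<lambda>n. 2 * sqrt \<eta> * \<bar>q n - \<rho>\<bar> * (1 + s / (1 - 2 * p))) \<longlonglongrightarrow> 0" by simp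
      have "\<bar>expectation (\<lambda>\<omega>. min ((G n \<omega>)\<^sup>2) \<eta>) - expectation (\<lambda>\<omega>. min ((G' n \<omega>)\<^sup>2) \<eta>)\<bar>
         \<le> 2 * sqrt \<eta> * \<bar>q n - \<rho>\<bar> * (1 + s / (1 - 2 * p))" for n
      proof -
        have "\<bar>expectation (\<lambda>\<omega>. min ((G n \<omega>)\<^sup>2) \<eta>) - expectation (\<lambda>\<omega>. min ((G' n \<omega>)\<^sup>2) \<eta>)\<bar>
          = \<bar>expectation (\<lambda>\<omega>. min ((G n \<omega>)\<^sup>2) \<eta> - min ((G' n \<omega>)\<^sup>2) \<eta>)\<bar>"
          using mi[OF Gm(1), of n] mi[OF Gm(2), of n] by simp
        also have "\<dots> \<le> expectation (\<lambda>\<omega>. \<bar>min ((G n \<omega>)\<^sup>2) \<eta> - min ((G' n \<omega>)\<^sup>2) \<eta>\<bar>)"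
          by (rule integral_abs_bound)
        also have "\<dots> \<le> expectation (\<lambda>\<omega>. 2 * sqrt \<eta> * \<bar>q n - \<rho>\<bar> * (1 + (grid k n \<omega> i)\<^sup>2))"
        proof (rule integral_mono)
          fix \<omega>
          have "G n \<omega> - G' n \<omega> = (\<rho> - q n) * grid k n \<omega> i" by (simp add: G_def G'_def algebra_simps)
          then have "\<bar>G n \<omega> - G' n \<omega>\<bar> = \<bar>q n - \<rho>\<bar> * \<bar>grid k n \<omega> i\<bar>" by (simp add: abs_mult abs_minus_commute)
          also have "\<bar>x\<bar> \<le> 1 + x\<^sup>2" for x :: real
          proof -
            have "2 * \<bar>x\<bar> * 1 \<le> \<bar>x\<bar>\<^sup>2 + 1\<^sup>2" by (rule sum_squares_bound)
            then show ?thesis by simp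
          qed
          then have "\<bar>q n - \<rho>\<bar> * \<bar>grid k n \<omega> i\<bar> \<le> \<bar>q n - \<rho>\<bar> * (1 + (grid k n \<omega> i)\<^sup>2)"
            by (intro mult_left_mono) auto
          finally have "\<bar>G n \<omega> - G' n \<omega>\<bar> \<le> \<bar>q n - \<rho>\<bar> * (1 + (grid k n \<omega> i)\<^sup>2)" .
          then have *: "2 * sqrt \<eta> * \<bar>G n \<omega> - G' n \<omega>\<bar> \<le> 2 * sqrt \<eta> * (\<bar>q n - \<rho>\<bar> * (1 + (grid k n \<omega> i)\<^sup>2))"
            using \<eta> by (intro mult_left_mono) auto
          show "\<bar>min ((G n \<omega>)\<^sup>2) \<eta> - min ((G' n \<omega>)\<^sup>2) \<eta>\<bar> \<le> 2 * sqrt \<eta> * \<bar>q n - \<rho>\<bar> * (1 + (grid k n \<omega> i)\<^sup>2)"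
            using order_trans[OF min_square_lipschitz[OF less_imp_le[OF \<eta>]] *] by (simp only: mult.assoc)
        qed (use mi[OF Gm(1), of n] mi[OF Gm(2), of n] grid_square_integrable in auto)
        also have "\<dots> = 2 * sqrt \<eta> * \<bar>q n - \<rho>\<bar> * (1 + expectation (\<lambda>\<omega>. (grid k n \<omega> i)\<^sup>2))"
          using grid_square_integrable by (simp add: prob_space)
        also have "\<dots> \<le> 2 * sqrt \<eta> * \<bar>q n - \<rho>\<bar> * (1 + s / (1 - 2 * p))"
          using grid_second_moment[of k n i] \<eta> by (intro mult_left_mono add_left_mono) (auto simp: s_def)
        finally show ?thesis .
      qed
      then show "\<forall>\<^sub>F n in sequentially. norm (expectation (\<lambda>\<omega>. min ((G n \<omega>)\<^sup>2) \<eta>) - expectation (\<lambda>\<omega>. min ((G' n \<omega>)\<^sup>2) \<eta>))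
         \<le> 2 * sqrt \<eta> * \<bar>q n - \<rho>\<bar> * (1 + s / (1 - 2 * p))" by simp
    qed
    from tendsto_add[OF this 1] show ?thesis by simp
  qed
  have vm: "v - m \<le> 3 * (1 / (real k * (1 - 2 * p)))\<^sup>2 / \<eta>"
  proof -
    note cg = N.centered_gaussian[OF Zg(1,2)]
    have [measurable]: "Z \<in> borel_measurable N" using Zg(1) by (simp add: gaussian_variable_def)
    have mi: "integrable N (\<lambda>\<omega>. min ((Z \<omega>)\<^sup>2) \<eta>)"
      by (rule N.integrable_const_bound[of _ \<eta>]) (use \<eta> in auto)
    have "v - m = N.expectation (\<lambda>\<omega>. (Z \<omega>)\<^sup>2 - min ((Z \<omega>)\<^sup>2) \<eta>)"
      unfolding m_def Zg(3)[symmetric] using mi cg(1) by simp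
    also have "\<dots> \<le> N.expectation (\<lambda>\<omega>. (Z \<omega>) ^ 4 / \<eta>)"
      using mi cg \<eta> by (intro integral_mono square_minus_min_le) auto
    also have "\<dots> = 3 * v\<^sup>2 / \<eta>" using cg(3) by (simp add: Zg(3))
    also have "\<dots> \<le> 3 * (1 / (real k * (1 - 2 * p)))\<^sup>2 / \<eta>"
      using v0 v1 \<eta> by (intro divide_right_mono mult_left_mono power_mono) auto
    finally show ?thesis .
  qed
  define w where "w = (\<rho> - 1)\<^sup>2 * \<kappa> s s"
  have Ew: "(\<lambda>n. (q n - 1)\<^sup>2 * expectation (\<lambda>\<omega>. (grid k n \<omega> i)\<^sup>2)) \<longlonglongrightarrow> w"
    unfolding w_def \<kappa>_def s_def power2_eq_square[of "grid k _ _ i"]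
    by (intro tendsto_intros q grid_cov_tendsto k order_refl)
  have w: "w \<le> 1 / ((1 - 2 * p) * real k) * (1 / real i)"
  proof (cases "i = 0")
    case True
    then show ?thesis by (simp add: w_def s_def \<kappa>tt)
  next
    case False
    then have s: "0 < s" using k by (simp add: s_def)
    have ts: "t / s = 1 + 1 / real i" using False k by (simp add: s_def t_def field_simps)
    have "1 \<le> \<rho>" unfolding \<rho>_def ts using False p_bounds by (simp add: ge_one_powr_ge_zero)
    moreover have "\<rho> \<le> 1 + 1 / real i"
      unfolding \<rho>_def ts using False p_bounds powr_mono[of p 1 "1 + 1 / real i"] by simp
    ultimately have "(\<rho> - 1)\<^sup>2 \<le> (1 / real i)\<^sup>2" by (intro power_mono) auto
    then have "w \<le> (1 / real i)\<^sup>2 * \<kappa> s s"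
      unfolding w_def using s c by (intro mult_right_mono) (auto simp: \<kappa>tt)
    also have "\<dots> = 1 / ((1 - 2 * p) * real k) * (1 / real i)"
      using s False k c by (simp add: \<kappa>tt s_def power2_eq_square)
    finally show ?thesis .
  qed
  define R where "R n = 16 / e\<^sup>2 * (2 * (expectation (\<lambda>\<omega>. (G n \<omega>)\<^sup>2) - expectation (\<lambda>\<omega>. min ((G n \<omega>)\<^sup>2) \<eta>)))
     + 4 / e\<^sup>2 * ((q n - 1)\<^sup>2 * expectation (\<lambda>\<omega>. (grid k n \<omega> i)\<^sup>2))" for n
  have R: "prob (osc k n e i) \<le> R n" if n: "0 < n" for n
  proof -
    have G: "grid k n \<omega> (Suc i) - ratio k n i * grid k n \<omega> i = G n \<omega>" for \<omega>
      by (cases "i = 0") (auto simp: G_def q_def)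
    have qq: "(ratio k n i - 1)\<^sup>2 * expectation (\<lambda>\<omega>. (grid k n \<omega> i)\<^sup>2) = (q n - 1)\<^sup>2 * expectation (\<lambda>\<omega>. (grid k n \<omega> i)\<^sup>2)"
      by (cases "i = 0") (auto simp: q_def)
    have mi: "integrable M (\<lambda>\<omega>. min ((G n \<omega>)\<^sup>2) \<eta>)"
      by (rule integrable_const_bound[of _ \<eta>]) (use \<eta> in auto)
    have ti: "integrable M (\<lambda>\<omega>. (G n \<omega>)\<^sup>2 * of_bool (e / 4 \<le> \<bar>G n \<omega>\<bar>))"
      by (rule Bochner_Integration.integrable_bound[OF Gi[of n]]) auto
    have "expectation (\<lambda>\<omega>. (G n \<omega>)\<^sup>2 * of_bool (e / 4 \<le> \<bar>G n \<omega>\<bar>)) \<le>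
        expectation (\<lambda>\<omega>. 2 * ((G n \<omega>)\<^sup>2 - min ((G n \<omega>)\<^sup>2) \<eta>))"
      unfolding \<eta>_def
      by (intro integral_mono ti square_tail_le integrable_mult_right Bochner_Integration.integrable_diff Gi mi[unfolded \<eta>_def])
        (use e in auto)
    also have "\<dots> = 2 * (expectation (\<lambda>\<omega>. (G n \<omega>)\<^sup>2) - expectation (\<lambda>\<omega>. min ((G n \<omega>)\<^sup>2) \<eta>))"
      using Gi mi by simp
    finally have "16 / e\<^sup>2 * expectation (\<lambda>\<omega>. (G n \<omega>)\<^sup>2 * of_bool (e / 4 \<le> \<bar>G n \<omega>\<bar>)) \<le>
       16 / e\<^sup>2 * (2 * (expectation (\<lambda>\<omega>. (G n \<omega>)\<^sup>2) - expectation (\<lambda>\<omega>. min ((G n \<omega>)\<^sup>2) \<eta>)))"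
      by (intro mult_left_mono) auto
    then show ?thesis
      using prob_osc_le[OF n e, of k i] unfolding G qq R_def by linarith
  qed
  have "R \<longlonglongrightarrow> 16 / e\<^sup>2 * (2 * (v - m)) + 4 / e\<^sup>2 * w"
    unfolding R_def by (intro tendsto_add tendsto_mult_left tendsto_diff EG Em Ew)
  moreover have "16 / e\<^sup>2 * (2 * (v - m)) + 4 / e\<^sup>2 * w <
    3072 / ((1 - 2 * p)\<^sup>2 * e ^ 4) / (real k)\<^sup>2 + 4 / ((1 - 2 * p) * e\<^sup>2) / real k * (1 / real i) + \<delta>"
  proof -
    have "16 / e\<^sup>2 * (2 * (v - m)) \<le> 16 / e\<^sup>2 * (2 * (3 * (1 / (real k * (1 - 2 * p)))\<^sup>2 / \<eta>))"
      using vm by (intro mult_left_mono) auto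
    also have "\<dots> = 3072 / ((1 - 2 * p)\<^sup>2 * e ^ 4) / (real k)\<^sup>2"
      using e by (simp add: \<eta>_def power_divide power_mult_distrib power2_eq_square power4_eq_xxxx mult_ac)
    finally have 1: "16 / e\<^sup>2 * (2 * (v - m)) \<le> 3072 / ((1 - 2 * p)\<^sup>2 * e ^ 4) / (real k)\<^sup>2" .
    have "4 / e\<^sup>2 * w \<le> 4 / e\<^sup>2 * (1 / ((1 - 2 * p) * real k) * (1 / real i))"
      using w by (intro mult_left_mono) auto
    also have "\<dots> = 4 / ((1 - 2 * p) * e\<^sup>2) / real k * (1 / real i)" by (simp add: mult_ac)
    finally show ?thesis using 1 \<delta> by linarith
  qed
  ultimately have "\<forall>\<^sub>F n in sequentially. R n <
    3072 / ((1 - 2 * p)\<^sup>2 * e ^ 4) / (real k)\<^sup>2 + 4 / ((1 - 2 * p) * e\<^sup>2) / real k * (1 / real i) + \<delta>"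
    by (rule order_tendstoD(2))
  then show ?thesis
    using eventually_gt_at_top[of 0] by eventually_elim (rule le_less_trans[OF R])
qed

end


section \<open>Convergence of paths\<close>

text \<open>The summand at \<open>i = 0\<close> is \<open>1 / 0 = 0\<close>. A square root suffices
  in place of the logarithm, since the sum over the \<open>T * k + 1\<close> blocks is divided by
  \<open>k\<close> afterwards.\<close>

lemma sum_inverse_le_sqrt: "(\<Sum>i\<le>m. 1 / real i) \<le> 2 * sqrt (real m)"
proof (induction m)
  case (Suc m)
  have 1: "sqrt (real m) \<le> sqrt (real (Suc m))" by simp
  have 2: "sqrt (real (Suc m)) \<le> real (Suc m)"
    by (rule real_le_lsqrt) (simp_all add: power2_eq_square)
  have "1 = (sqrt (real (Suc m)) - sqrt (real m)) * (sqrt (real (Suc m)) + sqrt (real m))"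
    by (simp add: algebra_simps)
  also have "\<dots> \<le> (sqrt (real (Suc m)) - sqrt (real m)) * (2 * real (Suc m))"
  proof (intro mult_left_mono)
    have "y + x \<le> 2 * z" if "x \<le> y" "y \<le> z" for x y z :: real using that by linarith
    then show "sqrt (real (Suc m)) + sqrt (real m) \<le> 2 * real (Suc m)" using 1 2 by blast
    show "0 \<le> sqrt (real (Suc m)) - sqrt (real m)" using 1 by simp
  qed
  finally have 3: "1 \<le> (sqrt (real (Suc m)) - sqrt (real m)) * (2 * real (Suc m))" .
  have "1 / z \<le> 2 * d" if "1 \<le> d * (2 * z)" "0 < z" for d z :: real
    using that by (simp add: pos_divide_le_eq mult_ac)
  from this[OF 3] have "1 / real (Suc m) \<le> 2 * (sqrt (real (Suc m)) - sqrt (real m))" by simp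
  then show ?case using Suc by simp
qed simp

lemma step_path_measurable:
  assumes "\<And>j. (\<lambda>\<omega>. s \<omega> j) \<in> borel_measurable M" "path_lipschitz L g" "0 \<le> \<kappa>"
  shows "(\<lambda>\<omega>. g (step_path \<kappa> \<beta> (s \<omega>))) \<in> borel_measurable M"
  using measurable_compose[OF measurable_coordinatewise_then_product[of s M, OF assms(1)]
      borel_measurable_continuous_onI[OF continuous_on_step_path[OF assms(2,3), of \<beta>]]] .

section \<open>Discretization of the limit process\<close>

context nrbm
begin

definition B_path :: "'b \<Rightarrow> real \<Rightarrow> real" where
  "B_path \<omega> = (\<lambda>t\<in>{0..}. B t \<omega>)"

definition B_step :: "nat \<Rightarrow> 'b \<Rightarrow> real \<Rightarrow> real" where
  "B_step k \<omega> = step_path (real k) 0 (\<lambda>l. B (real l / real k) \<omega>)"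

lemma B_path_cadlag:
  assumes "\<omega> \<in> space N"
  shows "B_path \<omega> \<in> cadlag_paths"
  unfolding cadlag_paths_def
proof (intro CollectI conjI allI impI)
  show "B_path \<omega> \<in> extensional {0..}" by (simp add: B_path_def)
  have "continuous_on {0..} (B_path \<omega>)"
    unfolding B_path_def by (rule continuous_on_cong[THEN iffD1, OF refl _ B_continuous[OF assms]]) simp
  then have lim: "(B_path \<omega> \<longlongrightarrow> B_path \<omega> t) (at t within {0..})" if "0 \<le> t" for t
    using that by (simp add: continuous_on_def)
  show "(B_path \<omega> \<longlongrightarrow> B_path \<omega> t) (at_right t)" if "0 \<le> t" for t
    by (rule tendsto_within_subset[OF lim[OF that]]) (use that in auto)
  show "\<exists>l. (B_path \<omega> \<longlongrightarrow> l) (at_left t)" if t: "0 < t" for t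
  proof -
    have "at t within {0..} = at t"
      by (rule at_within_interior) (use t in \<open>simp add: interior_Ici\<close>)
    then have "(B_path \<omega> \<longlongrightarrow> B_path \<omega> t) (at_left t)"
      using lim[of t] t by (simp add: filterlim_at_split)
    then show ?thesis by blast
  qed
qed

text \<open>Continuous paths are uniformly continuous on bounded intervals. Continuity of the limit
  enters here and lets the locally uniform distance suffice.\<close>

lemma B_step_tendsto:
  assumes "\<omega> \<in> space N"
  shows "(\<lambda>k. path_dist (B_step k \<omega>) (B_path \<omega>)) \<longlonglongrightarrow> 0"
proof (rule path_dist_tendsto_0)
  fix T :: real assume T: "0 \<le> T"
  have "continuous_on {0..T} (\<lambda>t. B t \<omega>)"
    by (rule continuous_on_subset[OF B_continuous[OF assms]]) auto
  then have uc: "uniformly_continuous_on {0..T} (\<lambda>t. B t \<omega>)"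
    by (rule compact_uniformly_continuous) simp
  show "uniform_limit {0..T} (\<lambda>k. B_step k \<omega>) (B_path \<omega>) sequentially"
    unfolding uniform_limit_iff
  proof (intro allI impI)
    fix e :: real assume "0 < e"
    then obtain d where d: "0 < d"
      "\<And>s t. s \<in> {0..T} \<Longrightarrow> t \<in> {0..T} \<Longrightarrow> dist s t < d \<Longrightarrow> dist (B s \<omega>) (B t \<omega>) < e"
      using uc unfolding uniformly_continuous_on_def by metis
    have "\<forall>\<^sub>F k in sequentially. 1 / real k < d"
      using order_tendstoD(2)[OF lim_1_over_n d(1)] .
    then show "\<forall>\<^sub>F k in sequentially. \<forall>t\<in>{0..T}. dist (B_step k \<omega> t) (B_path \<omega> t) < e"
      using eventually_gt_at_top[of 0]
    proof eventually_elim
      case (elim k)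
      show ?case
      proof
        fix t assume t: "t \<in> {0..T}"
        define l where "l = nat \<lfloor>t * real k\<rfloor>"
        have "0 \<le> t * real k" using t by simp
        then have l: "real l \<le> t * real k" "t * real k < real l + 1" unfolding l_def by linarith+
        have a: "real l / real k \<le> t" using l(1) elim by (simp add: pos_divide_le_eq)
        have "t < (real l + 1) / real k" using l(2) elim by (simp add: pos_less_divide_eq)
        then have b: "t - real l / real k < 1 / real k" by (simp add: add_divide_distrib)
        have "dist (B (real l / real k) \<omega>) (B t \<omega>) < e"
          by (rule d(2)) (use a b t elim in \<open>auto simp: dist_real_def\<close>)
        then show "dist (B_step k \<omega> t) (B_path \<omega> t) < e"
          using t by (simp add: B_step_def B_path_def step_path_def l_def)
      qed
    qed
  qed
qed

lemma B_step_measurable: "path_lipschitz L g \<Longrightarrow> (\<lambda>\<omega>. g (B_step k \<omega>)) \<in> borel_measurable N"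
  unfolding B_step_def by (rule step_path_measurable) (simp_all add: B_measurable)

text \<open>A path functional may involve uncountably many times; step paths read only countably
  many of them, and the functional is the limit of its values on step paths.\<close>

lemma B_path_measurable:
  assumes "path_lipschitz L g"
  shows "(\<lambda>\<omega>. g (B_path \<omega>)) \<in> borel_measurable N"
  by (rule borel_measurable_LIMSEQ_real[where u = "\<lambda>k \<omega>. g (B_step k \<omega>)"])
    (use path_lipschitz_tendsto[OF assms B_step_tendsto] B_step_measurable[OF assms] in auto)

lemma B_step_expectation_tendsto:
  assumes g: "path_lipschitz L g" "\<And>x. \<bar>g x\<bar> \<le> C"
  shows "(\<lambda>k. expectation (\<lambda>\<omega>. g (B_step k \<omega>))) \<longlonglongrightarrow> expectation (\<lambda>\<omega>. g (B_path \<omega>))"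
  by (rule integral_dominated_convergence[where w = "\<lambda>_. C"])
    (use g path_lipschitz_tendsto[OF g(1) B_step_tendsto] B_step_measurable B_path_measurable in auto)

end

context reinforcement_limit
begin

text \<open>Over about \<open>T * k\<close> blocks the terms \<open>K1 / k^2\<close> add up to order
  \<open>1 / k\<close> and the drift terms to order \<open>1 / sqrt k\<close>. The limit in
  \<open>n\<close> is taken first, for fixed \<open>k\<close>.\<close>

lemma prob_osc_union:
  assumes e: "0 < e" and \<delta>: "0 < \<delta>"
  shows "\<forall>\<^sub>F k in sequentially. \<forall>\<^sub>F n in sequentially. prob (\<Union>i\<in>{..T * k}. osc k n e i) < \<delta>"
proof -
  define K1 where "K1 = 3072 / ((1 - 2 * p)\<^sup>2 * e ^ 4)"
  define K2 where "K2 = 4 / ((1 - 2 * p) * e\<^sup>2)"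
  have K2: "0 \<le> K2" using p_bounds by (simp add: K2_def)
  have "(\<lambda>k. real T * K1 * (1 / real k) + K1 * (1 / (real k)\<^sup>2) + 2 * K2 * sqrt (real T) * (sqrt (real k) / real k))
     \<longlonglongrightarrow> real T * K1 * 0 + K1 * 0 + 2 * K2 * sqrt (real T) * 0"
    by (intro tendsto_add tendsto_mult_left) real_asymp+
  then have "\<forall>\<^sub>F k in sequentially. real T * K1 * (1 / real k) + K1 * (1 / (real k)\<^sup>2) +
      2 * K2 * sqrt (real T) * (sqrt (real k) / real k) < \<delta> / 2"
    by (rule order_tendstoD(2)) (use \<delta> in simp)
  then show ?thesis
    using eventually_gt_at_top[of 0]
  proof eventually_elim
    case (elim k)
    define b where "b i = K1 / (real k)\<^sup>2 + K2 / real k * (1 / real i)" for i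
    \<comment> \<open>The slack of each block, such that all \<open>T * k + 1\<close> of them
      together cost \<open>\<delta> / 2\<close>.\<close>
    define \<delta>' where "\<delta>' = \<delta> / (2 * real (Suc (T * k)))"
    have \<delta>': "0 < \<delta>'" unfolding \<delta>'_def using \<delta> by (intro divide_pos_pos mult_pos_pos) (simp_all add: add_pos_nonneg)
    have "(\<Sum>i\<le>T * k. b i) = real (Suc (T * k)) * (K1 / (real k)\<^sup>2) + K2 / real k * (\<Sum>i\<le>T * k. 1 / real i)"
      unfolding b_def sum.distrib sum_distrib_left by simp
    also have "\<dots> \<le> real (Suc (T * k)) * (K1 / (real k)\<^sup>2) + K2 / real k * (2 * sqrt (real (T * k)))"
      using K2 by (intro add_left_mono mult_left_mono sum_inverse_le_sqrt) auto
    also have "\<dots> = real T * K1 * (1 / real k) + K1 * (1 / (real k)\<^sup>2) + 2 * K2 * sqrt (real T) * (sqrt (real k) / real k)"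
      using elim(2) by (simp add: real_sqrt_mult power2_eq_square field_simps)
    finally have b: "(\<Sum>i\<le>T * k. b i) < \<delta> / 2" using elim(1) by linarith
    have "\<forall>\<^sub>F n in sequentially. \<forall>i\<in>{..T * k}. prob (osc k n e i) < b i + \<delta>'"
      unfolding b_def K1_def K2_def
      by (intro eventually_ball_finite ballI prob_osc_limit elim(2) e \<delta>') simp
    then show ?case
    proof eventually_elim
      case (elim n)
      have "prob (\<Union>i\<in>{..T * k}. osc k n e i) \<le> (\<Sum>i\<le>T * k. prob (osc k n e i))"
        by (rule finite_measure_subadditive_finite) auto
      also have "\<dots> \<le> (\<Sum>i\<le>T * k. b i + \<delta>')"
        using elim by (intro sum_mono less_imp_le) auto
      also have "\<dots> = (\<Sum>i\<le>T * k. b i) + real (Suc (T * k)) * \<delta>'" by (simp add: sum.distrib)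
      also have "real (Suc (T * k)) * \<delta>' = \<delta> / 2" unfolding \<delta>'_def by (simp del: of_nat_Suc)
      finally show ?case using b by linarith
    qed
  qed
qed

definition W_path :: "nat \<Rightarrow> 'a \<Rightarrow> real \<Rightarrow> real" where
  "W_path n \<omega> = step_path (real n) 0 (\<lambda>j. W j \<omega> / sqrt (real n))"

definition grid_path :: "nat \<Rightarrow> nat \<Rightarrow> 'a \<Rightarrow> real \<Rightarrow> real" where
  "grid_path k n \<omega> = step_path (real k) 0 (grid k n \<omega>)"

lemma W_path_measurable: "path_lipschitz L g \<Longrightarrow> (\<lambda>\<omega>. g (W_path n \<omega>)) \<in> borel_measurable M"
  unfolding W_path_def by (rule step_path_measurable) auto

lemma grid_path_measurable: "path_lipschitz L g \<Longrightarrow> (\<lambda>\<omega>. g (grid_path k n \<omega>)) \<in> borel_measurable M"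
  unfolding grid_path_def by (rule step_path_measurable) auto

text \<open>At time \<open>t\<close> the grid path shows the walk at the start of the block
  containing \<open>t\<close>, and the walk itself is at an index of that block, so outside the
  oscillation events they differ by at most \<open>e\<close> up to time \<open>T\<close>.\<close>

lemma path_dist_grid_path:
  assumes k: "0 < k" and n: "0 < n" and e: "0 \<le> e" and \<omega>: "\<omega> \<in> space M" "\<omega> \<notin> (\<Union>i\<in>{..T * k}. osc k n e i)"
  shows "path_dist (W_path n \<omega>) (grid_path k n \<omega>) \<le> max e (1 / (1 + real T))"
proof (rule path_dist_le)
  fix t :: real assume t: "0 \<le> t" "t \<le> real T"
  define i where "i = nat \<lfloor>t * real k\<rfloor>"
  define a where "a = nat \<lfloor>real i / real k * real n\<rfloor>"
  define j where "j = nat \<lfloor>t * real n\<rfloor>"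
  have "0 \<le> t * real k" using t by simp
  then have i: "real i \<le> t * real k" "t * real k < real i + 1" unfolding i_def by linarith+
  have "t * real k \<le> real (T * k)" using t by (simp add: mult_right_mono)
  then have "real i \<le> real (T * k)" using i(1) by linarith
  then have iT: "i \<in> {..T * k}" by (simp only: of_nat_le_iff atMost_iff)
  have 1: "real i / real k \<le> t" "t \<le> real (Suc i) / real k"
    using i k by (simp_all add: pos_divide_le_eq pos_le_divide_eq add.commute)
  have "a \<le> j" unfolding a_def j_def using 1 by (intro nat_mono floor_mono mult_right_mono) auto
  moreover have "j \<le> nat \<lfloor>real (Suc i) / real k * real n\<rfloor>"
    unfolding j_def using 1 by (intro nat_mono floor_mono mult_right_mono) auto
  moreover have "\<omega> \<notin> osc k n e i" using \<omega>(2) iT by blast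
  ultimately have "\<not> (e * sqrt (real n) < \<bar>W j \<omega> - W a \<omega>\<bar>)"
    using \<omega>(1) unfolding osc_def a_def by auto
  then have "\<bar>W j \<omega> - W a \<omega>\<bar> / sqrt (real n) \<le> e" using n by (simp add: pos_divide_le_eq)
  moreover have "W_path n \<omega> t - grid_path k n \<omega> t = (W j \<omega> - W a \<omega>) / sqrt (real n)"
    using t by (simp add: W_path_def grid_path_def step_path_def grid_def i_def a_def j_def diff_divide_distrib)
  ultimately show "\<bar>W_path n \<omega> t - grid_path k n \<omega> t\<bar> \<le> e" by simp
qed simp

lemma expectation_W_path_grid_path:
  assumes g: "path_lipschitz L g" "\<And>x. \<bar>g x\<bar> \<le> C" and L: "0 \<le> L"
    and kn: "0 < k" "0 < n" and e: "0 \<le> e" "1 / (1 + real T) \<le> e"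
    and P: "prob (\<Union>i\<in>{..T * k}. osc k n e i) \<le> \<delta>"
  shows "\<bar>expectation (\<lambda>\<omega>. g (W_path n \<omega>)) - expectation (\<lambda>\<omega>. g (grid_path k n \<omega>))\<bar> \<le> L * e + 2 * C * \<delta>"
proof -
  let ?V = "\<Union>i\<in>{..T * k}. osc k n e i"
  have V: "?V \<in> events" by (rule sets.finite_UN) auto
  have C0: "0 \<le> C" using g(2)[of undefined] by linarith
  note [measurable] = W_path_measurable[OF g(1)] grid_path_measurable[OF g(1)]
  have i: "integrable M (\<lambda>\<omega>. g (W_path n \<omega>))" "integrable M (\<lambda>\<omega>. g (grid_path k n \<omega>))"
    using g(2) by (auto intro!: integrable_const_bound[of _ C])
  have iV: "integrable M (\<lambda>\<omega>. 2 * C * indicator ?V \<omega>)"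
    using V by (intro integrable_mult_right integrable_real_indicator) (auto simp: less_top[symmetric])
  have "\<bar>expectation (\<lambda>\<omega>. g (W_path n \<omega>)) - expectation (\<lambda>\<omega>. g (grid_path k n \<omega>))\<bar> =
      \<bar>expectation (\<lambda>\<omega>. g (W_path n \<omega>) - g (grid_path k n \<omega>))\<bar>" using i by simp
  also have "\<dots> \<le> expectation (\<lambda>\<omega>. \<bar>g (W_path n \<omega>) - g (grid_path k n \<omega>)\<bar>)" by (rule integral_abs_bound)
  also have "\<dots> \<le> expectation (\<lambda>\<omega>. L * e + 2 * C * indicator ?V \<omega>)"
  proof (rule integral_mono)
    fix \<omega> assume \<omega>: "\<omega> \<in> space M"
    show "\<bar>g (W_path n \<omega>) - g (grid_path k n \<omega>)\<bar> \<le> L * e + 2 * C * indicator ?V \<omega>"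
    proof (cases "\<omega> \<in> ?V")
      case True
      have "0 \<le> L * e" using L e by simp
      then show ?thesis using True g(2)[of "W_path n \<omega>"] g(2)[of "grid_path k n \<omega>"] by (simp only: indicator_simps)
    next
      case False
      have "\<bar>g (W_path n \<omega>) - g (grid_path k n \<omega>)\<bar> \<le> L * path_dist (W_path n \<omega>) (grid_path k n \<omega>)"
        using g(1) by (simp add: path_lipschitz_def)
      also have "\<dots> \<le> L * max e (1 / (1 + real T))"
        using L by (intro mult_left_mono path_dist_grid_path[OF kn e(1) \<omega> False]) auto
      also have "\<dots> = L * e" using e by (simp add: max_absorb1)
      finally show ?thesis using False by simp
    qed
  qed (use i iV in auto)
  also have "\<dots> = L * e + 2 * C * prob ?V"
    using V by (subst Bochner_Integration.integral_add[OF _ iV]) (simp_all add: prob_space)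
  also have "\<dots> \<le> L * e + 2 * C * \<delta>" using P C0 by (intro add_left_mono mult_left_mono) auto
  finally show ?thesis .
qed

theorem W_path_convergence:
  assumes g: "path_lipschitz L g" "\<And>x. \<bar>g x\<bar> \<le> C" and L: "0 \<le> L"
  shows "(\<lambda>n. expectation (\<lambda>\<omega>. g (W_path n \<omega>))) \<longlonglongrightarrow> N.expectation (\<lambda>\<omega>. g (N.B_path \<omega>))"
proof (rule LIMSEQ_I)
  fix r :: real assume r: "0 < r"
  have C0: "0 \<le> C" using g(2)[of undefined] by linarith
  \<comment> \<open>The error \<open>r\<close> is shared equally by the Lipschitz cost
    \<open>L * e\<close>, the exceptional event with \<open>2 * C * \<delta>\<close>, the
    convergence on the grid and the discretization of the limit. The summands \<open>+ 1\<close>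
    guard against \<open>L = 0\<close> and \<open>C = 0\<close>.\<close>
  define e where "e = r / (4 * (L + 1))"
  have e: "0 < e" using r L by (simp add: e_def)
  have Le: "L * e \<le> r / 4"
  proof -
    have "c * (r / (4 * c)) = r / 4" if "0 < c" for c using that by simp
    from this[of "L + 1"] have "(L + 1) * e = r / 4" using L by (simp only: e_def)
    moreover have "L * e \<le> (L + 1) * e" using e by (intro mult_right_mono) auto
    ultimately show ?thesis by simp
  qed
  obtain T :: nat where "1 / e \<le> real T" using real_arch_simple by blast
  then have "1 \<le> e * (1 + real T)" using e by (simp add: pos_divide_le_eq distrib_left mult.commute)
  then have T: "1 / (1 + real T) \<le> e" by (simp add: pos_divide_le_eq)
  define \<delta> where "\<delta> = r / (8 * (C + 1))"
  have \<delta>: "0 < \<delta>" using r C0 by (simp add: \<delta>_def)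
  have C\<delta>: "2 * C * \<delta> \<le> r / 4"
  proof -
    have "2 * c * (r / (8 * c)) = r / 4" if "0 < c" for c using that by simp
    from this[of "C + 1"] have "2 * (C + 1) * \<delta> = r / 4" using C0 by (simp only: \<delta>_def)
    moreover have "2 * C * \<delta> \<le> 2 * (C + 1) * \<delta>" using \<delta> by (intro mult_right_mono) auto
    ultimately show ?thesis by simp
  qed
  have "\<forall>\<^sub>F k in sequentially. 0 < k \<and> \<bar>N.expectation (\<lambda>\<omega>. g (N.B_step k \<omega>)) - N.expectation (\<lambda>\<omega>. g (N.B_path \<omega>))\<bar> < r / 4 \<and>
      (\<forall>\<^sub>F n in sequentially. prob (\<Union>i\<in>{..T * k}. osc k n e i) < \<delta>)"
    using tendstoD[OF N.B_step_expectation_tendsto[OF g], of "r / 4"] r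
    by (intro eventually_conj eventually_gt_at_top prob_osc_union e \<delta>) (simp add: dist_real_def)
  then obtain k where k: "0 < k"
    "\<bar>N.expectation (\<lambda>\<omega>. g (N.B_step k \<omega>)) - N.expectation (\<lambda>\<omega>. g (N.B_path \<omega>))\<bar> < r / 4"
    "\<forall>\<^sub>F n in sequentially. prob (\<Union>i\<in>{..T * k}. osc k n e i) < \<delta>"
    by (auto dest: eventually_happens)
  have "(\<lambda>n. expectation (\<lambda>\<omega>. g (grid_path k n \<omega>))) \<longlonglongrightarrow> N.expectation (\<lambda>\<omega>. g (N.B_step k \<omega>))"
    unfolding grid_path_def N.B_step_def
    by (rule grid_convergence[OF k(1), of "\<lambda>s. g (step_path (real k) 0 s)" C])
      (use g in \<open>auto intro: continuous_on_step_path\<close>)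
  then have "\<forall>\<^sub>F n in sequentially. \<bar>expectation (\<lambda>\<omega>. g (grid_path k n \<omega>)) - N.expectation (\<lambda>\<omega>. g (N.B_step k \<omega>))\<bar> < r / 4"
    using tendstoD[of _ _ _ "r / 4"] r by (force simp: dist_real_def)
  then have "\<forall>\<^sub>F n in sequentially. norm (expectation (\<lambda>\<omega>. g (W_path n \<omega>)) - N.expectation (\<lambda>\<omega>. g (N.B_path \<omega>))) < r"
    using k(3) eventually_gt_at_top[of 0]
  proof eventually_elim
    case (elim n)
    have "\<bar>expectation (\<lambda>\<omega>. g (W_path n \<omega>)) - expectation (\<lambda>\<omega>. g (grid_path k n \<omega>))\<bar> \<le> L * e + 2 * C * \<delta>"
      by (rule expectation_W_path_grid_path[OF g L k(1) _ _ T]) (use elim e in auto)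
    then show ?case using elim(1) k(2) Le C\<delta> unfolding real_norm_def by linarith
  qed
  then show "\<exists>n0. \<forall>n\<ge>n0. norm (expectation (\<lambda>\<omega>. g (W_path n \<omega>)) - N.expectation (\<lambda>\<omega>. g (N.B_path \<omega>))) < r"
    by (simp add: eventually_sequentially)
qed

end

section \<open>From the standardized walk to the general one\<close>

lemma reinforcement_data_map:
  assumes data: "reinforcement_data p \<mu> M X \<epsilon> U" and f: "f \<in> borel_measurable borel"
  shows "reinforcement_data p (distr \<mu> borel f) M (\<lambda>i \<omega>. f (X i \<omega>)) \<epsilon> U"
proof -
  interpret prob_space M using data by (simp add: reinforcement_data_def)
  have ind: "indep_vars (\<lambda>_. borel) X {1..}" using data by (simp add: reinforcement_data_def)
  have Xm: "X i \<in> borel_measurable M" if "1 \<le> i" for i using ind that by (simp add: indep_vars_def)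
  have dX: "distr M borel (X i) = \<mu>" if "1 \<le> i" for i using data that by (simp add: reinforcement_data_def)
  have 1: "indep_vars (\<lambda>_. borel) (\<lambda>i \<omega>. f (X i \<omega>)) {1..}"
    by (rule indep_vars_compose2[OF ind]) (rule f)
  have 2: "distr M borel (\<lambda>\<omega>. f (X i \<omega>)) = distr \<mu> borel f" if "1 \<le> i" for i
    unfolding dX[OF that, symmetric] by (subst distr_distr) (use f Xm[OF that] in \<open>auto simp: comp_def\<close>)
  have sub: "generated_events M {1..} borel (\<lambda>i \<omega>. f (X i \<omega>)) \<subseteq> generated_events M {1..} borel X"
    unfolding generated_events_def
  proof (rule sigma_sets_mono, rule UN_least, rule subsetI)
    fix i S assume i: "i \<in> {1..}" and "S \<in> {(\<lambda>\<omega>. f (X i \<omega>)) -` A \<inter> space M | A. A \<in> sets borel}"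
    then obtain A where A: "S = (\<lambda>\<omega>. f (X i \<omega>)) -` A \<inter> space M" "A \<in> sets borel" by auto
    have "S = X i -` (f -` A) \<inter> space M" using A by auto
    moreover have "f -` A \<in> sets borel" using measurable_sets[OF f A(2)] by simp
    ultimately show "S \<in> sigma_sets (space M) (\<Union>i\<in>{1..}. {X i -` A \<inter> space M | A. A \<in> sets borel})"
      using i by (intro sigma_sets.Basic) auto
  qed
  have 3: "indep_sets (\<lambda>k. [generated_events M {1..} borel (\<lambda>i \<omega>. f (X i \<omega>)),
             generated_events M {2..} (count_space UNIV) \<epsilon>,
             generated_events M {2..} (count_space UNIV) U] ! k) {..<3::nat}"
  proof (rule indep_sets_mono_sets)
    show "indep_sets (\<lambda>k. [generated_events M {1..} borel X,
             generated_events M {2..} (count_space UNIV) \<epsilon>,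
             generated_events M {2..} (count_space UNIV) U] ! k) {..<3::nat}"
      using data by (simp add: reinforcement_data_def)
    fix k :: nat assume "k \<in> {..<3}"
    then have "k = 0 \<or> k = 1 \<or> k = 2" by auto
    then show "[generated_events M {1..} borel (\<lambda>i \<omega>. f (X i \<omega>)),
             generated_events M {2..} (count_space UNIV) \<epsilon>,
             generated_events M {2..} (count_space UNIV) U] ! k \<subseteq>
       [generated_events M {1..} borel X,
             generated_events M {2..} (count_space UNIV) \<epsilon>,
             generated_events M {2..} (count_space UNIV) U] ! k"
      using sub by auto
  qed
  show ?thesis using data 1 2 3 unfolding reinforcement_data_def by simp
qed

theorem theorem3p3:
  fixes p :: real
    and K :: "'k measure" and X :: "'k \<Rightarrow> real"
    and M :: "'a measure" and S :: "nat \<Rightarrow> 'a \<Rightarrow> real"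
    and N :: "'b measure" and B :: "real \<Rightarrow> 'b \<Rightarrow> real"
  assumes "0 < p" and "p < 1 / 2"
    and "prob_space K" and "X \<in> borel_measurable K"
    and "\<not> (\<exists>c. AE x in K. X x = c)"
    and "integrable K (\<lambda>x. (X x)\<^sup>2)"
    and "step_reinforced_random_walk p (distr K borel X) M S"
    and "noise_reinforced_brownian_motion p N B"
  shows "converges_in_distribution skorokhod_topology
    M (\<lambda>n \<omega>. \<lambda>t\<in>{0..}.
         (S (nat \<lfloor>t * real n\<rfloor>) \<omega> - t * real n * prob_space.expectation K X)
           / sqrt (real n * prob_space.variance K X))
    N (\<lambda>\<omega>. \<lambda>t\<in>{0..}. B t \<omega>)"
proof -
  interpret K: prob_space K by fact
  note [measurable] = \<open>X \<in> borel_measurable K\<close>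
  define m where "m = K.expectation X"
  define V where "V = K.variance X"
  define \<sigma> where "\<sigma> = sqrt V"
  have X1: "integrable K X" by (rule K.square_integrable_imp_integrable) (use assms in auto)
  have X2: "integrable K (\<lambda>x. (X x - m)\<^sup>2)"
    unfolding power2_diff using X1 assms(6) by simp
  have V: "0 < V"
  proof (rule ccontr)
    assume "\<not> 0 < V"
    moreover have "0 \<le> V" unfolding V_def by (intro Bochner_Integration.integral_nonneg) simp
    ultimately have "V = 0" by linarith
    then have "K.expectation (\<lambda>x. (X x - m)\<^sup>2) = 0" by (simp only: V_def m_def)
    then have "AE x in K. (X x - m)\<^sup>2 = 0"
      by (subst (asm) integral_nonneg_eq_0_iff_AE[OF X2]) auto
    then have "AE x in K. X x = m" by simp
    then show False using assms(5) by blast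
  qed
  have \<sigma>: "0 < \<sigma>" "\<sigma>\<^sup>2 = V" using V by (simp_all add: \<sigma>_def)
  obtain X0 \<epsilon> U where data: "reinforcement_data p (distr K borel X) M X0 \<epsilon> U"
    and S: "\<And>n \<omega>. \<omega> \<in> space M \<Longrightarrow>
        S n \<omega> = (\<Sum>i=1..n. reinforced (\<lambda>j. X0 j \<omega>) (\<lambda>j. \<epsilon> j \<omega>) (\<lambda>j. U j \<omega>) i)"
    using assms(7) unfolding step_reinforced_random_walk_def by blast
  define f where "f x = (x - m) / \<sigma>" for x
  have fm[measurable]: "f \<in> borel_measurable borel" unfolding f_def by measurable
  define \<mu> where "\<mu> = distr (distr K borel X) borel f"
  define X' where "X' i \<omega> = f (X0 i \<omega>)" for i \<omega>
  have data': "reinforcement_data p \<mu> M X' \<epsilon> U"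
    unfolding \<mu>_def X'_def[abs_def] by (rule reinforcement_data_map[OF data fm])
  interpret M: prob_space M using data by (simp add: reinforcement_data_def)
  interpret R: reinforcement M p \<mu> X' \<epsilon> U
    by unfold_locales (use assms data' in auto)
  have \<mu>: "\<mu> = distr K borel (\<lambda>x. f (X x))"
    unfolding \<mu>_def by (subst distr_distr) (auto simp: comp_def)
  have int: "(integrable M (\<lambda>\<omega>. h (X' i \<omega>)) \<longleftrightarrow> integrable K (\<lambda>x. h (f (X x)))) \<and>
     M.expectation (\<lambda>\<omega>. h (X' i \<omega>)) = K.expectation (\<lambda>x. h (f (X x)))"
    if "1 \<le> i" and [measurable]: "h \<in> borel_measurable borel" for h :: "real \<Rightarrow> real" and i
  proof -
    have [measurable]: "X' i \<in> borel_measurable M" by (rule R.X_measurable) fact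
    have "distr M borel (X' i) = distr K borel (\<lambda>x. f (X x))" using R.distr_X[OF that(1)] \<mu> by simp
    moreover have "(integrable M (\<lambda>\<omega>. h (X' i \<omega>)) \<longleftrightarrow> integrable (distr M borel (X' i)) h)"
      "M.expectation (\<lambda>\<omega>. h (X' i \<omega>)) = integral\<^sup>L (distr M borel (X' i)) h"
      by (simp_all add: integrable_distr_eq integral_distr)
    moreover have "(integrable K (\<lambda>x. h (f (X x))) \<longleftrightarrow> integrable (distr K borel (\<lambda>x. f (X x))) h)"
      "K.expectation (\<lambda>x. h (f (X x))) = integral\<^sup>L (distr K borel (\<lambda>x. f (X x))) h"
      by (simp_all add: integrable_distr_eq integral_distr)
    ultimately show ?thesis by simp
  qed
  interpret L: standard_reinforcement M p \<mu> X' \<epsilon> U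
  proof unfold_locales
    show "0 < p" "p < 1 / 2" by fact+
    fix i :: nat assume i: "1 \<le> i"
    have "K.expectation (\<lambda>x. f (X x)) = 0" using X1 by (simp add: f_def m_def K.prob_space)
    then show "M.expectation (X' i) = 0" using int[OF i, of "\<lambda>x. x"] by simp
    have sq: "(\<lambda>x. (f (X x))\<^sup>2) = (\<lambda>x. (X x - m)\<^sup>2 / V)" using \<sigma> by (simp add: f_def power_divide)
    show "integrable M (\<lambda>\<omega>. (X' i \<omega>)\<^sup>2)"
      using int[OF i, of "\<lambda>x. x\<^sup>2"] X2 by (simp add: sq)
    have "K.expectation (\<lambda>x. (f (X x))\<^sup>2) = 1" unfolding sq using V by (simp add: V_def m_def)
    then show "M.expectation (\<lambda>\<omega>. (X' i \<omega>)\<^sup>2) = 1"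
      using int[OF i, of "\<lambda>x. x\<^sup>2"] by simp
  qed
  interpret NB: nrbm p N B
    by unfold_locales fact+
  interpret L: reinforcement_limit M p \<mu> X' \<epsilon> U N B
    by unfold_locales
  have SW: "S j \<omega> = \<sigma> * L.W j \<omega> + real j * m" if "\<omega> \<in> space M" for j \<omega>
  proof -
    have "reinforced (\<lambda>j. X0 j \<omega>) e u i = \<sigma> * reinforced (\<lambda>j. X' j \<omega>) e u i + m" for e u i
      using \<sigma> by (simp add: reinforced_root_step X'_def f_def)
    then show ?thesis unfolding S[OF that] L.W_def by (simp add: sum.distrib sum_distrib_left)
  qed
  define d where "d n = sqrt (real n * V)" for n
  have d: "d n = \<sigma> * sqrt (real n)" for n by (simp add: d_def \<sigma>_def real_sqrt_mult)
  \<comment> \<open>The centring is taken at \<open>t * n\<close> and not at its floor; this linear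
    part is the drift of the step path. At \<open>n = 0\<close> all quotients by
    \<open>d 0 = 0\<close> vanish.\<close>
  define Y where "Y n \<omega> = step_path (real n) (- (real n * m) / d n) (\<lambda>j. S j \<omega> / d n)" for n \<omega>
  have Y_eq: "(\<lambda>t\<in>{0..}. (S (nat \<lfloor>t * real n\<rfloor>) \<omega> - t * real n * m) / sqrt (real n * V)) = Y n \<omega>" for n \<omega>
    unfolding Y_def step_path_def d_def[symmetric] by (intro restrict_ext) (simp add: diff_divide_distrib mult_ac)
  \<comment> \<open>\<open>S\<close> is described only on \<open>space M\<close>; its measurability
    is inherited from \<open>W\<close>, with which it agrees there up to an affine map.\<close>
  have Sm: "(\<lambda>\<omega>. S j \<omega> / d n) \<in> borel_measurable M" for j n
    by (subst measurable_cong[of M "\<lambda>\<omega>. S j \<omega> / d n" "\<lambda>\<omega>. (\<sigma> * L.W j \<omega> + real j * m) / d n"]) (simp_all add: SW)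
  \<comment> \<open>The two paths differ only by the centring at \<open>t * n\<close> instead of its
    floor, by less than one step of size \<open>m\<close>; this bound is uniform over all
    times.\<close>
  have close: "path_dist (Y n \<omega>) (L.W_path n \<omega>) \<le> \<bar>m\<bar> / \<sigma> * (1 / sqrt (real n))" if \<omega>: "\<omega> \<in> space M" and n: "0 < n" for n \<omega>
  proof (rule path_dist_least)
    fix t :: real assume t: "0 \<le> t"
    let ?j = "nat \<lfloor>t * real n\<rfloor>"
    have "Y n \<omega> t - L.W_path n \<omega> t = (real ?j - t * real n) * m / (\<sigma> * sqrt (real n))"
      using t \<sigma> n unfolding Y_def L.W_path_def step_path_def SW[OF \<omega>] d
      by (simp add: add_divide_distrib diff_divide_distrib left_diff_distrib right_diff_distrib mult_ac)
    also have "\<bar>\<dots>\<bar> = \<bar>real ?j - t * real n\<bar> * \<bar>m\<bar> / (\<sigma> * sqrt (real n))"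
      using \<sigma> by (simp add: abs_mult)
    also have "\<dots> \<le> 1 * \<bar>m\<bar> / (\<sigma> * sqrt (real n))"
    proof (intro divide_right_mono mult_right_mono)
      have "0 \<le> t * real n" using t by simp
      then show "\<bar>real ?j - t * real n\<bar> \<le> 1" by linarith
    qed (use \<sigma> in auto)
    finally have "\<bar>Y n \<omega> t - L.W_path n \<omega> t\<bar> \<le> \<bar>m\<bar> / \<sigma> * (1 / sqrt (real n))" by simp
    then show "min \<bar>Y n \<omega> t - L.W_path n \<omega> t\<bar> (1 / (1 + t)) \<le> \<bar>m\<bar> / \<sigma> * (1 / sqrt (real n))" by simp
  qed
  have Ym: "(\<lambda>\<omega>. g (Y n \<omega>)) \<in> borel_measurable M" if "path_lipschitz l g" for l g n
    unfolding Y_def using Sm that by (intro step_path_measurable) auto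
  have "converges_in_distribution skorokhod_topology M Y N NB.B_path"
  proof (rule converges_in_distribution_lipschitz[OF M.prob_space_axioms NB.prob_space_axioms])
    show "Y n \<omega> \<in> cadlag_paths" for n \<omega> unfolding Y_def by (rule step_path_cadlag) simp
    show "NB.B_path \<omega> \<in> cadlag_paths" if "\<omega> \<in> space N" for \<omega> by (rule NB.B_path_cadlag[OF that])
    fix l :: real and g assume l: "0 \<le> l" and g: "path_lipschitz l g"
    show "(\<lambda>\<omega>. g (Y n \<omega>)) \<in> borel_measurable M" for n by (rule Ym[OF g])
    show "(\<lambda>\<omega>. g (NB.B_path \<omega>)) \<in> borel_measurable N" by (rule NB.B_path_measurable[OF g])
    fix C assume C: "\<And>x. \<bar>g x\<bar> \<le> C"
    have i: "integrable M (\<lambda>\<omega>. g (Y n \<omega>))" "integrable M (\<lambda>\<omega>. g (L.W_path n \<omega>))" for n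
      using C Ym[OF g] L.W_path_measurable[OF g] by (auto intro!: M.integrable_const_bound[of _ C])
    have "(\<lambda>n. M.expectation (\<lambda>\<omega>. g (Y n \<omega>)) - M.expectation (\<lambda>\<omega>. g (L.W_path n \<omega>))) \<longlonglongrightarrow> 0"
    proof (rule Lim_null_comparison)
      have "(\<lambda>n. 1 / sqrt (real n)) \<longlonglongrightarrow> 0" by real_asymp
      then show "(\<lambda>n. l * (\<bar>m\<bar> / \<sigma> * (1 / sqrt (real n)))) \<longlonglongrightarrow> 0"
        by (intro tendsto_mult_right_zero)
      show "\<forall>\<^sub>F n in sequentially. norm (M.expectation (\<lambda>\<omega>. g (Y n \<omega>)) - M.expectation (\<lambda>\<omega>. g (L.W_path n \<omega>)))
          \<le> l * (\<bar>m\<bar> / \<sigma> * (1 / sqrt (real n)))"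
        using eventually_gt_at_top[of 0]
      proof eventually_elim
        case (elim n)
        have "norm (M.expectation (\<lambda>\<omega>. g (Y n \<omega>)) - M.expectation (\<lambda>\<omega>. g (L.W_path n \<omega>))) =
            \<bar>M.expectation (\<lambda>\<omega>. g (Y n \<omega>) - g (L.W_path n \<omega>))\<bar>" using i by simp
        also have "\<dots> \<le> M.expectation (\<lambda>\<omega>. \<bar>g (Y n \<omega>) - g (L.W_path n \<omega>)\<bar>)" by (rule integral_abs_bound)
        also have "\<dots> \<le> M.expectation (\<lambda>_. l * (\<bar>m\<bar> / \<sigma> * (1 / sqrt (real n))))"
        proof (rule integral_mono)
          fix \<omega> assume \<omega>: "\<omega> \<in> space M"
          have "\<bar>g (Y n \<omega>) - g (L.W_path n \<omega>)\<bar> \<le> l * path_dist (Y n \<omega>) (L.W_path n \<omega>)"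
            using g by (simp add: path_lipschitz_def)
          also have "\<dots> \<le> l * (\<bar>m\<bar> / \<sigma> * (1 / sqrt (real n)))"
            by (intro mult_left_mono close \<omega> elim l)
          finally show "\<bar>g (Y n \<omega>) - g (L.W_path n \<omega>)\<bar> \<le> l * (\<bar>m\<bar> / \<sigma> * (1 / sqrt (real n)))" .
        qed (use i in auto)
        finally show ?case by (simp add: M.prob_space)
      qed
    qed
    from tendsto_add[OF this L.W_path_convergence[OF g C l]]
    show "(\<lambda>n. M.expectation (\<lambda>\<omega>. g (Y n \<omega>))) \<longlonglongrightarrow> NB.expectation (\<lambda>\<omega>. g (NB.B_path \<omega>))" by simp
  qed
  then show ?thesis
    unfolding V_def[symmetric] unfolding m_def[symmetric] Y_eq NB.B_path_def[abs_def] .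
qed

end
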